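(* Let $\eta$ be a real number with $\eta<\dfrac{1}{32+4\sqrt{41}}$ (where $1/(32+4\sqrt{41})\approx 0.017357\ldots$). Then there exist a constant $C>0$ and $N_0\in\mathbb{N}$ such that for every $N\ge N_0$ and every set $\mathcal{P}_N\subset[0,1)^3$ consisting of $N$ points, the star discrepancy of $\mathcal{P}_N$ satisfies $$D_N^{\ast}\;\ge\; C(\log N)^{1+\eta}.$$
   Context: For a set $\mathcal{P}_N$ of $N$ points in $[0,1)^d$, the (unnormalized) discrepancy function is $D_N(x)=N\lambda_d([0,x))-\#(\mathcal{P}_N\cap[0,x))$ for $x=(x_1,\dots,x_d)\in[0,1)^d$, where $\lambda_d$ is $d$-dimensional Lebesgue measure and $[0,x)=[0,x_1)\times\cdots\times[0,x_d)$. The (unnormalized) star discrepancy is $D_N^{\ast}=\sup_{x\in[0,1)^d}|D_N(x)|$. Here $d=3$. *)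

theory Defs
  imports "HOL-Analysis.Analysis"
begin

text \<open>
  The dimension $d$ is the cardinality of the index type.  The product order on
  \<^typ>\<open>real^'d\<close> is not linear, so a half-open interval for that order is not the half-open
  box \<open>[a\<^sub>1,b\<^sub>1) \<times> \<dots> \<times> [a\<^sub>d,b\<^sub>d)\<close>; the strict inequality is required in every coordinate.
\<close>

definition half_open_box :: "real^'d \<Rightarrow> real^'d \<Rightarrow> (real^'d) set" where
  "half_open_box a b = {y. \<forall>i. a $ i \<le> y $ i \<and> y $ i < b $ i}"

definition unit_cube :: "(real^'d) set" where
  "unit_cube = half_open_box 0 (\<chi> i. 1)"

text \<open>The point set \<open>P\<close> is meant to be finite, and \<open>N = card P\<close>.\<close>

definition discrepancy :: "(real^'d) set \<Rightarrow> real^'d \<Rightarrow> real" where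
  "discrepancy P x =
     real (card P) * measure lebesgue (half_open_box 0 x) - real (card (P \<inter> half_open_box 0 x))"

definition star_discrepancy :: "(real^'d) set \<Rightarrow> real" where
  "star_discrepancy P = (SUP x\<in>unit_cube. \<bar>discrepancy P x\<bar>)"

text \<open>The supremum is taken over a nonempty set of reals that is bounded above.\<close>

lemma zero_in_unit_cube: "0 \<in> unit_cube"
  by (simp add: unit_cube_def half_open_box_def)

lemma bdd_above_discrepancy:
  fixes P :: "(real^'d) set"
  assumes "finite P"
  shows "bdd_above ((\<lambda>x. \<bar>discrepancy P x\<bar>) ` unit_cube)"
proof (rule bdd_aboveI2)
  fix x :: "real^'d" assume x: "x \<in> unit_cube"
  have eq: "half_open_box 0 x = (\<Inter>i. {y. 0 \<le> y $ i} \<inter> {y. y $ i < x $ i})"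
    by (auto simp: half_open_box_def)
  have "half_open_box 0 x \<in> sets borel"
    unfolding eq
    by (intro sets.countable_INT' sets.Int borel_closed borel_open closed_Collect_le
        open_Collect_less continuous_intros) auto
  then have meas: "half_open_box 0 x \<in> sets lebesgue"
    by simp
  have sub: "half_open_box 0 x \<subseteq> cbox 0 (\<chi> i. 1)"
    using x by (force simp: half_open_box_def unit_cube_def mem_box_cart intro: less_imp_le less_trans)
  have "measure lebesgue (half_open_box 0 x) \<le> measure lebesgue (cbox (0::real^'d) (\<chi> i. 1))"
    by (intro measure_mono_fmeasurable sub meas) auto
  also have "\<dots> = 1"
    by (simp add: measure_completion content_cbox_cart interval_eq_empty_cart not_less)
  finally have "measure lebesgue (half_open_box 0 x) \<le> 1" .
  then have "real (card P) * measure lebesgue (half_open_box 0 x) \<le> real (card P)"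
    by (simp add: mult_left_le)
  moreover have "real (card (P \<inter> half_open_box 0 x)) \<le> real (card P)"
    using assms by (simp add: card_mono)
  moreover have "0 \<le> real (card P) * measure lebesgue (half_open_box 0 x)"
    by simp
  ultimately show "\<bar>discrepancy P x\<bar> \<le> real (card P)"
    unfolding discrepancy_def by linarith
qed

end

theory Submission
  imports Defs "HOL-Computational_Algebra.Polynomial"
begin

text \<open>
  The proof is by duality.  Let \<open>N\<close> be the number of points.  On a grid of \<open>2\<^sup>L\<close> points per coordinate, with \<open>2 N \<le> 2 ^ (L - 1) \<le> 4 N\<close>,
  a test function \<open>T\<close> is built whose mean \<open>avg |T|\<close> is bounded by an absolute constant and whose pairing
  with the discrepancy function \<open>D\<close> is at least \<open>c G L\<close>, where \<open>G\<close> is about \<open>L ^ (1/57)\<close>.  Then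
  \<open>sup |D| \<ge> avg (D T) / avg |T|\<close> gives the theorem, because \<open>1/57\<close> exceeds \<open>1 / (32 + 4 sqrt 41)\<close>.

  For \<open>a + u < L\<close> let \<open>f a u\<close> be a function with values \<open>1\<close> and \<open>-1\<close>
  of dyadic levels \<open>a\<close>, \<open>u\<close>, \<open>L - 1 - a - u\<close> in the three coordinates (an r-function): on every dyadic
  box of these levels it is a product of three Rademacher functions, with the sign for which it
  correlates nonnegatively with \<open>D\<close>.  At least half of the boxes contain no point, and each of them contributes the
  Haar coefficient of the volume.  Hence \<open>avg (D f) \<ge> 1/512\<close> (\<open>avg_rfun_ge\<close>).  There are about
  \<open>L\<^sup>2 / 2\<close> such functions.

  The functions \<open>f a u\<close> on one line (fixed \<open>a\<close>) have distinct levels in the second and in the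
  third coordinate.  With \<open>\<tau> = 1 / sqrt L\<close>, the function \<open>\<Theta>\<^sub>a = Im (\<Prod>u. 1 + \<i> \<tau> f a u)\<close> is bounded
  (a device of Halasz) and has linear part \<open>\<tau> (\<Sum>u. f a u)\<close>.  Put \<open>\<gamma> = G / sqrt L\<close>.  The product
  \<open>\<Psi> = \<Prod>a. 1 + \<gamma> \<Theta>\<^sub>a\<close> is positive and has mean one, since \<open>\<Theta>\<^sub>a\<close> is odd in digit \<open>a\<close> of the
  first coordinate while the factors with smaller index do not see that digit.  Its linear part pairs with \<open>D\<close> to
  about \<open>\<gamma> \<tau> L\<^sup>2 = G L\<close>.  A longer product pairs with \<open>D\<close> to something small if it is odd in its top digit in every
  coordinate; but distinct lines may share second or third levels, so the top digit of a product need not survive.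

  \<open>T\<close> consists of those terms of \<open>\<Psi>\<close> that are odd in their top second digit \<open>v\<close>
  and in their top third digit \<open>w\<close>.  Let \<open>b\<close> be the top first level.  The part with \<open>b + v + w < L - 1\<close> vanishes, the
  part with \<open>b + v + w = L - 1\<close> is \<open>(G / L) f b v\<close>, and the part with \<open>b + v + w = L - 1 + j\<close> is
  bounded by a constant times \<open>\<gamma> (G / L) (1 + 8 \<gamma>) ^ j\<close> and pairs with \<open>D\<close> to at most \<open>2 ^ - j\<close> times
  that.  As \<open>\<gamma>\<close> is small, the diagonal wins (\<open>pairing_lower\<close>).

  Let \<open>\<Psi>(v, z, w, s)\<close> be the Riesz product restricted to second levels below \<open>v\<close>
  and third levels below \<open>w\<close>, where terms of second level \<open>v\<close> are added with a marker \<open>z\<close> and terms of third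
  level \<open>w\<close> with a marker \<open>s\<close>.  The terms odd in both top digits are extracted by the sum of \<open>z s \<Psi>\<close> over signs.
  Telescoping over \<open>v\<close> and \<open>w\<close> expresses \<open>T\<close> by \<open>\<Psi> - 1\<close> and by the sums
  \<open>h\<^sub>w(s) = \<Sum>v. (\<Psi>(v, 1, w, s) + \<Psi>(v, -1, w, s)) / 2 - \<Psi>(v, 0, w, s)\<close> of terms even in digit \<open>v\<close>,
  their mirror image under exchange of the second and third coordinate, and the even parts in \<open>s\<close> of the \<open>h\<^sub>w\<close>
  (\<open>testf_eq\<close>).  The last are recovered from complex \<open>s\<close> with \<open>|s| = sqrt L / G\<close> by a quadrature
  whose weights have total mass \<open>2 G\<^sup>2 / L\<close> (\<open>even_quadrature\<close>).  Summation over \<open>w\<close> costs \<open>L\<close>, so it suffices that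
  \<open>avg |h\<^sub>w(s)| \<le> K / G\<^sup>2\<close> for all these \<open>s\<close> (\<open>avg_even_sum_le\<close>).

  The coefficient of \<open>z\<^sup>2\<close> dominates \<open>h\<close>.  For a single \<open>v\<close> its mean is of order
  \<open>G\<^sup>2 / L\<close>, which is too large by \<open>G\<^sup>4\<close> when summed over \<open>v\<close>.  The missing factor is the square root of the length
  \<open>l = G\<^sup>8\<close> of a group of consecutive \<open>v\<close>.  Means are estimated through the weighted norm
  \<open>avg (|H|\<^sup>2 / \<psi>\<^sub>m)\<close>, \<open>\<psi>\<^sub>m\<close> being the product of the first \<open>m\<close> factors at the beginning of the group.  In this
  norm, passing from \<open>m\<close> to \<open>m + 1\<close> is free and increments odd in digit \<open>m\<close> add up as squares (\<open>wnorm_step\<close>).  What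
  remains is the sum over \<open>m\<close> of the squared norms of \<open>\<Sum>v. f m v E\<^sub>v\<close>, with \<open>E\<^sub>v\<close> the slowly varying first-order coefficients.
  Over a block of \<open>b\<close> consecutive \<open>m\<close> the columns \<open>(f m v)\<^sub>m\<close> are nearly orthogonal: \<open>\<Sum>m. f m v * f m v'\<close> is a
  martingale in the third coordinate, so it exceeds \<open>b / l\<close> with probability at most
  \<open>2 exp (- b / (4 l\<^sup>2))\<close>.  For \<open>b\<close> about \<open>G ^ 18 sqrt L\<close> this beats the crude bound
  \<open>exp (O (G sqrt L))\<close> for all quantities involved, and a large sieve inequality finishes the estimate.
\<close>

section \<open>Averages and weighted norms\<close>

definition avg :: "'x set \<Rightarrow> ('x \<Rightarrow> real) \<Rightarrow> real" where
  "avg A g = (\<Sum>x\<in>A. g x) / real (card A)"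

lemma avg_cong: "(\<And>x. x \<in> A \<Longrightarrow> g x = h x) \<Longrightarrow> avg A g = avg A h"
  by (simp add: avg_def)

lemma avg_mono: "(\<And>x. x \<in> A \<Longrightarrow> g x \<le> h x) \<Longrightarrow> avg A g \<le> avg A h"
  by (simp add: avg_def divide_right_mono sum_mono)

lemma avg_nonneg: "(\<And>x. x \<in> A \<Longrightarrow> 0 \<le> g x) \<Longrightarrow> 0 \<le> avg A g"
  by (simp add: avg_def sum_nonneg)

lemma avg_add: "avg A (\<lambda>x. g x + h x) = avg A g + avg A h"
  by (simp add: avg_def sum.distrib add_divide_distrib)

lemma avg_diff: "avg A (\<lambda>x. g x - h x) = avg A g - avg A h"
  by (simp add: avg_def sum_subtractf diff_divide_distrib)

lemma avg_cmult: "avg A (\<lambda>x. c * g x) = c * avg A g"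
  by (simp add: avg_def sum_distrib_left)

lemma avg_cmult_right: "avg A (\<lambda>x. g x * c) = avg A g * c"
  by (simp add: avg_def sum_distrib_right)

lemma avg_sum: "avg A (\<lambda>x. \<Sum>i\<in>I. g i x) = (\<Sum>i\<in>I. avg A (g i))"
  unfolding avg_def by (subst sum.swap) (simp add: sum_divide_distrib)

lemma avg_const: "finite A \<Longrightarrow> A \<noteq> {} \<Longrightarrow> avg A (\<lambda>_. c) = c"
  by (simp add: avg_def)

lemma avg_flip:
  assumes "bij_betw \<phi> A A"
  shows "avg A (\<lambda>x. g (\<phi> x)) = avg A g"
  unfolding avg_def using sum.reindex_bij_betw[OF assms, of g] by simp

lemma avg_odd:
  assumes "bij_betw \<phi> A A" "\<And>x. x \<in> A \<Longrightarrow> g (\<phi> x) = - g x"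
  shows "avg A g = 0"
proof -
  have "avg A g = avg A (\<lambda>x. g (\<phi> x))" using avg_flip[OF assms(1)] by metis
  also have "\<dots> = avg A (\<lambda>x. (-1) * g x)" using assms(2) by (intro avg_cong) simp
  also have "\<dots> = - avg A g" by (subst avg_cmult) simp
  finally show ?thesis by simp
qed

text \<open>Cauchy--Schwarz for the factors \<open>g / sqrt \<psi>\<close> and \<open>sqrt \<psi>\<close>.\<close>

lemma avg_mult_le:
  assumes "\<And>x. x \<in> A \<Longrightarrow> 0 < \<psi> x"
  shows "(avg A g)\<^sup>2 \<le> avg A (\<lambda>x. (g x)\<^sup>2 / \<psi> x) * avg A \<psi>"
proof -
  have "(\<Sum>x\<in>A. g x)\<^sup>2 = (\<Sum>x\<in>A. (g x / sqrt (\<psi> x)) * sqrt (\<psi> x))\<^sup>2"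
    using assms by (intro arg_cong[where f="\<lambda>t. t\<^sup>2"] sum.cong) (auto dest: less_imp_neq[symmetric])
  also have "\<dots> \<le> (\<Sum>x\<in>A. (g x / sqrt (\<psi> x))\<^sup>2) * (\<Sum>x\<in>A. (sqrt (\<psi> x))\<^sup>2)"
    by (rule Cauchy_Schwarz_ineq_sum)
  also have "\<dots> = (\<Sum>x\<in>A. (g x)\<^sup>2 / \<psi> x) * (\<Sum>x\<in>A. \<psi> x)"
    using assms by (intro arg_cong2[where f="(*)"] sum.cong) (auto simp: power_divide less_imp_le)
  finally show ?thesis
    by (simp add: avg_def power_divide power2_eq_square divide_right_mono)
qed

text \<open>The square of a norm relative to a density \<open>\<psi>\<close>.  If \<open>\<psi>\<close> has mean one then it dominates
  the square of the mean of \<open>|H|\<close>, and \<open>\<psi>\<close> itself has norm one although its maximum may be huge.\<close>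

definition wnorm :: "'x set \<Rightarrow> ('x \<Rightarrow> real) \<Rightarrow> ('x \<Rightarrow> complex) \<Rightarrow> real" where
  "wnorm A \<psi> H = avg A (\<lambda>x. (cmod (H x))\<^sup>2 / \<psi> x)"

lemma wnorm_cong: "(\<And>x. x \<in> A \<Longrightarrow> H x = H' x) \<Longrightarrow> wnorm A \<psi> H = wnorm A \<psi> H'"
  unfolding wnorm_def by (intro avg_cong) simp

lemma wnorm_nonneg: "(\<And>x. x \<in> A \<Longrightarrow> 0 < \<psi> x) \<Longrightarrow> 0 \<le> wnorm A \<psi> H"
  unfolding wnorm_def by (intro avg_nonneg) (simp add: less_imp_le)

text \<open>The Pythagorean step.  In the expansion of \<open>|p H + Y|\<^sup>2 / (\<psi> p)\<close> the cross term and the excess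
  \<open>(p - 1) |H|\<^sup>2 / \<psi>\<close> are odd under the flip \<open>\<phi>\<close> and average out.  So multiplication by \<open>p\<close> costs nothing, and
  the odd increment \<open>Y\<close> enters quadratically.\<close>

lemma wnorm_step:
  assumes bij: "bij_betw \<phi> A A"
    and psi: "\<And>x. x \<in> A \<Longrightarrow> 0 < \<psi> x" "\<And>x. x \<in> A \<Longrightarrow> \<psi> (\<phi> x) = \<psi> x"
    and H: "\<And>x. x \<in> A \<Longrightarrow> H (\<phi> x) = H x"
    and Y: "\<And>x. x \<in> A \<Longrightarrow> Y (\<phi> x) = - Y x"
    and p: "\<And>x. x \<in> A \<Longrightarrow> 1/2 \<le> p x" "\<And>x. x \<in> A \<Longrightarrow> p (\<phi> x) - 1 = - (p x - 1)"
  shows "wnorm A (\<lambda>x. \<psi> x * p x) (\<lambda>x. of_real (p x) * H x + Y x)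
    \<le> wnorm A \<psi> H + 2 * wnorm A \<psi> Y"
proof -
  define o1 where "o1 = (\<lambda>x. (p x - 1) * ((cmod (H x))\<^sup>2 / \<psi> x) + 2 * Re (cnj (H x) * Y x) / \<psi> x)"
  have eq: "(cmod (of_real (p x) * H x + Y x))\<^sup>2 / (\<psi> x * p x)
     = (cmod (H x))\<^sup>2 / \<psi> x + o1 x + (cmod (Y x))\<^sup>2 / (\<psi> x * p x)" if "x \<in> A" for x
  proof -
    have p0: "p x > 0" using p(1)[OF that] by simp
    have ps: "\<psi> x > 0" using psi(1)[OF that] .
    have "(cmod (of_real (p x) * H x + Y x))\<^sup>2 =
       (p x)\<^sup>2 * (cmod (H x))\<^sup>2 + 2 * p x * Re (cnj (H x) * Y x) + (cmod (Y x))\<^sup>2"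
      unfolding cmod_power2 by (simp add: power2_eq_square algebra_simps)
    then show ?thesis using p0 ps unfolding o1_def
      by (simp add: divide_simps) (simp add: algebra_simps power2_eq_square)
  qed
  have odd: "avg A o1 = 0"
  proof (rule avg_odd[OF bij])
    fix x assume x: "x \<in> A"
    show "o1 (\<phi> x) = - o1 x"
      unfolding o1_def p(2)[OF x] psi(2)[OF x] H[OF x] Y[OF x]
      by (simp add: algebra_simps add_divide_distrib diff_divide_distrib)
  qed
  have "wnorm A (\<lambda>x. \<psi> x * p x) (\<lambda>x. of_real (p x) * H x + Y x)
    = avg A (\<lambda>x. (cmod (H x))\<^sup>2 / \<psi> x + o1 x + (cmod (Y x))\<^sup>2 / (\<psi> x * p x))"
    unfolding wnorm_def by (intro avg_cong eq)
  also have "\<dots> = wnorm A \<psi> H + avg A (\<lambda>x. (cmod (Y x))\<^sup>2 / (\<psi> x * p x))"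
    by (simp add: avg_add odd wnorm_def)
  also have "avg A (\<lambda>x. (cmod (Y x))\<^sup>2 / (\<psi> x * p x)) \<le> avg A (\<lambda>x. 2 * ((cmod (Y x))\<^sup>2 / \<psi> x))"
  proof (rule avg_mono)
    fix x assume x: "x \<in> A"
    have "1 / p x \<le> 2" using p(1)[OF x] by (simp add: divide_simps)
    then have "(cmod (Y x))\<^sup>2 / \<psi> x * (1 / p x) \<le> (cmod (Y x))\<^sup>2 / \<psi> x * 2"
      using psi(1)[OF x] by (intro mult_left_mono) simp_all
    then show "(cmod (Y x))\<^sup>2 / (\<psi> x * p x) \<le> 2 * ((cmod (Y x))\<^sup>2 / \<psi> x)" by (simp add: mult.commute)
  qed
  also have "\<dots> = 2 * wnorm A \<psi> Y" unfolding avg_cmult wnorm_def by (rule refl)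
  finally show ?thesis by simp
qed

lemma wnorm_add_le:
  assumes "\<And>x. x \<in> A \<Longrightarrow> 0 < \<psi> x"
  shows "wnorm A \<psi> (\<lambda>x. Y x + Z x) \<le> 2 * wnorm A \<psi> Y + 2 * wnorm A \<psi> Z"
proof -
  have "wnorm A \<psi> (\<lambda>x. Y x + Z x) \<le> avg A (\<lambda>x. 2 * ((cmod (Y x))\<^sup>2 / \<psi> x) + 2 * ((cmod (Z x))\<^sup>2 / \<psi> x))"
    unfolding wnorm_def
  proof (rule avg_mono)
    fix x assume x: "x \<in> A"
    have "(cmod (Y x + Z x))\<^sup>2 \<le> (cmod (Y x) + cmod (Z x))\<^sup>2"
      by (intro power_mono norm_triangle_ineq) simp
    also have "\<dots> \<le> 2 * (cmod (Y x))\<^sup>2 + 2 * (cmod (Z x))\<^sup>2"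
      using sum_squares_bound[of "cmod (Y x)" "cmod (Z x)"] by (simp add: power2_sum)
    finally have "(cmod (Y x + Z x))\<^sup>2 / \<psi> x \<le> (2 * (cmod (Y x))\<^sup>2 + 2 * (cmod (Z x))\<^sup>2) / \<psi> x"
      using assms[OF x] by (intro divide_right_mono) simp_all
    then show "(cmod (Y x + Z x))\<^sup>2 / \<psi> x \<le> 2 * ((cmod (Y x))\<^sup>2 / \<psi> x) + 2 * ((cmod (Z x))\<^sup>2 / \<psi> x)"
      by (simp add: add_divide_distrib)
  qed
  also have "\<dots> = 2 * wnorm A \<psi> Y + 2 * wnorm A \<psi> Z"
    unfolding avg_add avg_cmult wnorm_def by (rule refl)
  finally show ?thesis .
qed

lemma wnorm_mult_le:
  assumes "\<And>x. x \<in> A \<Longrightarrow> 0 < \<psi> x" "\<And>x. x \<in> A \<Longrightarrow> cmod (D x) \<le> d"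
  shows "wnorm A \<psi> (\<lambda>x. D x * H x) \<le> d\<^sup>2 * wnorm A \<psi> H"
proof -
  have "wnorm A \<psi> (\<lambda>x. D x * H x) \<le> avg A (\<lambda>x. d\<^sup>2 * ((cmod (H x))\<^sup>2 / \<psi> x))"
    unfolding wnorm_def
  proof (rule avg_mono)
    fix x assume x: "x \<in> A"
    have "(cmod (D x * H x))\<^sup>2 = (cmod (D x))\<^sup>2 * (cmod (H x))\<^sup>2" by (simp add: norm_mult power_mult_distrib)
    also have "\<dots> \<le> d\<^sup>2 * (cmod (H x))\<^sup>2" using assms(2)[OF x] by (intro mult_right_mono power_mono) simp_all
    finally have "(cmod (D x * H x))\<^sup>2 / \<psi> x \<le> (d\<^sup>2 * (cmod (H x))\<^sup>2) / \<psi> x"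
      using assms(1)[OF x] by (intro divide_right_mono) simp_all
    then show "(cmod (D x * H x))\<^sup>2 / \<psi> x \<le> d\<^sup>2 * ((cmod (H x))\<^sup>2 / \<psi> x)" by simp
  qed
  then show ?thesis unfolding avg_cmult wnorm_def .
qed

lemma wnorm_sum_le:
  assumes "\<And>x. x \<in> A \<Longrightarrow> 0 < \<psi> x" "finite V"
  shows "wnorm A \<psi> (\<lambda>x. \<Sum>v\<in>V. H v x) \<le> real (card V) * (\<Sum>v\<in>V. wnorm A \<psi> (H v))"
proof -
  have "wnorm A \<psi> (\<lambda>x. \<Sum>v\<in>V. H v x) \<le> avg A (\<lambda>x. real (card V) * (\<Sum>v\<in>V. (cmod (H v x))\<^sup>2 / \<psi> x))"
    unfolding wnorm_def
  proof (rule avg_mono)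
    fix x assume x: "x \<in> A"
    have "(cmod (\<Sum>v\<in>V. H v x))\<^sup>2 \<le> (\<Sum>v\<in>V. cmod (H v x) * 1)\<^sup>2"
      using norm_sum[of "\<lambda>v. H v x" V] by (intro power_mono) simp_all
    also have "\<dots> \<le> (\<Sum>v\<in>V. (cmod (H v x))\<^sup>2) * (\<Sum>v\<in>V. 1\<^sup>2)"
      by (rule Cauchy_Schwarz_ineq_sum)
    finally have "(cmod (\<Sum>v\<in>V. H v x))\<^sup>2 \<le> real (card V) * (\<Sum>v\<in>V. (cmod (H v x))\<^sup>2)"
      by (simp add: mult.commute)
    then have "(cmod (\<Sum>v\<in>V. H v x))\<^sup>2 / \<psi> x \<le> real (card V) * (\<Sum>v\<in>V. (cmod (H v x))\<^sup>2) / \<psi> x"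
      using assms(1)[OF x] by (intro divide_right_mono) simp_all
    then show "(cmod (\<Sum>v\<in>V. H v x))\<^sup>2 / \<psi> x \<le> real (card V) * (\<Sum>v\<in>V. (cmod (H v x))\<^sup>2 / \<psi> x)"
      by (simp only: sum_divide_distrib times_divide_eq_right[symmetric])
  qed
  also have "\<dots> = real (card V) * (\<Sum>v\<in>V. wnorm A \<psi> (H v))"
    unfolding avg_cmult avg_sum wnorm_def by (rule refl)
  finally show ?thesis .
qed

section \<open>Digit flips, martingales and Riesz measures\<close>

lemma exp_plus_exp_minus_le: "(exp y + exp (- y)) / 2 \<le> exp (y\<^sup>2)" for y :: real
proof -
  have main: "(exp y + exp (- y)) / 2 \<le> exp (y\<^sup>2)" if y: "0 \<le> y" for y :: real
  proof (cases "y \<le> 1")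
    case True
    have 1: "exp y \<le> 1 + y + y\<^sup>2" using exp_bound[OF y True] .
    have "exp (- y) = 1 / exp y" by (simp add: exp_minus divide_inverse)
    also have "\<dots> \<le> 1 / (1 + y)" using y by (intro divide_left_mono) (auto simp: exp_ge_add_one_self)
    also have "\<dots> \<le> 1 - y + y\<^sup>2"
    proof -
      have "(1 - y + y\<^sup>2) * (1 + y) = 1 + y ^ 3" by (simp add: algebra_simps power2_eq_square power3_eq_cube)
      then show ?thesis using y by (simp add: divide_le_eq)
    qed
    finally have "(exp y + exp (- y)) / 2 \<le> 1 + y\<^sup>2" using 1 by simp
    then show ?thesis using exp_ge_add_one_self[of "y\<^sup>2"] by linarith
  next
    case False
    have "exp (- y) \<le> exp y" using y by simp
    then have "(exp y + exp (- y)) / 2 \<le> exp y" by simp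
    also have "\<dots> \<le> exp (y\<^sup>2)" using False by (simp add: power2_eq_square)
    finally show ?thesis .
  qed
  show ?thesis
  proof (cases "0 \<le> y")
    case False
    then have "(exp (-y) + exp (- (-y))) / 2 \<le> exp ((-y)\<^sup>2)" by (intro main) simp
    then show ?thesis by (simp add: add.commute)
  qed (rule main)
qed

text \<open>The map \<open>fl k\<close> reverses binary digit \<open>k\<close> of one coordinate, digit \<open>0\<close> being the most significant.
  A function of dyadic level \<open>m\<close> in that coordinate ignores the digits after \<open>m\<close> and is odd in digit \<open>m\<close>.\<close>

locale digits =
  fixes A :: "'x set" and fl :: "nat \<Rightarrow> 'x \<Rightarrow> 'x" and L :: nat
  assumes finA: "finite A" and neA: "A \<noteq> {}"
    and bij_fl: "k < L \<Longrightarrow> bij_betw (fl k) A A"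
begin

definition inv_from :: "nat \<Rightarrow> ('x \<Rightarrow> 'b) \<Rightarrow> bool" where
  "inv_from m H \<longleftrightarrow> (\<forall>k x. m \<le> k \<longrightarrow> k < L \<longrightarrow> x \<in> A \<longrightarrow> H (fl k x) = H x)"

definition odd_at :: "nat \<Rightarrow> ('x \<Rightarrow> 'b::ab_group_add) \<Rightarrow> bool" where
  "odd_at m H \<longleftrightarrow> (\<forall>x\<in>A. H (fl m x) = - H x)"

lemma inv_fromD: "inv_from m H \<Longrightarrow> m \<le> k \<Longrightarrow> k < L \<Longrightarrow> x \<in> A \<Longrightarrow> H (fl k x) = H x"
  by (auto simp: inv_from_def)

lemma odd_atD: "odd_at m H \<Longrightarrow> x \<in> A \<Longrightarrow> H (fl m x) = - H x"
  by (auto simp: odd_at_def)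

lemma inv_from_mono: "inv_from m H \<Longrightarrow> m \<le> m' \<Longrightarrow> inv_from m' H"
  unfolding inv_from_def using le_trans by blast

lemma inv_from_const: "inv_from m (\<lambda>x. c)" by (simp add: inv_from_def)

lemma inv_from_comp: "inv_from m H \<Longrightarrow> inv_from m (\<lambda>x. g (H x))"
  by (simp add: inv_from_def)

lemma inv_from_comp2: "inv_from m H \<Longrightarrow> inv_from m H' \<Longrightarrow> inv_from m (\<lambda>x. g (H x) (H' x))"
  by (simp add: inv_from_def)

lemma inv_from_sum: "(\<And>i. i \<in> I \<Longrightarrow> inv_from m (H i)) \<Longrightarrow> inv_from m (\<lambda>x. \<Sum>i\<in>I. H i x)"
  unfolding inv_from_def by (auto intro!: sum.cong)

lemma inv_from_prod: "(\<And>i. i \<in> I \<Longrightarrow> inv_from m (H i)) \<Longrightarrow> inv_from m (\<lambda>x. \<Prod>i\<in>I. H i x)"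
  unfolding inv_from_def by (auto intro!: prod.cong)

lemmas inv_from_add = inv_from_comp2[where g = "(+)"]
  and inv_from_diff = inv_from_comp2[where g = "(-)"]
  and inv_from_mult = inv_from_comp2[where g = "(*)"]
  and inv_from_divide = inv_from_comp2[where g = "(/)"]

lemma odd_at_add: "odd_at m H \<Longrightarrow> odd_at m H' \<Longrightarrow> odd_at m (\<lambda>x. H x + H' x)"
  by (simp add: odd_at_def)

lemma odd_at_diff: "odd_at m H \<Longrightarrow> odd_at m H' \<Longrightarrow> odd_at m (\<lambda>x. H x - H' x)"
  by (simp add: odd_at_def)

lemma odd_at_sum: "(\<And>i. i \<in> I \<Longrightarrow> odd_at m (H i)) \<Longrightarrow> odd_at m (\<lambda>x. \<Sum>i\<in>I. H i x)"
  by (simp add: odd_at_def sum_negf)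

lemma odd_at_mult_inv:
  fixes H H' :: "'x \<Rightarrow> 'b::comm_ring"
  shows "odd_at m H \<Longrightarrow> inv_from m H' \<Longrightarrow> m < L \<Longrightarrow> odd_at m (\<lambda>x. H x * H' x)"
  by (simp add: odd_at_def inv_from_def)

lemma avg_odd_at: "odd_at m g \<Longrightarrow> m < L \<Longrightarrow> avg A g = 0"
  using avg_odd[OF bij_fl] odd_atD by metis

text \<open>The summand of the finest level is averaged out first, since the others ignore its digit; each
  step costs \<open>exp (\<theta>\<^sup>2)\<close> because \<open>cosh y \<le> exp (y\<^sup>2)\<close>.  The levels decrease with the index because third
  levels of r-functions decrease when the first level grows.\<close>

lemma exp_moment_le:
  fixes d :: "nat \<Rightarrow> 'x \<Rightarrow> real"
  assumes "finite M"
    and "\<And>m. m \<in> M \<Longrightarrow> lev m < L"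
    and "\<And>m m'. m \<in> M \<Longrightarrow> m' \<in> M \<Longrightarrow> m < m' \<Longrightarrow> lev m' < lev m"
    and "\<And>m. m \<in> M \<Longrightarrow> odd_at (lev m) (d m)"
    and "\<And>m. m \<in> M \<Longrightarrow> inv_from (Suc (lev m)) (d m)"
    and "\<And>m x. m \<in> M \<Longrightarrow> x \<in> A \<Longrightarrow> \<bar>d m x\<bar> \<le> 1"
  shows "avg A (\<lambda>x. exp (\<theta> * (\<Sum>m\<in>M. d m x))) \<le> exp (\<theta>\<^sup>2 * real (card M))"
  using assms
proof (induction M rule: finite_linorder_min_induct)
  case empty
  then show ?case using avg_const[OF finA neA] by simp
next
  case (insert b M)
  have bM: "b \<notin> M" using insert.hyps(2) by auto
  define S where "S = (\<lambda>x. exp (\<theta> * (\<Sum>m\<in>M. d m x)))"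
  define k where "k = lev b"
  have kL: "k < L" using insert.prems(1)[of b] by (simp add: k_def)
  have lt: "Suc (lev m) \<le> k" if "m \<in> M" for m
    using insert.prems(2)[of b m] insert.hyps(2) that by (simp add: k_def Suc_le_eq)
  have Sinv: "inv_from k S"
    unfolding S_def
    by (intro inv_from_comp[where g="\<lambda>t. exp (\<theta> * t)"] inv_from_sum)
       (use insert.prems(4) lt inv_from_mono in blast)
  have IH: "avg A S \<le> exp (\<theta>\<^sup>2 * real (card M))"
    unfolding S_def by (rule insert.IH) (use insert.prems in \<open>blast+\<close>)
  define g where "g = (\<lambda>x. exp (\<theta> * (\<Sum>m\<in>insert b M. d m x)))"
  have g: "g x = exp (\<theta> * d b x) * S x" for x
    unfolding g_def S_def using bM insert.hyps(1) by (simp add: distrib_left exp_add)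
  have "avg A g = (avg A g + avg A (\<lambda>x. g (fl k x))) / 2"
    using avg_flip[OF bij_fl[OF kL], of g] by simp
  also have "\<dots> = avg A (\<lambda>x. (g x + g (fl k x)) * (1/2))"
    unfolding avg_cmult_right avg_add by simp
  also have "\<dots> \<le> avg A (\<lambda>x. exp (\<theta>\<^sup>2) * S x)"
  proof (rule avg_mono)
    fix x assume x: "x \<in> A"
    have d: "d b (fl k x) = - d b x" using insert.prems(3)[of b] x by (simp add: k_def odd_at_def)
    have Sx: "S (fl k x) = S x" using inv_fromD[OF Sinv order_refl kL x] .
    have "(g x + g (fl k x)) * (1/2) = (exp (\<theta> * d b x) + exp (- (\<theta> * d b x))) / 2 * S x"
      unfolding g d Sx by (simp add: algebra_simps)
    also have "\<dots> \<le> exp ((\<theta> * d b x)\<^sup>2) * S x"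
      by (intro mult_right_mono exp_plus_exp_minus_le) (simp add: S_def)
    also have "\<dots> \<le> exp (\<theta>\<^sup>2) * S x"
    proof (intro mult_right_mono)
      have "(d b x)\<^sup>2 \<le> 1" using insert.prems(5)[of b x] x by (simp add: abs_square_le_1)
      then show "exp ((\<theta> * d b x)\<^sup>2) \<le> exp (\<theta>\<^sup>2)"
        by (simp add: power_mult_distrib mult_left_le)
    qed (simp add: S_def)
    finally show "(g x + g (fl k x)) * (1/2) \<le> exp (\<theta>\<^sup>2) * S x" .
  qed
  also have "\<dots> = exp (\<theta>\<^sup>2) * avg A S" by (rule avg_cmult)
  also have "\<dots> \<le> exp (\<theta>\<^sup>2) * exp (\<theta>\<^sup>2 * real (card M))" using IH by simp
  also have "\<dots> = exp (\<theta>\<^sup>2 * real (card (insert b M)))"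
    using bM insert.hyps(1) by (simp add: exp_add[symmetric] algebra_simps)
  finally show ?case unfolding g_def .
qed

text \<open>Chernoff's bound from the exponential moment at the optimal \<open>\<theta> = t / (2 c)\<close>.\<close>

lemma azuma:
  fixes d :: "nat \<Rightarrow> 'x \<Rightarrow> real"
  assumes M: "finite M" "real (card M) \<le> c" and c: "0 < c" and t: "0 \<le> t"
    and lev: "\<And>m. m \<in> M \<Longrightarrow> lev m < L"
    "\<And>m m'. m \<in> M \<Longrightarrow> m' \<in> M \<Longrightarrow> m < m' \<Longrightarrow> lev m' < lev m"
    and d: "\<And>m. m \<in> M \<Longrightarrow> odd_at (lev m) (d m)"
    "\<And>m. m \<in> M \<Longrightarrow> inv_from (Suc (lev m)) (d m)"
    "\<And>m x. m \<in> M \<Longrightarrow> x \<in> A \<Longrightarrow> \<bar>d m x\<bar> \<le> 1"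
  shows "avg A (\<lambda>x. of_bool (t < \<bar>\<Sum>m\<in>M. d m x\<bar>)) \<le> 2 * exp (- t\<^sup>2 / (4 * c))"
proof -
  \<comment> \<open>The minimiser of \<open>\<theta>\<^sup>2 * c - \<theta> * t\<close>.\<close>
  define \<theta> where "\<theta> = t / (2 * c)"
  have th: "0 \<le> \<theta>" using c t by (simp add: \<theta>_def)
  define S where "S = (\<lambda>x. \<Sum>m\<in>M. d m x)"
  have mom: "avg A (\<lambda>x. exp (\<theta>' * S x)) \<le> exp (\<theta>\<^sup>2 * c)" if "\<theta>' = \<theta> \<or> \<theta>' = - \<theta>" for \<theta>'
  proof -
    have "avg A (\<lambda>x. exp (\<theta>' * S x)) \<le> exp (\<theta>'\<^sup>2 * real (card M))"
      unfolding S_def by (rule exp_moment_le) (use assms in blast)+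
    also have "\<theta>'\<^sup>2 = \<theta>\<^sup>2" using that by auto
    also have "exp (\<theta>\<^sup>2 * real (card M)) \<le> exp (\<theta>\<^sup>2 * c)" using M(2) by (simp add: mult_left_mono)
    finally show ?thesis .
  qed
  have "avg A (\<lambda>x. of_bool (t < \<bar>S x\<bar>))
     \<le> avg A (\<lambda>x. exp (\<theta> * S x) * exp (- \<theta> * t) + exp ((- \<theta>) * S x) * exp (- \<theta> * t))"
  proof (rule avg_mono)
    fix x assume "x \<in> A"
    have "1 \<le> exp (\<theta> * S x) * exp (- \<theta> * t)" if "t < S x"
      using that th by (simp add: exp_add[symmetric] mult_left_mono)
    moreover have "1 \<le> exp ((- \<theta>) * S x) * exp (- \<theta> * t)" if "t < - S x"
    proof -
      have "\<theta> * t \<le> \<theta> * (- S x)" using that th by (intro mult_left_mono) auto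
      then have "0 \<le> - \<theta> * S x + - \<theta> * t" by simp
      then show ?thesis by (simp add: exp_add[symmetric])
    qed
    ultimately show "of_bool (t < \<bar>S x\<bar>) \<le> exp (\<theta> * S x) * exp (- \<theta> * t) + exp ((- \<theta>) * S x) * exp (- \<theta> * t)"
      by (auto simp: abs_real_def add_increasing add_increasing2 split: if_splits)
  qed
  also have "\<dots> = avg A (\<lambda>x. exp (\<theta> * S x)) * exp (- \<theta> * t) + avg A (\<lambda>x. exp ((- \<theta>) * S x)) * exp (- \<theta> * t)"
    by (simp only: avg_add avg_cmult_right)
  also have "\<dots> \<le> exp (\<theta>\<^sup>2 * c) * exp (- \<theta> * t) + exp (\<theta>\<^sup>2 * c) * exp (- \<theta> * t)"
    by (intro add_mono mult_right_mono mom) auto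
  also have "\<dots> = 2 * exp (\<theta>\<^sup>2 * c - \<theta> * t)" by (simp add: exp_add[symmetric])
  also have "\<theta>\<^sup>2 * c - \<theta> * t = - t\<^sup>2 / (4 * c)"
    using c by (simp add: \<theta>_def field_simps power2_eq_square)
  finally show ?thesis unfolding S_def .
qed

end

text \<open>Densities of Riesz product type: each factor is one plus a function odd in its own digit, which the
  earlier factors do not see.  The partial products are therefore probability densities.\<close>

locale riesz_measure = digits A fl L for A :: "'x set" and fl L +
  fixes p :: "nat \<Rightarrow> 'x \<Rightarrow> real"
  assumes p_half: "m < L \<Longrightarrow> x \<in> A \<Longrightarrow> 1/2 \<le> p m x"
    and p_inv: "m < L \<Longrightarrow> inv_from (Suc m) (p m)"
    and p_odd: "m < L \<Longrightarrow> odd_at m (\<lambda>x. p m x - 1)"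
begin

definition psi :: "nat \<Rightarrow> 'x \<Rightarrow> real" where "psi m x = (\<Prod>a<m. p a x)"

lemma psi_0: "psi 0 = (\<lambda>x. 1)" by (simp add: psi_def fun_eq_iff)
lemma psi_Suc: "psi (Suc m) = (\<lambda>x. psi m x * p m x)" by (simp add: psi_def fun_eq_iff)

lemma p_pos: "m < L \<Longrightarrow> x \<in> A \<Longrightarrow> 0 < p m x" using p_half[of m x] by simp

lemma psi_pos: "m \<le> L \<Longrightarrow> x \<in> A \<Longrightarrow> 0 < psi m x"
  unfolding psi_def by (intro prod_pos) (auto intro: p_pos)

lemma psi_inv: "m \<le> L \<Longrightarrow> inv_from m (psi m)"
  unfolding psi_def by (intro inv_from_prod) (auto intro: inv_from_mono[OF p_inv])

lemma avg_psi_Suc: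
  assumes m: "m < L" and g: "inv_from m g"
  shows "avg A (\<lambda>x. psi (Suc m) x * g x) = avg A (\<lambda>x. psi m x * g x)"
proof -
  have "avg A (\<lambda>x. (p m x - 1) * (psi m x * g x)) = 0"
    by (rule avg_odd_at[OF odd_at_mult_inv[OF p_odd[OF m]]])
       (use m in \<open>auto intro!: inv_from_mult psi_inv g\<close>)
  moreover have "psi (Suc m) x * g x = (p m x - 1) * (psi m x * g x) + psi m x * g x" for x
    by (simp add: psi_Suc algebra_simps)
  ultimately show ?thesis by (simp add: avg_add)
qed

text \<open>Functions of the first \<open>m\<close> digits have the same expectation under all densities from stage
  \<open>m\<close> on.\<close>

lemma avg_psi_extend:
  assumes "m \<le> m'" "m' \<le> L" "inv_from m g"
  shows "avg A (\<lambda>x. psi m' x * g x) = avg A (\<lambda>x. psi m x * g x)"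
  using assms
proof (induction m' rule: dec_induct)
  case (step k)
  then show ?case using avg_psi_Suc[of k g] inv_from_mono[of m g k] by simp
qed simp

lemma avg_psi: "m \<le> L \<Longrightarrow> avg A (psi m) = 1"
  using avg_psi_extend[of 0 m "\<lambda>_. 1"] inv_from_const[of 0 "1::real"] avg_const[OF finA neA, of 1]
  by (simp add: psi_0)

lemma avg_le_wnorm:
  assumes "m \<le> L"
  shows "avg A (\<lambda>x. cmod (H x)) \<le> sqrt (wnorm A (psi m) H)"
proof (rule real_le_rsqrt)
  have "(avg A (\<lambda>x. cmod (H x)))\<^sup>2 \<le> avg A (\<lambda>x. (cmod (H x))\<^sup>2 / psi m x) * avg A (psi m)"
    by (rule avg_mult_le) (rule psi_pos[OF assms])
  then show "(avg A (\<lambda>x. cmod (H x)))\<^sup>2 \<le> wnorm A (psi m) H"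
    by (simp add: avg_psi[OF assms] wnorm_def)
qed

abbreviation nrm :: "nat \<Rightarrow> ('x \<Rightarrow> complex) \<Rightarrow> real" where "nrm m \<equiv> wnorm A (psi m)"

lemma nrm_nonneg: "m \<le> L \<Longrightarrow> 0 \<le> nrm m H"
  by (rule wnorm_nonneg) (rule psi_pos)

lemma nrm_step:
  assumes "m < L" "inv_from m H" "odd_at m Y"
  shows "nrm (Suc m) (\<lambda>x. of_real (p m x) * H x + Y x) \<le> nrm m H + 2 * nrm m Y"
  unfolding psi_Suc
  by (rule wnorm_step[where \<phi> = "fl m"])
     (use assms psi_pos p_half bij_fl inv_fromD[OF psi_inv, of m m] inv_fromD[OF assms(2), of m]
        odd_atD[OF p_odd] odd_atD[OF assms(3)] in \<open>auto\<close>)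

text \<open>A discrete Gronwall inequality.  Since \<open>D\<^sub>m X\<^sub>m\<close> is again odd in digit \<open>m\<close>, a deviation of size
  \<open>\<delta>\<^sub>m\<close> from the density costs only a factor \<open>1 + 4 \<delta>\<^sub>m\<^sup>2\<close>; deviations of size \<open>1 / sqrt L\<close> are
  harmless over \<open>L\<close> steps.\<close>

lemma growth:
  assumes M: "M \<le> L"
    and X: "\<And>m x. m < M \<Longrightarrow> x \<in> A \<Longrightarrow> X (Suc m) x = (of_real (p m x) + D m x) * X m x + Y m x"
    and Xinv: "\<And>m. m \<le> M \<Longrightarrow> inv_from m (X m)"
    and D: "\<And>m. m < M \<Longrightarrow> odd_at m (D m)" "\<And>m x. m < M \<Longrightarrow> x \<in> A \<Longrightarrow> cmod (D m x) \<le> \<delta> m"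
    and Y: "\<And>m. m < M \<Longrightarrow> odd_at m (Y m)"
  shows "nrm M (X M) \<le> exp (4 * (\<Sum>m<M. (\<delta> m)\<^sup>2)) * (nrm 0 (X 0) + 4 * (\<Sum>m<M. nrm m (Y m)))"
  using assms
proof (induction M)
  case 0
  then show ?case by simp
next
  case (Suc M)
  define E where "E = exp (4 * (\<Sum>m<M. (\<delta> m)\<^sup>2))"
  define R where "R = nrm 0 (X 0) + 4 * (\<Sum>m<M. nrm m (Y m))"
  have IH: "nrm M (X M) \<le> E * R" unfolding E_def R_def by (rule Suc.IH) (use Suc.prems in auto)
  have MltL: "M < L" using Suc.prems(1) by simp
  have R0: "0 \<le> R" unfolding R_def using MltL by (intro add_nonneg_nonneg nrm_nonneg mult_nonneg_nonneg sum_nonneg) auto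
  have E1: "1 \<le> E" by (simp add: E_def sum_nonneg)
  have "nrm (Suc M) (X (Suc M)) = nrm (Suc M) (\<lambda>x. of_real (p M x) * X M x + (D M x * X M x + Y M x))"
    by (intro wnorm_cong) (simp add: Suc.prems(2) algebra_simps)
  also have "\<dots> \<le> nrm M (X M) + 2 * nrm M (\<lambda>x. D M x * X M x + Y M x)"
    by (intro nrm_step MltL Suc.prems odd_at_add odd_at_mult_inv) auto
  also have "nrm M (\<lambda>x. D M x * X M x + Y M x) \<le> 2 * nrm M (\<lambda>x. D M x * X M x) + 2 * nrm M (Y M)"
    by (intro wnorm_add_le psi_pos) (use MltL in auto)
  also have "nrm M (\<lambda>x. D M x * X M x) \<le> (\<delta> M)\<^sup>2 * nrm M (X M)"
    by (intro wnorm_mult_le psi_pos) (use MltL Suc.prems in auto)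
  finally have "nrm (Suc M) (X (Suc M)) \<le> (1 + 4 * (\<delta> M)\<^sup>2) * nrm M (X M) + 4 * nrm M (Y M)"
    by (simp add: algebra_simps)
  also have "\<dots> \<le> exp (4 * (\<delta> M)\<^sup>2) * (E * R) + 4 * nrm M (Y M)"
    using IH by (intro add_right_mono mult_mono exp_ge_add_one_self nrm_nonneg) (use MltL in auto)
  also have "\<dots> \<le> exp (4 * (\<delta> M)\<^sup>2) * (E * R) + (exp (4 * (\<delta> M)\<^sup>2) * E) * (4 * nrm M (Y M))"
  proof -
    have "1 \<le> exp (4 * (\<delta> M)\<^sup>2)" by simp
    then have "1 * 1 \<le> exp (4 * (\<delta> M)\<^sup>2) * E" using E1 by (intro mult_mono) auto
    moreover have "0 \<le> 4 * nrm M (Y M)" using nrm_nonneg[of M] MltL by simp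
    ultimately have "1 * 1 * (4 * nrm M (Y M)) \<le> exp (4 * (\<delta> M)\<^sup>2) * E * (4 * nrm M (Y M))"
      by (rule mult_right_mono)
    then show ?thesis by simp
  qed
  also have "\<dots> = exp (4 * (\<Sum>m<Suc M. (\<delta> m)\<^sup>2)) * (nrm 0 (X 0) + 4 * (\<Sum>m<Suc M. nrm m (Y m)))"
    by (simp add: E_def R_def exp_add distrib_left algebra_simps)
  finally show ?case .
qed

end

text \<open>Expand the square and bound \<open>|g v| |g v'|\<close> by the mean of the squares: the Gram matrix of the columns is at
  most \<open>b\<close> on the diagonal and \<open>z\<close> off it.\<close>

lemma large_sieve:
  fixes a :: "nat \<Rightarrow> nat \<Rightarrow> real" and g :: "nat \<Rightarrow> complex"
  assumes "finite M" "finite V"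
    and diag: "\<And>v. v \<in> V \<Longrightarrow> (\<Sum>m\<in>M. (a m v)\<^sup>2) \<le> b"
    and off: "\<And>v v'. v \<in> V \<Longrightarrow> v' \<in> V \<Longrightarrow> v \<noteq> v' \<Longrightarrow> \<bar>\<Sum>m\<in>M. a m v * a m v'\<bar> \<le> z"
    and z: "0 \<le> z" and b: "0 \<le> b"
  shows "(\<Sum>m\<in>M. (cmod (\<Sum>v\<in>V. of_real (a m v) * g v))\<^sup>2) \<le> (b + real (card V) * z) * (\<Sum>v\<in>V. (cmod (g v))\<^sup>2)"
proof -
  define Z where "Z = (\<lambda>v v'. \<Sum>m\<in>M. a m v * a m v')"
  have Zle: "\<bar>Z v v'\<bar> \<le> z + of_bool (v = v') * b" if "v \<in> V" "v' \<in> V" for v v'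
  proof (cases "v = v'")
    case True
    have "0 \<le> Z v v" unfolding Z_def by (intro sum_nonneg) simp
    then show ?thesis using diag[OF that(1)] z True by (simp add: Z_def power2_eq_square)
  qed (use off that in \<open>simp add: Z_def\<close>)
  have e1: "(cmod (\<Sum>v\<in>V. of_real (a m v) * g v))\<^sup>2 = (\<Sum>v\<in>V. \<Sum>v'\<in>V. a m v * a m v' * Re (g v * cnj (g v')))" for m
  proof -
    have "of_real ((cmod (\<Sum>v\<in>V. of_real (a m v) * g v))\<^sup>2)
      = (\<Sum>v\<in>V. of_real (a m v) * g v) * cnj (\<Sum>v\<in>V. of_real (a m v) * g v)"
      by (rule complex_norm_square)
    also have "\<dots> = (\<Sum>v\<in>V. \<Sum>v'\<in>V. of_real (a m v * a m v') * (g v * cnj (g v')))"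
      by (simp add: sum_product mult_ac)
    finally have "Re (of_real ((cmod (\<Sum>v\<in>V. of_real (a m v) * g v))\<^sup>2)) =
       (\<Sum>v\<in>V. \<Sum>v'\<in>V. Re (of_real (a m v * a m v') * (g v * cnj (g v'))))" by (simp only: Re_sum)
    then show ?thesis by (simp del: of_real_mult)
  qed
  have "(\<Sum>m\<in>M. (cmod (\<Sum>v\<in>V. of_real (a m v) * g v))\<^sup>2)
     = (\<Sum>v\<in>V. \<Sum>v'\<in>V. Z v v' * Re (g v * cnj (g v')))"
    unfolding e1 Z_def
    by (subst sum.swap, rule sum.cong[OF refl], subst sum.swap) (simp add: sum_distrib_right)
  also have "\<dots> \<le> (\<Sum>v\<in>V. \<Sum>v'\<in>V. (z + of_bool (v = v') * b) * (((cmod (g v))\<^sup>2 + (cmod (g v'))\<^sup>2) / 2))"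
  proof (intro sum_mono)
    fix v v' assume v: "v \<in> V" "v' \<in> V"
    have "\<bar>Re (g v * cnj (g v'))\<bar> \<le> cmod (g v) * cmod (g v')"
      using abs_Re_le_cmod[of "g v * cnj (g v')"] by (simp add: norm_mult)
    also have "\<dots> \<le> ((cmod (g v))\<^sup>2 + (cmod (g v'))\<^sup>2) / 2"
      using sum_squares_bound[of "cmod (g v)" "cmod (g v')"] by simp
    finally have "\<bar>Z v v'\<bar> * \<bar>Re (g v * cnj (g v'))\<bar> \<le> (z + of_bool (v = v') * b) * (((cmod (g v))\<^sup>2 + (cmod (g v'))\<^sup>2) / 2)"
      using Zle[OF v] by (intro mult_mono) (use z b in auto)
    then show "Z v v' * Re (g v * cnj (g v')) \<le> (z + of_bool (v = v') * b) * (((cmod (g v))\<^sup>2 + (cmod (g v'))\<^sup>2) / 2)"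
      using abs_ge_self[of "Z v v' * Re (g v * cnj (g v'))"] by (simp add: abs_mult)
  qed
  also have "\<dots> = (\<Sum>v\<in>V. \<Sum>v'\<in>V. z / 2 * (cmod (g v))\<^sup>2 + z / 2 * (cmod (g v'))\<^sup>2 + of_bool (v = v') * (b * (cmod (g v))\<^sup>2))"
    by (intro sum.cong refl) (auto simp: field_simps)
  also have "\<dots> = (b + real (card V) * z) * (\<Sum>v\<in>V. (cmod (g v))\<^sup>2)"
  proof -
    have "(\<Sum>v'\<in>V. of_bool (v = v') * (b * (cmod (g v))\<^sup>2)) = b * (cmod (g v))\<^sup>2" if "v \<in> V" for v
      using assms(2) that by (subst sum_distrib_right[symmetric]) (simp add: of_bool_def)
    then have a1: "(\<Sum>v\<in>V. \<Sum>v'\<in>V. of_bool (v = v') * (b * (cmod (g v))\<^sup>2)) = b * (\<Sum>v\<in>V. (cmod (g v))\<^sup>2)"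
      by (simp add: sum_distrib_left)
    have a2: "(\<Sum>v\<in>V. \<Sum>v'\<in>V. z / 2 * (cmod (g v))\<^sup>2) = real (card V) * z / 2 * (\<Sum>v\<in>V. (cmod (g v))\<^sup>2)"
      "(\<Sum>v\<in>V. \<Sum>v'\<in>V. z / 2 * (cmod (g v'))\<^sup>2) = real (card V) * z / 2 * (\<Sum>v\<in>V. (cmod (g v))\<^sup>2)"
      by (simp_all add: sum_distrib_left mult_ac)
    show ?thesis by (simp only: sum.distrib a1 a2) (simp add: algebra_simps)
  qed
  finally show ?thesis .
qed

section \<open>Coefficients of perturbed Riesz products\<close>

text \<open>The coefficient of \<open>z\<^sup>k\<close> in the polynomial \<open>\<Prod>a<m. F a x + z * q a x\<close>, by the recursion in \<open>m\<close> that the norm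
  estimates follow.\<close>

primrec zcoeff :: "(nat \<Rightarrow> 'x \<Rightarrow> complex) \<Rightarrow> (nat \<Rightarrow> 'x \<Rightarrow> complex) \<Rightarrow> nat \<Rightarrow> nat \<Rightarrow> 'x \<Rightarrow> complex" where
  "zcoeff F q k 0 = (\<lambda>x. if k = 0 then 1 else 0)"
| "zcoeff F q k (Suc m) = (\<lambda>x. F m x * zcoeff F q k m x + (if k = 0 then 0 else q m x * zcoeff F q (k - 1) m x))"

definition zprod :: "(nat \<Rightarrow> 'x \<Rightarrow> complex) \<Rightarrow> (nat \<Rightarrow> 'x \<Rightarrow> complex) \<Rightarrow> complex \<Rightarrow> nat \<Rightarrow> 'x \<Rightarrow> complex" where
  "zprod F q z m x = (\<Prod>a<m. F a x + z * q a x)"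

lemma zprod_Suc: "zprod F q z (Suc m) x = (F m x + z * q m x) * zprod F q z m x"
  by (simp add: zprod_def mult.commute)

lemma zcoeff_0: "zcoeff F q 0 m x = zprod F q 0 m x"
  by (induction m) (simp_all add: zprod_def mult.commute)

text \<open>The factors \<open>F m\<close> deviate from the densities \<open>p m\<close> and are perturbed by \<open>q m\<close>; both changes are odd in
  digit \<open>m\<close> and square summable.\<close>

locale chain = riesz_measure A fl L p for A :: "'x set" and fl L p +
  fixes F q :: "nat \<Rightarrow> 'x \<Rightarrow> complex" and \<delta> \<xi> :: "nat \<Rightarrow> real" and D2 X2 :: real
  assumes F_odd: "m < L \<Longrightarrow> odd_at m (\<lambda>x. F m x - of_real (p m x))"
    and F_inv: "m < L \<Longrightarrow> inv_from (Suc m) (F m)"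
    and F_le: "m < L \<Longrightarrow> x \<in> A \<Longrightarrow> cmod (F m x - of_real (p m x)) \<le> \<delta> m"
    and q_odd: "m < L \<Longrightarrow> odd_at m (q m)"
    and q_inv: "m < L \<Longrightarrow> inv_from (Suc m) (q m)"
    and q_le: "m < L \<Longrightarrow> x \<in> A \<Longrightarrow> cmod (q m x) \<le> \<xi> m"
    and D2: "(\<Sum>m<L. (\<delta> m)\<^sup>2) \<le> D2"
    and X2: "(\<Sum>m<L. (\<xi> m)\<^sup>2) \<le> X2"
begin

lemma D2_le: "m \<le> L \<Longrightarrow> (\<Sum>j<m. (\<delta> j)\<^sup>2) \<le> D2"
  by (rule order_trans[OF sum_mono2 D2]) auto

lemma X2_le: "m \<le> L \<Longrightarrow> (\<Sum>j<m. (\<xi> j)\<^sup>2) \<le> X2"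
  by (rule order_trans[OF sum_mono2 X2]) auto

lemma X2_nonneg: "0 \<le> X2" using X2_le[of 0] by simp

lemma zcoeff_inv: "m \<le> L \<Longrightarrow> inv_from m (zcoeff F q k m)"
proof (induction m arbitrary: k)
  case (Suc m)
  have 1: "inv_from (Suc m) (zcoeff F q k m)" for k
    using Suc.IH[of k] Suc.prems inv_from_mono by fastforce
  have "inv_from (Suc m) (\<lambda>x. F m x * zcoeff F q k m x + q m x * zcoeff F q (k - 1) m x)"
    "inv_from (Suc m) (\<lambda>x. F m x * zcoeff F q k m x + 0)"
    by (intro inv_from_add inv_from_mult inv_from_const 1 F_inv q_inv; use Suc.prems in simp)+
  then show ?case by (cases "k = 0") simp_all
qed (auto intro: inv_from_const)

lemma zprod_inv: "m \<le> L \<Longrightarrow> inv_from m (zprod F q z m)"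
  unfolding zprod_def
  by (intro inv_from_prod inv_from_add inv_from_mult inv_from_const)
     (auto intro: inv_from_mono[OF F_inv] inv_from_mono[OF q_inv])

text \<open>One more order in \<open>q\<close> gains the factor \<open>X2\<close>, because the source term \<open>q m * Y m\<close> is odd in digit \<open>m\<close> and
  the squares of the \<open>q m\<close> sum to \<open>X2\<close>.\<close>

lemma chain_step:
  assumes M: "M \<le> L"
    and X0: "\<And>x. x \<in> A \<Longrightarrow> X 0 x = 0"
    and X: "\<And>m x. m < M \<Longrightarrow> x \<in> A \<Longrightarrow> X (Suc m) x = F m x * X m x + q m x * Y m x"
    and Xinv: "\<And>m. m \<le> M \<Longrightarrow> inv_from m (X m)"
    and Yinv: "\<And>m. m < M \<Longrightarrow> inv_from m (Y m)"
    and Y: "\<And>m. m < M \<Longrightarrow> nrm m (Y m) \<le> B" and B: "0 \<le> B"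
  shows "nrm M (X M) \<le> 4 * exp (4 * D2) * X2 * B"
proof -
  have "nrm M (X M) \<le> exp (4 * (\<Sum>m<M. (\<delta> m)\<^sup>2)) * (nrm 0 (X 0) + 4 * (\<Sum>m<M. nrm m (\<lambda>x. q m x * Y m x)))"
  proof (rule growth[where D = "\<lambda>m x. F m x - of_real (p m x)"])
    show "X (Suc m) x = (of_real (p m x) + (F m x - of_real (p m x))) * X m x + q m x * Y m x"
      if "m < M" "x \<in> A" for m x using X[OF that] by simp
    show "odd_at m (\<lambda>x. q m x * Y m x)" if "m < M" for m
      by (rule odd_at_mult_inv[OF q_odd Yinv]) (use that M in auto)
  qed (use assms F_odd F_le in auto)
  also have "nrm 0 (X 0) = 0"
    unfolding wnorm_def using X0 by (subst avg_cong[where h = "\<lambda>_. 0"]) (auto simp: avg_def)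
  also have "(\<Sum>m<M. nrm m (\<lambda>x. q m x * Y m x)) \<le> (\<Sum>m<M. (\<xi> m)\<^sup>2 * B)"
  proof (rule sum_mono)
    fix m assume m: "m \<in> {..<M}"
    have "nrm m (\<lambda>x. q m x * Y m x) \<le> (\<xi> m)\<^sup>2 * nrm m (Y m)"
      by (intro wnorm_mult_le psi_pos q_le) (use m M in auto)
    also have "\<dots> \<le> (\<xi> m)\<^sup>2 * B" using Y m by (intro mult_left_mono) auto
    finally show "nrm m (\<lambda>x. q m x * Y m x) \<le> (\<xi> m)\<^sup>2 * B" .
  qed
  also have "\<dots> \<le> X2 * B"
    unfolding sum_distrib_right[symmetric] using X2_le[OF M] B by (intro mult_right_mono) auto
  also have "exp (4 * (\<Sum>m<M. (\<delta> m)\<^sup>2)) * (0 + 4 * (X2 * B)) \<le> exp (4 * D2) * (0 + 4 * (X2 * B))"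
    using D2_le[OF M] X2_nonneg B by (intro mult_right_mono) auto
  finally show ?thesis by (simp add: mult_ac)
qed

lemma nrm_zprod:
  assumes M: "M \<le> L" and z: "cmod z \<le> 1"
  shows "nrm M (zprod F q z M) \<le> exp (8 * (D2 + X2))"
proof -
  have "nrm M (zprod F q z M) \<le> exp (4 * (\<Sum>m<M. (\<delta> m + \<xi> m)\<^sup>2)) * (nrm 0 (zprod F q z 0) + 4 * (\<Sum>m<M. nrm m (\<lambda>x. 0)))"
  proof (rule growth[where D = "\<lambda>m x. (F m x - of_real (p m x)) + q m x * z"])
    show "odd_at m (\<lambda>x. F m x - of_real (p m x) + q m x * z)" if "m < M" for m
      by (rule odd_at_add[OF F_odd odd_at_mult_inv[OF q_odd inv_from_const]]) (use that M in auto)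
    show "cmod (F m x - of_real (p m x) + q m x * z) \<le> \<delta> m + \<xi> m" if "m < M" "x \<in> A" for m x
    proof -
      have "cmod (q m x * z) \<le> \<xi> m * 1" unfolding norm_mult
        using that M z q_le[of m x] by (intro mult_mono) (auto intro: order_trans[OF norm_ge_zero])
      moreover have "cmod (F m x - of_real (p m x)) \<le> \<delta> m" using that M by (intro F_le) auto
      ultimately show ?thesis by (intro norm_triangle_le) simp
    qed
  qed (use M zprod_inv in \<open>auto simp: zprod_Suc odd_at_def algebra_simps\<close>)
  also have "nrm 0 (zprod F q z 0) = 1" using avg_const[OF finA neA, of 1]
    by (simp add: wnorm_def zprod_def psi_def)
  also have "(\<Sum>m<M. nrm m (\<lambda>x. 0)) = 0" by (simp add: wnorm_def avg_def)
  also have "(\<Sum>m<M. (\<delta> m + \<xi> m)\<^sup>2) \<le> (\<Sum>m<M. 2 * (\<delta> m)\<^sup>2 + 2 * (\<xi> m)\<^sup>2)"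
  proof (rule sum_mono)
    fix m show "(\<delta> m + \<xi> m)\<^sup>2 \<le> 2 * (\<delta> m)\<^sup>2 + 2 * (\<xi> m)\<^sup>2"
      using sum_squares_bound[of "\<delta> m" "\<xi> m"] by (simp add: power2_sum)
  qed
  also have "\<dots> \<le> 2 * (D2 + X2)"
    using D2_le[OF M] X2_le[OF M] by (simp add: sum.distrib sum_distrib_left[symmetric])
  finally show ?thesis by simp
qed

lemma nrm_zcoeff:
  assumes "M \<le> L"
  shows "nrm M (zcoeff F q k M) \<le> exp (8 * (D2 + X2)) * (4 * exp (4 * D2) * X2) ^ k"
  using assms
proof (induction k arbitrary: M)
  case 0
  have "nrm M (zcoeff F q 0 M) = nrm M (zprod F q 0 M)" by (intro wnorm_cong) (simp add: zcoeff_0)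
  then show ?case using nrm_zprod[OF 0, of 0] by simp
next
  case (Suc k)
  have "nrm M (zcoeff F q (Suc k) M) \<le> 4 * exp (4 * D2) * X2 * (exp (8 * (D2 + X2)) * (4 * exp (4 * D2) * X2) ^ k)"
    by (rule chain_step[where Y = "zcoeff F q k"])
       (use Suc zcoeff_inv X2_nonneg in \<open>auto intro: Suc.IH\<close>)
  then show ?case by (simp add: mult_ac)
qed

text \<open>The even orders from four on.  Even and odd remainders feed each other: the even part of the product drives its odd part,
  this drives the even part without order zero, and so on.  Four passages, each gaining the factor of \<open>chain_step\<close>,
  lead to the remainder in question.\<close>

lemma nrm_remainder:
  assumes M: "M \<le> L"
  shows "nrm M (\<lambda>x. (zprod F q 1 M x + zprod F q (-1) M x) / 2 - zcoeff F q 0 M x - zcoeff F q 2 M x)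
    \<le> exp (8 * (D2 + X2)) * (4 * exp (4 * D2) * X2) ^ 4"
proof -
  define c where "c = 4 * exp (4 * D2) * X2"
  have c0: "0 \<le> c" using X2_nonneg by (simp add: c_def)
  define K where "K = exp (8 * (D2 + X2))"
  have K0: "0 \<le> K" by (simp add: K_def)
  define R0 where "R0 = (\<lambda>m x. zprod F q 1 m x * (1/2) + zprod F q (-1) m x * (1/2))"
  define O1 where "O1 = (\<lambda>m x. zprod F q 1 m x * (1/2) - zprod F q (-1) m x * (1/2))"
  define R2 where "R2 = (\<lambda>m x. R0 m x - zcoeff F q 0 m x)"
  define O3 where "O3 = (\<lambda>m x. O1 m x - zcoeff F q 1 m x)"
  define R4 where "R4 = (\<lambda>m x. R2 m x - zcoeff F q 2 m x)"
  have inv: "inv_from m (R0 m)" "inv_from m (O1 m)" "inv_from m (R2 m)" "inv_from m (O3 m)" "inv_from m (R4 m)"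
    if "m \<le> L" for m
    unfolding R0_def O1_def R2_def O3_def R4_def using that
    by (intro inv_from_add inv_from_diff inv_from_mult zprod_inv zcoeff_inv inv_from_const; simp)+
  have "nrm m (R0 m) \<le> K" if m: "m \<le> L" for m
  proof -
    have h: "nrm m (\<lambda>x. zprod F q z m x * (1/2)) \<le> K / 4" if "cmod z \<le> 1" for z
    proof -
      have "nrm m (\<lambda>x. zprod F q z m x * (1/2)) = nrm m (\<lambda>x. (1/2) * zprod F q z m x)"
        by (intro wnorm_cong) simp
      also have "\<dots> \<le> (1/2)\<^sup>2 * nrm m (zprod F q z m)"
        by (intro wnorm_mult_le psi_pos) (use m in auto)
      also have "\<dots> \<le> (1/2)\<^sup>2 * K" unfolding K_def using nrm_zprod[OF m that] by simp
      finally show ?thesis by (simp add: power2_eq_square)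
    qed
    have "nrm m (R0 m) \<le> 2 * nrm m (\<lambda>x. zprod F q 1 m x * (1/2)) + 2 * nrm m (\<lambda>x. zprod F q (-1) m x * (1/2))"
      unfolding R0_def by (intro wnorm_add_le psi_pos) (use m in auto)
    also have "\<dots> \<le> 2 * (K / 4) + 2 * (K / 4)" by (intro add_mono mult_left_mono h) auto
    finally show ?thesis by simp
  qed
  note R0_le = this
  have rec: "O1 (Suc m) x = F m x * O1 m x + q m x * R0 m x"
    "R2 (Suc m) x = F m x * R2 m x + q m x * O1 m x"
    "O3 (Suc m) x = F m x * O3 m x + q m x * R2 m x"
    "R4 (Suc m) x = F m x * R4 m x + q m x * O3 m x"
    "O1 0 x = 0" "R2 0 x = 0" "O3 0 x = 0" "R4 0 x = 0" for m x
    unfolding O1_def R2_def R0_def O3_def R4_def zprod_Suc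
    by (simp_all add: numeral_2_eq_2) (simp_all add: zprod_def field_simps)
  have O1_le: "nrm m (O1 m) \<le> 4 * exp (4 * D2) * X2 * K" if "m \<le> L" for m
    by (rule chain_step[where Y = R0]) (use that K0 in \<open>auto simp: rec intro: inv R0_le\<close>)
  have R2_le: "nrm m (R2 m) \<le> 4 * exp (4 * D2) * X2 * (c * K)" if "m \<le> L" for m
    by (rule chain_step[where Y = O1]) (use that K0 X2_nonneg O1_le in \<open>auto simp: rec c_def intro: inv\<close>)
  have O3_le: "nrm m (O3 m) \<le> 4 * exp (4 * D2) * X2 * (c * (c * K))" if "m \<le> L" for m
    by (rule chain_step[where Y = R2]) (use that K0 X2_nonneg R2_le in \<open>auto simp: rec c_def intro: inv\<close>)
  have "nrm m (R4 m) \<le> 4 * exp (4 * D2) * X2 * (c * (c * (c * K)))" if "m \<le> L" for m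
    by (rule chain_step[where Y = O3]) (use that K0 X2_nonneg O3_le in \<open>auto simp: rec c_def intro: inv\<close>)
  from this[OF M] have "nrm M (R4 M) \<le> K * c ^ 4"
    by (simp add: c_def power4_eq_xxxx mult_ac)
  moreover have "nrm M (R4 M) = nrm M (\<lambda>x. (zprod F q 1 M x + zprod F q (-1) M x) / 2 - zcoeff F q 0 M x - zcoeff F q 2 M x)"
    by (intro wnorm_cong) (simp add: R4_def R2_def R0_def add_divide_distrib)
  ultimately show ?thesis by (simp add: K_def c_def)
qed

end

section \<open>Bounded functions on the lines\<close>

text \<open>The r-function with first level \<open>a\<close> and second level \<open>u\<close> has third level \<open>L - 1 - a - u\<close>.  It is kept if that level is below
  \<open>w\<close>, marked by \<open>s\<close> if it equals \<open>w\<close>, and dropped if it is larger.\<close>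

definition wt :: "nat \<Rightarrow> nat \<Rightarrow> complex \<Rightarrow> nat \<Rightarrow> nat \<Rightarrow> complex" where
  "wt L w s a u = (if a + u < L then (if L \<le> a + u + w then 1 else if Suc (a + u + w) = L then s else 0) else 0)"

text \<open>The parities of r-functions in the first and third coordinate.  The estimates are used twice, for the given family and for the one
  with the second and third coordinate exchanged.\<close>

locale lines = x1: digits A fl1 L + x3: digits A fl3 L
  for A :: "'x set" and fl1 fl3 :: "nat \<Rightarrow> 'x \<Rightarrow> 'x" and L :: nat +
  fixes f :: "nat \<Rightarrow> nat \<Rightarrow> 'x \<Rightarrow> real" and G :: real
  assumes f_abs: "a + u < L \<Longrightarrow> x \<in> A \<Longrightarrow> \<bar>f a u x\<bar> = 1"
    and f_inv1: "a + u < L \<Longrightarrow> x1.inv_from (Suc a) (f a u)"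
    and f_odd1: "a + u < L \<Longrightarrow> x1.odd_at a (f a u)"
    and f_inv3: "a + u < L \<Longrightarrow> x3.inv_from (L - a - u) (f a u)"
    and f_odd3: "a + u < L \<Longrightarrow> x3.odd_at (L - 1 - a - u) (f a u)"
    and G1: "1 \<le> G" and L0: "0 < L"
begin

definition tau :: real where "tau = 1 / sqrt (real L)"
definition gam :: real where "gam = G / sqrt (real L)"
definition rho :: real where "rho = G / real L"

lemma tau_pos: "0 < tau" using L0 by (simp add: tau_def)
lemma gam_pos: "0 < gam" using L0 G1 by (simp add: gam_def)
lemma rho_pos: "0 < rho" using L0 G1 by (simp add: rho_def)
lemma gam_tau: "gam * tau = rho" using L0 by (simp add: gam_def tau_def rho_def)
lemma tau_sq: "tau\<^sup>2 = 1 / real L" using L0 by (simp add: tau_def power_divide)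
text \<open>For real weights and \<open>\<iota> = \<i>\<close> this is a product of at most \<open>L\<close> numbers of modulus at most
  \<open>sqrt (1 + 1 / L)\<close>, hence bounded; \<open>Th\<close> and \<open>Cc\<close> are its imaginary and real part, written as polynomials
  in \<open>s\<close> so that complex markers make sense.\<close>

definition PP :: "nat \<Rightarrow> complex \<Rightarrow> complex \<Rightarrow> nat \<Rightarrow> nat \<Rightarrow> 'x \<Rightarrow> complex" where
  "PP w s \<iota> v a x = (\<Prod>u<v. 1 + \<iota> * (of_real (tau * f a u x) * wt L w s a u))"

definition Th :: "nat \<Rightarrow> complex \<Rightarrow> nat \<Rightarrow> nat \<Rightarrow> 'x \<Rightarrow> complex" where
  "Th w s v a x = (PP w s \<i> v a x - PP w s (-\<i>) v a x) / (2 * \<i>)"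

definition Cc :: "nat \<Rightarrow> complex \<Rightarrow> nat \<Rightarrow> nat \<Rightarrow> 'x \<Rightarrow> complex" where
  "Cc w s v a x = (PP w s \<i> v a x + PP w s (-\<i>) v a x) / 2"

lemma PP_Suc: "PP w s \<iota> (Suc v) a x = PP w s \<iota> v a x * (1 + \<iota> * (of_real (tau * f a v x) * wt L w s a v))"
  by (simp add: PP_def)

lemma Th_Suc: "Th w s (Suc v) a x = Th w s v a x + of_real (tau * f a v x) * wt L w s a v * Cc w s v a x"
  unfolding Th_def Cc_def PP_Suc by (simp add: field_simps)

lemma Cc_Suc: "Cc w s (Suc v) a x = Cc w s v a x - of_real (tau * f a v x) * wt L w s a v * Th w s v a x"
  unfolding Th_def Cc_def PP_Suc by (simp add: field_simps)

lemma Th_0: "Th w s 0 a x = 0" by (simp add: Th_def PP_def)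

lemma wt_le: "cmod (wt L w s a u) \<le> 1 + cmod s * of_bool (Suc (a + u + w) = L)"
  by (simp add: wt_def)

lemma f_wt_le: "x \<in> A \<Longrightarrow> cmod (of_real (f a u x) * wt L w s a u) = cmod (wt L w s a u)"
  using f_abs[of a u x] by (auto simp: wt_def norm_mult)

text \<open>At most one \<open>u\<close> on the line carries the marker, and there \<open>tau * cmod s \<le> 1\<close> permits the crude factor two.\<close>

lemma PP_factor:
  assumes "\<iota> = \<i> \<or> \<iota> = - \<i>" "x \<in> A" "tau * cmod s \<le> 1"
  shows "cmod (1 + \<iota> * (of_real (tau * f a u x) * wt L w s a u))
    \<le> (if u < L then exp (1 / (2 * real L)) else 1) * (if Suc (a + u + w) = L \<and> s \<noteq> 0 then 2 else 1)"
proof -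
  have e1: "1 \<le> exp (1 / (2 * real L))" by simp
  consider "wt L w s a u = 0" | "a + u < L" "L \<le> a + u + w" "wt L w s a u = 1"
    | "a + u < L" "Suc (a + u + w) = L" "wt L w s a u = s" "s \<noteq> 0"
  proof -
    have "wt L w s a u = 0 \<or> (a + u < L \<and> L \<le> a + u + w \<and> wt L w s a u = 1)
      \<or> (a + u < L \<and> Suc (a + u + w) = L \<and> wt L w s a u = s \<and> s \<noteq> 0)"
      by (auto simp: wt_def)
    then show ?thesis using that by blast
  qed
  then show ?thesis
  proof cases
    case 1
    have "1 * 1 \<le> (if u < L then exp (1 / (2 * real L)) else 1) * (if Suc (a + u + w) = L \<and> s \<noteq> 0 then 2 else (1::real))"
      using e1 by (intro mult_mono) auto
    then show ?thesis using 1 by simp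
  next
    case 2
    have "(cmod (1 + \<iota> * of_real (tau * f a u x)))\<^sup>2 = 1 + (tau * f a u x)\<^sup>2"
      using assms(1) by (auto simp: cmod_power2)
    also have "\<dots> = 1 + 1 / real L"
      using f_abs[OF 2(1) assms(2)] by (simp add: power_mult_distrib tau_sq abs_square_eq_1[symmetric])
    also have "\<dots> \<le> exp (1 / real L)" by (rule exp_ge_add_one_self)
    also have "\<dots> = (exp (1 / (2 * real L)))\<^sup>2" by (simp add: power2_eq_square exp_add[symmetric])
    finally have "cmod (1 + \<iota> * of_real (tau * f a u x)) \<le> exp (1 / (2 * real L))"
      by (rule power2_le_imp_le) simp
    then show ?thesis using 2 by auto
  next
    case 3
    have "cmod (1 + \<iota> * (of_real (tau * f a u x) * s)) \<le> 1 + cmod (\<iota> * (of_real (tau * f a u x) * s))"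
      using norm_triangle_ineq[of 1 "\<iota> * (of_real (tau * f a u x) * s)"] by simp
    also have "cmod (\<iota> * (of_real (tau * f a u x) * s)) = tau * cmod s"
      using assms(1) f_abs[OF 3(1) assms(2)] tau_pos by (auto simp: norm_mult abs_mult)
    finally have *: "cmod (1 + \<iota> * (of_real (tau * f a u x) * s)) \<le> 2" using assms(3) by simp
    have "1 * 2 \<le> (if u < L then exp (1 / (2 * real L)) else 1) * (2::real)"
      using e1 by (intro mult_mono) auto
    with * have "cmod (1 + \<iota> * (of_real (tau * f a u x) * s)) \<le> (if u < L then exp (1 / (2 * real L)) else 1) * 2"
      by linarith
    then show ?thesis using 3 by simp
  qed
qed

lemma exp_half_le: "exp (1/2::real) \<le> 2"
proof -
  have "exp (1/2::real) \<le> 1 + 1/2 + (1/2)\<^sup>2" by (rule exp_bound) auto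
  then show ?thesis by (simp add: power2_eq_square)
qed

lemma PP_le:
  assumes "\<iota> = \<i> \<or> \<iota> = - \<i>" "x \<in> A" "tau * cmod s \<le> 1"
  shows "cmod (PP w s \<iota> v a x) \<le> (if s = 0 then 2 else 4)"
proof -
  have "cmod (PP w s \<iota> v a x) \<le> (\<Prod>u<v. (if u < L then exp (1 / (2 * real L)) else 1) * (if Suc (a + u + w) = L \<and> s \<noteq> 0 then 2 else 1))"
    unfolding PP_def prod_norm[symmetric] using PP_factor[OF assms] by (intro prod_mono) auto
  also have "\<dots> = (\<Prod>u<v. if u < L then exp (1 / (2 * real L)) else 1) * (\<Prod>u<v. if Suc (a + u + w) = L \<and> s \<noteq> 0 then 2 else 1)"
    by (rule prod.distrib)
  also have "\<dots> \<le> 2 * (if s = 0 then 1 else 2)"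
  proof (intro mult_mono)
    have "(\<Prod>u<v. if u < L then exp (1 / (2 * real L)) else 1) = (\<Prod>u\<in>{..<v} \<inter> {u. u < L}. exp (1 / (2 * real L)))"
      by (simp add: prod.inter_filter[symmetric] Int_def conj_commute)
    also have "\<dots> = exp (1 / (2 * real L)) ^ card ({..<v} \<inter> {u. u < L})" by simp
    also have "\<dots> \<le> exp (1 / (2 * real L)) ^ L"
    proof (intro power_increasing)
      have "card ({..<v} \<inter> {u. u < L}) \<le> card {..<L}" by (intro card_mono) auto
      then show "card ({..<v} \<inter> {u. u < L}) \<le> L" by simp
    qed simp
    also have "\<dots> = exp (1/2)" using L0 by (simp add: exp_of_nat_mult[symmetric])
    also have "\<dots> \<le> 2" by (rule exp_half_le)
    finally show "(\<Prod>u<v. if u < L then exp (1 / (2 * real L)) else 1) \<le> 2" .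
    show "(\<Prod>u<v. if Suc (a + u + w) = L \<and> s \<noteq> 0 then 2 else 1) \<le> (if s = 0 then 1 else 2::real)"
    proof (cases "s = 0")
      case False
      have "(\<Prod>u<v. if Suc (a + u + w) = L \<and> s \<noteq> 0 then 2 else (1::real)) \<le> (\<Prod>u\<in>insert (L - Suc (a + w)) {..<v}. if u = L - Suc (a + w) then 2 else 1)"
      proof -
        have "(\<Prod>u<v. if Suc (a + u + w) = L \<and> s \<noteq> 0 then 2 else (1::real)) \<le> (\<Prod>u<v. if u = L - Suc (a + w) then 2 else 1)"
          by (intro prod_mono) auto
        also have "\<dots> \<le> (\<Prod>u\<in>insert (L - Suc (a + w)) {..<v}. if u = L - Suc (a + w) then 2 else 1)"
          by (intro prod_mono2) auto
        finally show ?thesis .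
      qed
      also have "\<dots> = 2" by (subst prod.delta) auto
      finally show ?thesis using False by simp
    qed simp
  qed (auto intro!: prod_nonneg)
  finally show ?thesis by (simp split: if_splits)
qed

lemma Th_le: "x \<in> A \<Longrightarrow> tau * cmod s \<le> 1 \<Longrightarrow> cmod (Th w s v a x) \<le> 4"
  and Cc_le: "x \<in> A \<Longrightarrow> tau * cmod s \<le> 1 \<Longrightarrow> cmod (Cc w s v a x) \<le> 4"
  and Th_le0: "x \<in> A \<Longrightarrow> cmod (Th w 0 v a x) \<le> 2"
  and Cc_le0: "x \<in> A \<Longrightarrow> cmod (Cc w 0 v a x) \<le> 2"
  using PP_le[of \<i> x s w v a] PP_le[of "-\<i>" x s w v a] PP_le[of \<i> x 0 w v a] PP_le[of "-\<i>" x 0 w v a]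
    norm_triangle_ineq4[of "PP w s \<i> v a x" "PP w s (-\<i>) v a x"]
    norm_triangle_ineq[of "PP w s \<i> v a x" "PP w s (-\<i>) v a x"]
    norm_triangle_ineq4[of "PP w 0 \<i> v a x" "PP w 0 (-\<i>) v a x"]
    norm_triangle_ineq[of "PP w 0 \<i> v a x" "PP w 0 (-\<i>) v a x"]
  by (auto simp: Th_def Cc_def norm_divide norm_mult split: if_splits)

lemma Th_diff_le:
  assumes "x \<in> A" "tau * cmod s \<le> 1" "v0 \<le> v"
  shows "cmod (Th w s v a x - Th w s v0 a x) \<le> 4 * tau * (\<Sum>u=v0..<v. cmod (wt L w s a u))"
    and "cmod (Cc w s v a x - Cc w s v0 a x) \<le> 4 * tau * (\<Sum>u=v0..<v. cmod (wt L w s a u))"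
proof -
  have inc: "cmod (of_real (tau * f a u x) * wt L w s a u * Z) \<le> 4 * tau * cmod (wt L w s a u)" if "cmod Z \<le> 4" for u Z
  proof -
    have "cmod (of_real (tau * f a u x) * wt L w s a u * Z) = tau * cmod (of_real (f a u x) * wt L w s a u) * cmod Z"
      using tau_pos by (simp add: norm_mult abs_mult)
    also have "\<dots> = tau * cmod (wt L w s a u) * cmod Z" by (simp only: f_wt_le[OF assms(1)])
    also have "\<dots> \<le> tau * cmod (wt L w s a u) * 4" using that tau_pos by (intro mult_left_mono) auto
    finally show ?thesis by (simp add: mult_ac)
  qed
  show "cmod (Th w s v a x - Th w s v0 a x) \<le> 4 * tau * (\<Sum>u=v0..<v. cmod (wt L w s a u))"
    using assms(3)
  proof (induction v rule: dec_induct)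
    case (step v)
    have "cmod (Th w s (Suc v) a x - Th w s v0 a x) \<le> cmod (Th w s v a x - Th w s v0 a x) + cmod (of_real (tau * f a v x) * wt L w s a v * Cc w s v a x)"
      unfolding Th_Suc using norm_triangle_ineq[of "Th w s v a x - Th w s v0 a x" "of_real (tau * f a v x) * wt L w s a v * Cc w s v a x"]
      by (simp add: algebra_simps)
    also have "\<dots> \<le> 4 * tau * (\<Sum>u=v0..<v. cmod (wt L w s a u)) + 4 * tau * cmod (wt L w s a v)"
      by (intro add_mono step.IH inc Cc_le assms)
    finally show ?case using step.hyps by (simp add: distrib_left)
  qed simp
  show "cmod (Cc w s v a x - Cc w s v0 a x) \<le> 4 * tau * (\<Sum>u=v0..<v. cmod (wt L w s a u))"
    using assms(3)
  proof (induction v rule: dec_induct)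
    case (step v)
    have "cmod (Cc w s (Suc v) a x - Cc w s v0 a x) \<le> cmod (Cc w s v a x - Cc w s v0 a x) + cmod (of_real (tau * f a v x) * wt L w s a v * Th w s v a x)"
      unfolding Cc_Suc using norm_triangle_ineq4[of "Cc w s v a x - Cc w s v0 a x" "of_real (tau * f a v x) * wt L w s a v * Th w s v a x"]
      by (simp add: algebra_simps)
    also have "\<dots> \<le> 4 * tau * (\<Sum>u=v0..<v. cmod (wt L w s a u)) + 4 * tau * cmod (wt L w s a v)"
      by (intro add_mono step.IH inc Th_le assms)
    finally show ?case using step.hyps by (simp add: distrib_left)
  qed simp
qed

text \<open>The only r-function on line \<open>a\<close> of third level \<open>w\<close>, if it is present.  Being alone, it makes the dependence on \<open>s\<close>
  affine.\<close>

definition marked_f :: "nat \<Rightarrow> nat \<Rightarrow> nat \<Rightarrow> 'x \<Rightarrow> real" where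
  "marked_f w v a x = (if a + w < L \<and> L - Suc (a + w) < v then f a (L - Suc (a + w)) x else 0)"

lemma marked_f_le: "x \<in> A \<Longrightarrow> \<bar>marked_f w v a x\<bar> \<le> 1"
  using f_abs[of a "L - Suc (a + w)" x] by (auto simp: marked_f_def)

lemma PP_s: "PP w s \<iota> v a x = PP w 0 \<iota> v a x * (1 + \<iota> * (of_real (tau * marked_f w v a x) * s))"
proof (cases "a + w < L \<and> L - Suc (a + w) < v")
  case True
  define u where "u = L - Suc (a + w)"
  have u: "Suc (a + u + w) = L" "u < v" "a + u < L" using True by (auto simp: u_def)
  have r: "(\<Prod>u'\<in>{..<v}-{u}. 1 + \<iota> * (of_real (tau * f a u' x) * wt L w s a u')) = (\<Prod>u'\<in>{..<v}-{u}. 1 + \<iota> * (of_real (tau * f a u' x) * wt L w 0 a u'))"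
    using u by (intro prod.cong) (auto simp: wt_def)
  have w: "wt L w s a u = s" "wt L w 0 a u = 0" using u by (auto simp: wt_def)
  have m: "finite {..<v}" "u \<in> {..<v}" using u by auto
  have g: "marked_f w v a x = f a u x" using True by (simp add: marked_f_def u_def)
  show ?thesis
    unfolding PP_def prod.remove[OF m] r w g by simp
next
  case False
  have "PP w s \<iota> v a x = PP w 0 \<iota> v a x"
    unfolding PP_def
  proof (intro prod.cong refl)
    fix u assume "u \<in> {..<v}"
    then have "Suc (a + u + w) \<noteq> L" using False by auto
    then have "wt L w s a u = wt L w 0 a u" by (simp add: wt_def)
    then show "1 + \<iota> * (of_real (tau * f a u x) * wt L w s a u) = 1 + \<iota> * (of_real (tau * f a u x) * wt L w 0 a u)" by simp
  qed
  moreover have "marked_f w v a x = 0" using False by (simp only: marked_f_def if_False)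
  ultimately show ?thesis by simp
qed

lemma Th_s: "Th w s v a x = Th w 0 v a x + of_real (tau * marked_f w v a x) * s * Cc w 0 v a x"
  unfolding Th_def Cc_def PP_s[of w s] by (simp add: field_simps)

lemma Cc_s: "Cc w s v a x = Cc w 0 v a x - of_real (tau * marked_f w v a x) * s * Th w 0 v a x"
  unfolding Th_def Cc_def PP_s[of w s] by (simp add: field_simps)

lemma Th_s_diff_le:
  assumes "x \<in> A" "tau * cmod s \<le> 1"
  shows "cmod (Th w s v a x - Th w 0 v a x) \<le> 4 * tau * cmod s"
proof -
  have "Th w s v a x - Th w 0 v a x = of_real (tau * marked_f w v a x) * s * Cc w 0 v a x"
    by (simp add: Th_s[of w s])
  also have "cmod \<dots> = tau * cmod s * (\<bar>marked_f w v a x\<bar> * cmod (Cc w 0 v a x))"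
    using tau_pos by (simp add: norm_mult abs_mult)
  also have "\<dots> \<le> tau * cmod s * (1 * 4)"
    using marked_f_le[OF assms(1)] order_trans[OF Cc_le0[OF assms(1)]] tau_pos
    by (intro mult_left_mono mult_mono) auto
  finally show ?thesis by (simp add: mult_ac)
qed

lemma PP_flip1: "a < L \<Longrightarrow> x \<in> A \<Longrightarrow> PP w s \<iota> v a (fl1 a x) = PP w s (- \<iota>) v a x"
  unfolding PP_def
  using x1.odd_atD[OF f_odd1] by (intro prod.cong) (auto simp: wt_def)

lemma PP_inv1: "x1.inv_from (Suc a) (PP w s \<iota> v a)"
  unfolding PP_def
proof (rule x1.inv_from_prod)
  fix u
  show "x1.inv_from (Suc a) (\<lambda>x. 1 + \<iota> * (of_real (tau * f a u x) * wt L w s a u))"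
  proof (cases "a + u < L")
    case True
    then show ?thesis using f_inv1[OF True] by (auto simp: x1.inv_from_def)
  qed (simp add: wt_def x1.inv_from_const)
qed

lemma Th_inv1: "x1.inv_from (Suc a) (Th w s v a)"
  and Cc_inv1: "x1.inv_from (Suc a) (Cc w s v a)"
  using PP_inv1[of a w s \<i> v] PP_inv1[of a w s "-\<i>" v]
  by (auto simp: x1.inv_from_def Th_def Cc_def)

lemma Th_odd1: "a < L \<Longrightarrow> x1.odd_at a (Th w s v a)"
  by (auto simp: x1.odd_at_def Th_def PP_flip1 field_simps)

lemma Cc_even1: "a < L \<Longrightarrow> x \<in> A \<Longrightarrow> Cc w s v a (fl1 a x) = Cc w s v a x"
  by (auto simp: Cc_def PP_flip1 field_simps)

text \<open>The factor of the Riesz product on line \<open>a\<close>, and its increment when second level \<open>v\<close> is added.  Adding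
  the level is the same as putting the marker \<open>z = 1\<close> in \<open>FF + z * qq\<close>.\<close>

definition FF :: "nat \<Rightarrow> complex \<Rightarrow> nat \<Rightarrow> nat \<Rightarrow> 'x \<Rightarrow> complex" where
  "FF w s v a x = 1 + of_real gam * Th w s v a x"

definition qq :: "nat \<Rightarrow> complex \<Rightarrow> nat \<Rightarrow> nat \<Rightarrow> 'x \<Rightarrow> complex" where
  "qq w s v a x = of_real (rho * f a v x) * wt L w s a v * Cc w s v a x"

lemma FF_Suc: "FF w s (Suc v) a x = FF w s v a x + qq w s v a x"
  unfolding FF_def Th_Suc qq_def gam_tau[symmetric] by (simp add: algebra_simps)

lemma FF_inv1: "x1.inv_from (Suc a) (FF w s v a)"
  using Th_inv1[of a w s v] by (auto simp: x1.inv_from_def FF_def)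

lemma qq_inv1: "x1.inv_from (Suc a) (qq w s v a)"
proof (cases "a + v < L")
  case True
  then show ?thesis using f_inv1[OF True] Cc_inv1[of a w s v] by (auto simp: x1.inv_from_def qq_def)
next
  case False
  then have "qq w s v a = (\<lambda>x. 0)" by (simp add: qq_def wt_def fun_eq_iff)
  then show ?thesis by (simp add: x1.inv_from_const)
qed

lemma qq_odd1: "a < L \<Longrightarrow> x1.odd_at a (qq w s v a)"
  using f_odd1[of a v] Cc_even1[of a _ w s v]
  by (cases "a + v < L") (auto simp: x1.odd_at_def qq_def wt_def)

lemma qq_le: "x \<in> A \<Longrightarrow> tau * cmod s \<le> 1 \<Longrightarrow> cmod (qq w s v a x) \<le> 4 * rho * cmod (wt L w s a v)"
proof -
  assume x: "x \<in> A" "tau * cmod s \<le> 1"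
  have "cmod (qq w s v a x) = rho * cmod (of_real (f a v x) * wt L w s a v) * cmod (Cc w s v a x)"
    using rho_pos by (simp add: qq_def norm_mult abs_mult)
  also have "\<dots> = rho * cmod (wt L w s a v) * cmod (Cc w s v a x)" by (simp only: f_wt_le[OF x(1)])
  also have "\<dots> \<le> rho * cmod (wt L w s a v) * 4" using Cc_le[OF x] rho_pos by (intro mult_left_mono) auto
  finally show ?thesis by (simp add: mult_ac)
qed

lemma Th_real: "Im (Th w 0 v a x) = 0"
proof -
  have "PP w 0 (-\<i>) v a x = cnj (PP w 0 \<i> v a x)"
    unfolding PP_def cnj_prod by (intro prod.cong) (auto simp: wt_def)
  then have "Th w 0 v a x = (of_real (Im (PP w 0 \<i> v a x)) * (2 * \<i>)) / (2 * \<i>)"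
    unfolding Th_def by (simp add: complex_diff_cnj mult_ac)
  also have "\<dots> = of_real (Im (PP w 0 \<i> v a x))" by (rule nonzero_mult_div_cancel_right) simp
  finally have "Th w 0 v a x = of_real (Im (PP w 0 \<i> v a x))" .
  then show ?thesis by simp
qed

end

section \<open>A group of consecutive second levels\<close>

lemma nested_le:
  fixes a b c d e P Q :: real
  assumes "a \<le> b + 2 * c" "c \<le> 2 * d + 2 * e" "d \<le> P" "e \<le> Q"
  shows "a \<le> b + 4 * (P + Q)"
proof -
  have "a \<le> b + 2 * (2 * d + 2 * e)" using assms(1,2) by argo
  also have "\<dots> = b + 4 * (d + e)" by (simp add: algebra_simps)
  also have "\<dots> \<le> b + 4 * (P + Q)" using assms(3,4) by (intro add_left_mono mult_left_mono add_mono) auto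
  finally show ?thesis .
qed

text \<open>An absolute constant into which the exponentials from the norm estimates are absorbed.\<close>

definition KK :: real where "KK = exp 1000"

lemma KK1: "1 \<le> KK" by (simp add: KK_def)

text \<open>A group of \<open>l\<close> second levels starting at \<open>v0\<close>; first levels will be averaged over blocks of length \<open>b\<close>.  The
  bound on \<open>s\<close> makes a marked r-function no worse than a change of order \<open>1 / sqrt L\<close> in one factor.  Assumption
  \<open>c2\<close> says that exceptional sets are negligible even against the crude bounds, \<open>c3\<close> that the group is short
  enough for the factors to change little within it.\<close>

locale level_group = lines A fl1 fl3 L f G for A :: "'x set" and fl1 fl3 L f G +
  fixes w :: nat and s :: complex and v0 l b :: nat
  assumes s_le: "cmod s \<le> sqrt (real L) / G"
    and l0: "0 < l" and b0: "0 < b"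
    and c0: "64 * G\<^sup>2 \<le> real L"
    and c1: "l * b \<le> L"
    and c2: "real l ^ 3 * exp (30 * G * sqrt (real L) - real b / (4 * (real l)\<^sup>2)) \<le> 32 * G\<^sup>2 / real L"
    and c3: "G\<^sup>2 * real l ^ 3 \<le> real L"
begin

text \<open>The density at the beginning of the group, with the marked terms left out: it is real and close to one.\<close>

definition p :: "nat \<Rightarrow> 'x \<Rightarrow> real" where "p a x = 1 + gam * Re (Th w 0 v0 a x)"

lemma sqrtL: "8 * G \<le> sqrt (real L)"
  using c0 G1 by (intro real_le_rsqrt) (simp add: power_mult_distrib)

lemma gam_le: "8 * gam \<le> 1"
  using sqrtL L0 by (simp add: gam_def)

lemma tau_s: "tau * cmod s \<le> 1"
proof -
  have "tau * cmod s \<le> tau * (sqrt (real L) / G)" using s_le tau_pos by (intro mult_left_mono) auto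
  also have "\<dots> = 1 / G" using L0 by (simp add: tau_def)
  also have "\<dots> \<le> 1" using G1 by simp
  finally show ?thesis .
qed

lemma rho_s: "rho * cmod s \<le> 1 / sqrt (real L)"
proof -
  have "rho * cmod s \<le> rho * (sqrt (real L) / G)" using s_le rho_pos by (intro mult_left_mono) auto
  also have "\<dots> = 1 / sqrt (real L)" using L0 G1 by (simp add: rho_def field_simps)
  finally show ?thesis .
qed

lemma rho_l: "rho * real l \<le> 1 / sqrt (real L)"
proof -
  have "real l ^ 2 \<le> real l ^ 3" using l0 by (intro power_increasing) auto
  then have "G\<^sup>2 * real l ^ 2 \<le> G\<^sup>2 * real l ^ 3" by (intro mult_left_mono) auto
  then have "(G * real l)\<^sup>2 \<le> real L" using c3 by (simp add: power_mult_distrib)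
  then have "G * real l \<le> sqrt (real L)" by (rule real_le_rsqrt)
  then have "G * real l / real L \<le> sqrt (real L) / real L" by (intro divide_right_mono) auto
  also have "sqrt (real L) / real L = 1 / sqrt (real L)" using L0 by (simp add: divide_simps)
  finally show ?thesis by (simp add: rho_def)
qed

lemma s_sq: "rho\<^sup>2 * (cmod s)\<^sup>2 \<le> 1 / real L"
proof -
  have "(rho * cmod s)\<^sup>2 \<le> (1 / sqrt (real L))\<^sup>2" using rho_s rho_pos by (intro power_mono) auto
  then show ?thesis by (simp add: power_mult_distrib power_divide)
qed

lemma of_real_p: "x \<in> A \<Longrightarrow> of_real (p a x) = FF w 0 v0 a x"
  using Th_real[of w v0 a x] by (simp add: p_def FF_def complex_eq_iff)

lemma p_bounds: assumes "x \<in> A" shows "\<bar>p a x - 1\<bar> \<le> 2 * gam"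
proof -
  have "\<bar>Re (Th w 0 v0 a x)\<bar> \<le> 2" using Th_le0[OF assms] abs_Re_le_cmod order_trans by blast
  then have "gam * \<bar>Re (Th w 0 v0 a x)\<bar> \<le> gam * 2" using gam_pos by (intro mult_left_mono) auto
  then show ?thesis using gam_pos by (simp add: p_def abs_mult)
qed

sublocale rm: riesz_measure A fl1 L p
proof
  fix m x assume "m < L" "x \<in> A"
  then show "1 / 2 \<le> p m x" using p_bounds[of x m] gam_le by linarith
next
  fix m assume "m < L"
  then show "x1.inv_from (Suc m) (p m)" "x1.odd_at m (\<lambda>x. p m x - 1)"
    using Th_inv1[of m w 0 v0] Th_odd1[of m w 0 v0]
    by (auto simp: x1.inv_from_def x1.odd_at_def p_def)
qed

definition X2 :: real where "X2 = 32 * G\<^sup>2 / real L"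

lemma X2_pos: "0 < X2" using G1 L0 by (simp add: X2_def)
lemma X2_le: "X2 \<le> 1/2" using c0 L0 by (simp add: X2_def field_simps)

lemma wt_sq: "(cmod (wt L w s a v))\<^sup>2 \<le> 1 + (cmod s)\<^sup>2 * of_bool (Suc (a + v + w) = L)"
  by (simp add: wt_def)

lemma sum_level_le: "(\<Sum>a<L. of_bool (Suc (a + v + w) = L)) \<le> (1::real)"
proof -
  have "(\<Sum>a<L. of_bool (Suc (a + v + w) = L)) = real (card ({..<L} \<inter> {a. Suc (a + v + w) = L}))"
    by (simp add: of_bool_def sum.If_cases)
  also have "\<dots> \<le> real (card {L - Suc (v + w)})" by (intro of_nat_mono card_mono) auto
  finally show ?thesis by simp
qed

lemma sum_wt: "(\<Sum>a<L. (4 * rho * cmod (wt L w s a v))\<^sup>2) \<le> X2"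
proof -
  have "(\<Sum>a<L. (4 * rho * cmod (wt L w s a v))\<^sup>2) \<le> (\<Sum>a<L. 16 * rho\<^sup>2 * (1 + (cmod s)\<^sup>2 * of_bool (Suc (a + v + w) = L)))"
    unfolding power_mult_distrib using wt_sq by (intro sum_mono mult_mono) auto
  also have "\<dots> = 16 * rho\<^sup>2 * (real L + (cmod s)\<^sup>2 * (\<Sum>a<L. of_bool (Suc (a + v + w) = L)))"
    by (simp add: sum_distrib_left[symmetric] sum.distrib)
  also have "\<dots> \<le> 16 * rho\<^sup>2 * (real L + (cmod s)\<^sup>2 * 1)"
    using sum_level_le[of v] by (intro mult_left_mono add_left_mono) auto
  also have "\<dots> = 16 * (rho\<^sup>2 * real L) + 16 * (rho\<^sup>2 * (cmod s)\<^sup>2)" by (simp add: algebra_simps)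
  also have "\<dots> \<le> 16 * (G\<^sup>2 / real L) + 16 * (1 / real L)"
    using s_sq L0 by (intro add_mono mult_left_mono) (auto simp: rho_def power_divide power2_eq_square)
  also have "\<dots> \<le> 16 * (G\<^sup>2 / real L) + 16 * (G\<^sup>2 / real L)"
    using G1 by (intro add_left_mono mult_left_mono divide_right_mono) auto
  finally show ?thesis by (simp add: X2_def)
qed

text \<open>Whether line \<open>a\<close> meets third level \<open>w\<close> within the group.\<close>

definition marks :: "nat \<Rightarrow> real" where
  "marks a = (\<Sum>u=v0..<v0+l. of_bool (Suc (a + u + w) = L))"

lemma marks_01: "marks a = 0 \<or> marks a = 1"
proof -
  have "marks a = real (card ({v0..<v0+l} \<inter> {u. Suc (a + u + w) = L}))"
    by (simp add: marks_def of_bool_def sum.If_cases)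
  moreover have "card ({v0..<v0+l} \<inter> {u. Suc (a + u + w) = L}) \<le> card {L - Suc (a + w)}"
    by (intro card_mono) auto
  ultimately show ?thesis by (auto simp: le_Suc_eq)
qed

lemma marks_le: "0 \<le> marks a" "marks a \<le> 1" "(marks a)\<^sup>2 = marks a"
  using marks_01[of a] by auto

lemma sum_marks_le: "(\<Sum>a<L. marks a) \<le> real l"
proof -
  have "(\<Sum>a<L. marks a) = (\<Sum>u=v0..<v0+l. \<Sum>a<L. of_bool (Suc (a + u + w) = L))"
    unfolding marks_def by (rule sum.swap)
  also have "\<dots> \<le> (\<Sum>u=v0..<v0+l. 1)" by (intro sum_mono sum_level_le)
  finally show ?thesis by simp
qed

text \<open>The total weight that the group can add to line \<open>a\<close>.\<close>

definition wt_bound :: "nat \<Rightarrow> real" where "wt_bound a = real l + cmod s * marks a"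

lemma sum_wt_le: assumes "v \<le> v0 + l" shows "(\<Sum>u=v0..<v. cmod (wt L w s a u)) \<le> wt_bound a"
proof -
  have "(\<Sum>u=v0..<v. cmod (wt L w s a u)) \<le> (\<Sum>u=v0..<v0+l. cmod (wt L w s a u))"
    using assms by (intro sum_mono2) auto
  also have "\<dots> \<le> (\<Sum>u=v0..<v0+l. 1 + cmod s * of_bool (Suc (a + u + w) = L))"
    by (intro sum_mono wt_le)
  also have "\<dots> = wt_bound a" unfolding wt_bound_def marks_def sum.distrib sum_distrib_left by simp
  finally show ?thesis .
qed

lemma sum_wt_bound_sq: "(\<Sum>a<L. (wt_bound a)\<^sup>2) \<le> 2 * real L * (real l)\<^sup>2 + 2 * (cmod s)\<^sup>2 * real l"
proof -
  have "(\<Sum>a<L. (wt_bound a)\<^sup>2) \<le> (\<Sum>a<L. 2 * (real l)\<^sup>2 + 2 * (cmod s)\<^sup>2 * marks a)"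
  proof (intro sum_mono)
    fix a
    have "(wt_bound a)\<^sup>2 \<le> 2 * (real l)\<^sup>2 + 2 * (cmod s * marks a)\<^sup>2"
      using sum_squares_bound[of "real l" "cmod s * marks a"] by (simp add: wt_bound_def power2_sum)
    then show "(wt_bound a)\<^sup>2 \<le> 2 * (real l)\<^sup>2 + 2 * (cmod s)\<^sup>2 * marks a"
      by (simp add: power_mult_distrib marks_le)
  qed
  also have "\<dots> = 2 * real L * (real l)\<^sup>2 + 2 * (cmod s)\<^sup>2 * (\<Sum>a<L. marks a)"
    by (simp add: sum.distrib sum_distrib_left)
  also have "\<dots> \<le> 2 * real L * (real l)\<^sup>2 + 2 * (cmod s)\<^sup>2 * real l"
    using sum_marks_le by (intro add_left_mono mult_left_mono) auto
  finally show ?thesis .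
qed

lemma wt_bound_rho_sq: "rho\<^sup>2 * (\<Sum>a<L. (wt_bound a)\<^sup>2) \<le> 4 * G\<^sup>2 * (real l)\<^sup>2 / real L"
proof -
  have "rho\<^sup>2 * (\<Sum>a<L. (wt_bound a)\<^sup>2) \<le> rho\<^sup>2 * (2 * real L * (real l)\<^sup>2 + 2 * (cmod s)\<^sup>2 * real l)"
    by (intro mult_left_mono sum_wt_bound_sq) auto
  also have "\<dots> = 2 * (rho\<^sup>2 * real L) * (real l)\<^sup>2 + 2 * (rho\<^sup>2 * (cmod s)\<^sup>2) * real l"
    by (simp add: algebra_simps)
  also have "\<dots> \<le> 2 * (G\<^sup>2 / real L) * (real l)\<^sup>2 + 2 * (1 / real L) * real l"
    using s_sq L0 by (intro add_mono mult_left_mono mult_right_mono) (auto simp: rho_def power_divide power2_eq_square)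
  also have "\<dots> \<le> 2 * (G\<^sup>2 / real L) * (real l)\<^sup>2 + 2 * (G\<^sup>2 / real L) * (real l)\<^sup>2"
  proof (intro add_left_mono mult_mono divide_right_mono)
    show "real l \<le> (real l)\<^sup>2" using l0 by (simp add: power2_eq_square)
  qed (use G1 in auto)
  finally show ?thesis by simp
qed

lemma FF_diff:
  assumes "x \<in> A" "v0 \<le> v" "v \<le> v0 + l"
  shows "cmod (FF w s v a x - FF w s v0 a x) \<le> 4 * rho * wt_bound a"
    and "cmod (Cc w s v a x - Cc w s v0 a x) \<le> 4 * tau * wt_bound a"
proof -
  have "cmod (FF w s v a x - FF w s v0 a x) = gam * cmod (Th w s v a x - Th w s v0 a x)"
    using gam_pos by (simp add: FF_def norm_mult right_diff_distrib[symmetric])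
  also have "\<dots> \<le> gam * (4 * tau * wt_bound a)"
    using Th_diff_le(1)[OF assms(1) tau_s assms(2), of w a] sum_wt_le[OF assms(3), of a] gam_pos tau_pos
    by (intro mult_left_mono order_trans[OF Th_diff_le(1)[OF assms(1) tau_s assms(2)]]) auto
  finally show "cmod (FF w s v a x - FF w s v0 a x) \<le> 4 * rho * wt_bound a"
    by (simp add: gam_tau[symmetric] mult_ac)
  show "cmod (Cc w s v a x - Cc w s v0 a x) \<le> 4 * tau * wt_bound a"
    using sum_wt_le[OF assms(3), of a] tau_pos
    by (intro order_trans[OF Th_diff_le(2)[OF assms(1) tau_s assms(2)]]) auto
qed

text \<open>The deviation from the density has two sources, each of order \<open>1 / sqrt L\<close>: the marked r-function, where \<open>rho * cmod s \<le> 1 / sqrt L\<close>, and the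
  levels added within the group, where \<open>rho * l \<le> 1 / sqrt L\<close>.\<close>

lemma FF_p:
  assumes "x \<in> A" "v0 \<le> v" "v \<le> v0 + l"
  shows "cmod (FF w s v a x - of_real (p a x)) \<le> 12 / sqrt (real L)"
proof -
  have "cmod (FF w s v0 a x - FF w 0 v0 a x) = gam * cmod (Th w s v0 a x - Th w 0 v0 a x)"
    using gam_pos by (simp add: FF_def norm_mult right_diff_distrib[symmetric])
  also have "\<dots> \<le> gam * (4 * tau * cmod s)"
    using Th_s_diff_le[OF assms(1) tau_s] gam_pos by (intro mult_left_mono) auto
  also have "\<dots> = 4 * (rho * cmod s)" by (simp add: gam_tau[symmetric])
  finally have 1: "cmod (FF w s v0 a x - FF w 0 v0 a x) \<le> 4 * (1 / sqrt (real L))" using rho_s by linarith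
  have "rho * wt_bound a = rho * real l + rho * cmod s * marks a" by (simp add: wt_bound_def algebra_simps)
  also have "rho * cmod s * marks a \<le> rho * cmod s" using marks_le(2)[of a] rho_pos by (simp add: mult_left_le)
  finally have "rho * wt_bound a \<le> 2 * (1 / sqrt (real L))" using rho_l rho_s by linarith
  then have 2: "cmod (FF w s v a x - FF w s v0 a x) \<le> 8 * (1 / sqrt (real L))"
    using FF_diff(1)[OF assms, of a] by linarith
  show ?thesis unfolding of_real_p[OF assms(1)]
    using norm_triangle_ineq[of "FF w s v a x - FF w s v0 a x" "FF w s v0 a x - FF w 0 v0 a x"] 1 2 by simp
qed

lemma chain_v:
  assumes "v0 \<le> v" "v \<le> v0 + l"
  shows "chain A fl1 L p (FF w s v) (qq w s v) (\<lambda>_. 12 / sqrt (real L)) (\<lambda>a. 4 * rho * cmod (wt L w s a v)) 144 X2"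
proof
  fix m assume m: "m < L"
  show "x1.odd_at m (\<lambda>x. FF w s v m x - of_real (p m x))"
    using x1.odd_atD[OF Th_odd1[OF m, of w s v]] x1.odd_atD[OF Th_odd1[OF m, of w 0 v0]]
    by (auto simp: x1.odd_at_def FF_def p_def)
  show "x1.inv_from (Suc m) (FF w s v m)" by (rule FF_inv1)
  show "x1.odd_at m (qq w s v m)" by (rule qq_odd1[OF m])
  show "x1.inv_from (Suc m) (qq w s v m)" by (rule qq_inv1)
next
  fix m x assume "m < L" "x \<in> A"
  then show "cmod (FF w s v m x - of_real (p m x)) \<le> 12 / sqrt (real L)"
    "cmod (qq w s v m x) \<le> 4 * rho * cmod (wt L w s m v)"
    using FF_p[OF _ assms] qq_le[OF _ tau_s] by blast+
next
  show "(\<Sum>m<L. (12 / sqrt (real L))\<^sup>2) \<le> 144" using L0 by (simp add: power_divide)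
  show "(\<Sum>a<L. (4 * rho * cmod (wt L w s a v))\<^sup>2) \<le> X2" by (rule sum_wt)
qed

abbreviation E :: "nat \<Rightarrow> nat \<Rightarrow> nat \<Rightarrow> 'x \<Rightarrow> complex" where
  "E v k \<equiv> zcoeff (FF w s v) (qq w s v) k"

lemma K_le: "exp (8 * (144 + X2)) \<le> KK ^ 2" "4 * exp (4 * 144) * X2 \<le> 4 * KK * X2"
proof -
  have "exp (8 * (144 + X2)) \<le> exp 2000" using X2_le by simp
  also have "exp 2000 = KK ^ 2" by (simp add: KK_def exp_of_nat_mult[symmetric])
  finally show "exp (8 * (144 + X2)) \<le> KK ^ 2" .
  show "4 * exp (4 * 144) * X2 \<le> 4 * KK * X2" using X2_pos by (simp add: KK_def)
qed

text \<open>Every coefficient has the size suggested by independence, order \<open>X2 ^ k\<close> in squared norm.\<close>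

lemma nrm_E:
  assumes "v0 \<le> v" "v \<le> v0 + l" "m \<le> L"
  shows "rm.nrm m (E v k m) \<le> KK ^ 2 * (4 * KK * X2) ^ k"
proof -
  interpret chain A fl1 L p "FF w s v" "qq w s v" "\<lambda>_. 12 / sqrt (real L)" "\<lambda>a. 4 * rho * cmod (wt L w s a v)" 144 X2
    by (rule chain_v[OF assms(1,2)])
  have "rm.nrm m (E v k m) \<le> exp (8 * (144 + X2)) * (4 * exp (4 * 144) * X2) ^ k"
    by (rule nrm_zcoeff[OF assms(3)])
  also have "\<dots> \<le> KK ^ 2 * (4 * KK * X2) ^ k"
    using K_le X2_pos KK1 by (intro mult_mono power_mono) auto
  finally show ?thesis .
qed

lemma E_inv:
  assumes "v0 \<le> v" "v \<le> v0 + l" "m \<le> L"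
  shows "x1.inv_from m (E v k m)"
proof -
  interpret chain A fl1 L p "FF w s v" "qq w s v" "\<lambda>_. 12 / sqrt (real L)" "\<lambda>a. 4 * rho * cmod (wt L w s a v)" 144 X2
    by (rule chain_v[OF assms(1,2)])
  show ?thesis by (rule zcoeff_inv[OF assms(3)])
qed

lemma avg_remainder:
  assumes "v0 \<le> v" "v \<le> v0 + l"
  shows "avg A (\<lambda>x. cmod ((zprod (FF w s v) (qq w s v) 1 L x + zprod (FF w s v) (qq w s v) (-1) L x) / 2 - E v 0 L x - E v 2 L x))
    \<le> 16 * KK ^ 3 * X2\<^sup>2"
proof -
  interpret chain A fl1 L p "FF w s v" "qq w s v" "\<lambda>_. 12 / sqrt (real L)" "\<lambda>a. 4 * rho * cmod (wt L w s a v)" 144 X2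
    by (rule chain_v[OF assms])
  have "avg A (\<lambda>x. cmod ((zprod (FF w s v) (qq w s v) 1 L x + zprod (FF w s v) (qq w s v) (-1) L x) / 2 - E v 0 L x - E v 2 L x))
    \<le> sqrt (exp (8 * (144 + X2)) * (4 * exp (4 * 144) * X2) ^ 4)"
    by (intro order_trans[OF rm.avg_le_wnorm[of L] real_sqrt_le_mono] nrm_remainder) auto
  also have "\<dots> \<le> sqrt (KK ^ 2 * (4 * KK * X2) ^ 4)"
    using K_le X2_pos KK1 by (intro real_sqrt_le_mono mult_mono power_mono) auto
  also have "KK ^ 2 * (4 * KK * X2) ^ 4 = (KK * (4 * KK * X2)\<^sup>2)\<^sup>2" by (simp add: power_mult_distrib)
  also have "sqrt \<dots> = KK * (4 * KK * X2)\<^sup>2" using KK1 by simp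
  also have "\<dots> = 16 * KK ^ 3 * X2\<^sup>2" by (simp add: power_mult_distrib power2_eq_square power3_eq_cube)
  finally show ?thesis .
qed

section \<open>Near-orthogonality of the columns and crude bounds\<close>

definition V :: "nat set" where "V = {v0..<v0+l}"

lemma finV: "finite V" and cardV: "card V = l" by (simp_all add: V_def)
lemma inV: "v \<in> V \<Longrightarrow> v0 \<le> v \<and> v \<le> v0 + l" by (simp add: V_def)

text \<open>The entries of the sieve matrix: \<open>f m v\<close> where it has weight one.  Marked terms are treated separately.\<close>

definition entry :: "nat \<Rightarrow> nat \<Rightarrow> 'x \<Rightarrow> real" where
  "entry m v x = (if m + v < L \<and> L \<le> m + v + w then f m v x else 0)"

lemma entry_le: "x \<in> A \<Longrightarrow> \<bar>entry m v x\<bar> \<le> 1"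
  using f_abs[of m v x] by (simp add: entry_def)

lemma entry_odd: "m < L \<Longrightarrow> x \<in> A \<Longrightarrow> entry m v (fl1 m x) = - entry m v x"
  using x1.odd_atD[OF f_odd1] by (auto simp: entry_def)

lemma entry_inv: "x1.inv_from (Suc m) (entry m v)"
  using f_inv1[of m v] by (auto simp: entry_def x1.inv_from_def)

text \<open>A flip of digit \<open>m\<close> reverses all entries of row \<open>m\<close> at once, which the modulus does not notice.\<close>

lemma sum_entry_inv:
  assumes g: "\<And>v. v \<in> V \<Longrightarrow> x1.inv_from m (g v)"
  shows "x1.inv_from m (\<lambda>x. (cmod (\<Sum>v\<in>V. of_real (entry m v x) * g v x))\<^sup>2)"
  unfolding x1.inv_from_def
proof (intro allI impI)
  fix k x assume k: "m \<le> k" "k < L" "x \<in> A"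
  have g: "g v (fl1 k x) = g v x" if "v \<in> V" for v
    using x1.inv_fromD[OF g[OF that] k] .
  show "(cmod (\<Sum>v\<in>V. of_real (entry m v (fl1 k x)) * g v (fl1 k x)))\<^sup>2 = (cmod (\<Sum>v\<in>V. of_real (entry m v x) * g v x))\<^sup>2"
  proof (cases "k = m")
    case True
    then have "(\<Sum>v\<in>V. of_real (entry m v (fl1 k x)) * g v (fl1 k x)) = - (\<Sum>v\<in>V. of_real (entry m v x) * g v x)"
      using k g entry_odd[of m x] by (simp add: sum_negf)
    then show ?thesis by simp
  next
    case False
    then have "entry m v (fl1 k x) = entry m v x" for v
      using k by (intro x1.inv_fromD[OF entry_inv]) auto
    then show ?thesis using g by simp
  qed
qed

text \<open>For \<open>v' < v\<close> the product \<open>f m v * f m v'\<close> has third level \<open>L - 1 - m - v'\<close>, the larger of the two, and these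
  levels are distinct for distinct \<open>m\<close>.  So the inner product of two columns is a martingale in the third coordinate.\<close>

lemma bad_prob:
  assumes "v \<noteq> v'" "m1 \<le> m0 + b" "m1 \<le> L"
  shows "avg A (\<lambda>x. of_bool (real b / real l < \<bar>\<Sum>m=m0..<m1. entry m v x * entry m v' x\<bar>)) \<le> 2 * exp (- (real b / (4 * (real l)\<^sup>2)))"
  using assms(1)
proof (induction v' v rule: linorder_wlog)
  case (le v' v)
  then have lt: "v' < v" by simp
  define M where "M = {m \<in> {m0..<m1}. m + v < L \<and> L \<le> m + v' + w}"
  have eq: "(\<Sum>m=m0..<m1. entry m v x * entry m v' x) = (\<Sum>m\<in>M. f m v x * f m v' x)" for x
    unfolding M_def using lt by (intro sum.mono_neutral_cong_right) (auto simp: entry_def)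
  have cM: "card M \<le> b"
  proof -
    have "card M \<le> card {m0..<m1}" unfolding M_def by (intro card_mono) auto
    then show ?thesis using assms(2) by simp
  qed
  have "avg A (\<lambda>x. of_bool (real b / real l < \<bar>\<Sum>m\<in>M. f m v x * f m v' x\<bar>)) \<le> 2 * exp (- (real b / real l)\<^sup>2 / (4 * real b))"
  proof (rule x3.azuma[where lev = "\<lambda>m. L - 1 - m - v'"])
    show "finite M" by (simp add: M_def)
    show "real (card M) \<le> real b" using cM by simp
    show "0 < real b" using b0 by simp
    show "L - 1 - m - v' < L" for m using L0 by simp
    show "L - 1 - m' - v' < L - 1 - m - v'" if "m \<in> M" "m' \<in> M" "m < m'" for m m'
      using that lt by (auto simp: M_def)
    fix m assume m: "m \<in> M"
    then have mv: "m + v < L" "m + v' < L" using lt by (auto simp: M_def)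
    have "x3.inv_from (L - 1 - m - v') (f m v)"
      by (rule x3.inv_from_mono[OF f_inv3[OF mv(1)]]) (use lt in simp)
    then have "x3.odd_at (L - 1 - m - v') (\<lambda>x. f m v' x * f m v x)"
      using L0 by (intro x3.odd_at_mult_inv f_odd3 mv) auto
    then show "x3.odd_at (L - 1 - m - v') (\<lambda>x. f m v x * f m v' x)" by (simp add: mult.commute)
    show "x3.inv_from (Suc (L - 1 - m - v')) (\<lambda>x. f m v x * f m v' x)"
      by (intro x3.inv_from_mult x3.inv_from_mono[OF f_inv3[OF mv(1)]] x3.inv_from_mono[OF f_inv3[OF mv(2)]])
         (use lt mv in auto)
    show "\<bar>f m v x * f m v' x\<bar> \<le> 1" if "x \<in> A" for x
      using f_abs[OF mv(1) that] f_abs[OF mv(2) that] by (simp add: abs_mult)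
  qed simp
  also have "- (real b / real l)\<^sup>2 / (4 * real b) = - (real b / (4 * (real l)\<^sup>2))"
    using b0 by (simp add: power_divide power2_eq_square field_simps)
  finally show ?case unfolding eq .
next
  case (sym v v')
  then show ?case by (simp add: mult.commute)
qed

lemma gamL: "gam * real L = G * sqrt (real L)"
  using L0 by (simp add: gam_def divide_simps mult.assoc)

lemma psi_upper: "m \<le> L \<Longrightarrow> x \<in> A \<Longrightarrow> rm.psi m x \<le> exp (2 * G * sqrt (real L))"
proof -
  assume m: "m \<le> L" and x: "x \<in> A"
  have "rm.psi m x \<le> (\<Prod>a<m. exp (2 * gam))"
    unfolding rm.psi_def
  proof (intro prod_mono conjI)
    fix a assume "a \<in> {..<m}"
    then show "0 \<le> p a x" using rm.p_pos[of a x] m x by simp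
    show "p a x \<le> exp (2 * gam)" using p_bounds[OF x, of a] exp_ge_add_one_self[of "2 * gam"] by linarith
  qed
  also have "\<dots> = exp (2 * gam) ^ m" by simp
  also have "\<dots> \<le> exp (2 * gam) ^ L" using m gam_pos by (intro power_increasing) auto
  also have "\<dots> = exp (2 * (gam * real L))" by (simp add: exp_of_nat_mult[symmetric] mult_ac)
  finally show ?thesis by (simp only: gamL mult.assoc)
qed

lemma psi_lower: "m \<le> L \<Longrightarrow> x \<in> A \<Longrightarrow> exp (- 4 * G * sqrt (real L)) \<le> rm.psi m x"
proof -
  assume m: "m \<le> L" and x: "x \<in> A"
  have "exp (- 4 * G * sqrt (real L)) = exp (- 4 * gam) ^ L"
    by (simp add: exp_of_nat_mult[symmetric] gamL[symmetric] mult_ac)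
  also have "\<dots> \<le> exp (- 4 * gam) ^ m" using m gam_pos by (intro power_decreasing) auto
  also have "\<dots> = (\<Prod>a<m. exp (- 4 * gam))" by simp
  also have "\<dots> \<le> rm.psi m x"
    unfolding rm.psi_def
  proof (intro prod_mono conjI)
    fix a
    have "1 \<le> (1 - 2 * gam) * (1 + 4 * gam)"
    proof -
      have "0 \<le> 2 * gam * (1 - 4 * gam)" using gam_pos gam_le by (intro mult_nonneg_nonneg) auto
      then show ?thesis by (simp add: algebra_simps)
    qed
    also have "\<dots> \<le> (1 - 2 * gam) * exp (4 * gam)"
      using gam_le exp_ge_add_one_self[of "4 * gam"] by (intro mult_left_mono) auto
    finally have "exp (- 4 * gam) \<le> 1 - 2 * gam" by (simp add: exp_minus field_simps)
    then show "exp (- 4 * gam) \<le> p a x" using p_bounds[OF x, of a] by linarith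
  qed simp
  finally show ?thesis .
qed

lemma inv_sqrt_le_gam: "1 / sqrt (real L) \<le> gam"
  using G1 by (simp add: gam_def divide_right_mono)

lemma rho_wt: "rho * cmod (wt L w s a v) \<le> gam"
proof -
  have "rho \<le> 1 / sqrt (real L)"
  proof -
    have "rho * 1 \<le> rho * real l" using l0 rho_pos by (intro mult_left_mono) auto
    then show ?thesis using rho_l by simp
  qed
  then have "rho \<le> gam" "rho * cmod s \<le> gam" using rho_s inv_sqrt_le_gam by linarith+
  then show ?thesis using gam_pos by (simp add: wt_def)
qed

text \<open>The sum of the orders zero and one grows by a factor \<open>1 + 8 gam\<close> at most in each step.\<close>

lemma E1_sup:
  assumes v: "v \<in> V" and x: "x \<in> A"
  shows "cmod (E v 1 m x) \<le> exp (8 * gam) ^ m"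
proof -
  have "cmod (E v 0 m x) + cmod (E v 1 m x) \<le> exp (8 * gam) ^ m"
  proof (induction m)
    case (Suc m)
    define F where "F = cmod (FF w s v m x)"
    define q where "q = cmod (qq w s v m x)"
    have q: "q \<le> 4 * gam" using qq_le[OF x tau_s, of w v m] rho_wt[of m v] by (simp add: q_def)
    have F: "F \<le> 1 + 4 * gam"
    proof -
      have "F \<le> 1 + gam * cmod (Th w s v m x)" unfolding F_def FF_def
        using norm_triangle_ineq[of 1 "of_real gam * Th w s v m x"] gam_pos by (simp add: norm_mult)
      also have "\<dots> \<le> 1 + gam * 4" using Th_le[OF x tau_s] gam_pos by (intro add_left_mono mult_left_mono) auto
      finally show ?thesis by simp
    qed
    have "cmod (E v 0 (Suc m) x) + cmod (E v 1 (Suc m) x)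
      \<le> F * cmod (E v 0 m x) + (F * cmod (E v 1 m x) + q * cmod (E v 0 m x))"
      unfolding F_def q_def using norm_triangle_ineq[of "FF w s v m x * E v 1 m x" "qq w s v m x * E v 0 m x"]
      by (simp add: norm_mult)
    also have "\<dots> \<le> F * cmod (E v 0 m x) + (F * cmod (E v 1 m x) + 4 * gam * cmod (E v 0 m x)) + 4 * gam * cmod (E v 1 m x)"
    proof -
      have "q * cmod (E v 0 m x) \<le> 4 * gam * cmod (E v 0 m x)" using q by (intro mult_right_mono) auto
      moreover have "0 \<le> 4 * gam * cmod (E v 1 m x)" using gam_pos by simp
      ultimately show ?thesis by linarith
    qed
    also have "\<dots> = (F + 4 * gam) * (cmod (E v 0 m x) + cmod (E v 1 m x))" by (simp add: algebra_simps)
    also have "\<dots> \<le> exp (8 * gam) * exp (8 * gam) ^ m"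
    proof (intro mult_mono Suc.IH)
      show "F + 4 * gam \<le> exp (8 * gam)" using F exp_ge_add_one_self[of "8 * gam"] by linarith
    qed auto
    finally show ?case by simp
  qed simp
  then show ?thesis using norm_ge_zero[of "E v 0 m x"] by linarith
qed

lemma E1_sup': "v \<in> V \<Longrightarrow> x \<in> A \<Longrightarrow> m \<le> L \<Longrightarrow> cmod (E v 1 m x) \<le> exp (8 * G * sqrt (real L))"
proof -
  assume *: "v \<in> V" "x \<in> A" "m \<le> L"
  have "cmod (E v 1 m x) \<le> exp (8 * gam) ^ m" by (rule E1_sup[OF *(1,2)])
  also have "\<dots> \<le> exp (8 * gam) ^ L" using * gam_pos by (intro power_increasing) auto
  also have "\<dots> = exp (8 * G * sqrt (real L))"
    by (simp add: exp_of_nat_mult[symmetric] gamL[symmetric] mult_ac)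
  finally show ?thesis .
qed

lemma nrm_E1: "v \<in> V \<Longrightarrow> m \<le> L \<Longrightarrow> rm.nrm m (E v 1 m) \<le> 4 * KK ^ 3 * X2"
  using nrm_E[of v m 1] inV[of v] by (simp add: power3_eq_cube power2_eq_square mult_ac)

lemma nrm_E0: "v \<in> V \<Longrightarrow> m \<le> L \<Longrightarrow> rm.nrm m (E v 0 m) \<le> KK ^ 2"
  using nrm_E[of v m 0] inV[of v] by simp

text \<open>A bound for the squared norm of the increment that the first-order coefficient receives at step \<open>j\<close> besides multiplication by the density.\<close>

definition drift :: "nat \<Rightarrow> nat \<Rightarrow> real" where
  "drift v j = 4 * (144 / real L * (4 * KK ^ 3 * X2) + (4 * rho * cmod (wt L w s j v))\<^sup>2 * KK ^ 2)"

lemma drift_nonneg: "0 \<le> drift v j" using KK1 X2_pos by (simp add: drift_def)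

lemma sum_drift: "(\<Sum>j<L. drift v j) \<le> 2400 * KK ^ 3 * X2"
proof -
  have "(\<Sum>j<L. drift v j) = 4 * (144 * (4 * KK ^ 3 * X2)) + 4 * ((\<Sum>j<L. (4 * rho * cmod (wt L w s j v))\<^sup>2) * KK ^ 2)"
    using L0 by (simp add: drift_def sum.distrib sum_distrib_left sum_distrib_right mult_ac)
  also have "\<dots> \<le> 4 * (144 * (4 * KK ^ 3 * X2)) + 4 * (X2 * KK ^ 3)"
  proof (intro add_left_mono mult_left_mono mult_mono sum_wt)
    show "KK ^ 2 \<le> KK ^ 3" using KK1 by (intro power_increasing) auto
  qed (use X2_pos in auto)
  also have "\<dots> \<le> 2400 * KK ^ 3 * X2" using KK1 X2_pos by simp
  finally show ?thesis .
qed

text \<open>Relative to the density the first-order coefficient moves little within a block, so it may be frozen at the beginning of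
  the block; its motion consists of odd increments and is controlled by the Pythagorean step.\<close>

lemma drift_bound:
  assumes v: "v \<in> V" and "m0 \<le> m" "m \<le> L"
  shows "rm.nrm m (\<lambda>x. E v 1 m x - of_real (rm.psi m x / rm.psi m0 x) * E v 1 m0 x) \<le> (\<Sum>j=m0..<m. drift v j)"
  using assms(2,3)
proof (induction m rule: dec_induct)
  case base
  have e: "rm.nrm m0 (\<lambda>x. E v 1 m0 x - of_real (rm.psi m0 x / rm.psi m0 x) * E v 1 m0 x) = rm.nrm m0 (\<lambda>x. 0)"
    using rm.psi_pos[OF base] by (intro wnorm_cong) (auto dest: less_imp_neq[symmetric])
  show ?case unfolding e by (simp add: wnorm_def avg_def)
next
  case (step m)
  have mL: "m < L" using step.prems by simp
  define X where "X = (\<lambda>x. E v 1 m x - of_real (rm.psi m x / rm.psi m0 x) * E v 1 m0 x)"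
  define Y where "Y = (\<lambda>x. (FF w s v m x - of_real (p m x)) * E v 1 m x + qq w s v m x * E v 0 m x)"
  interpret ch: chain A fl1 L p "FF w s v" "qq w s v" "\<lambda>_. 12 / sqrt (real L)" "\<lambda>a. 4 * rho * cmod (wt L w s a v)" 144 X2
    using chain_v inV[OF v] by blast
  have Xinv: "x1.inv_from m X" unfolding X_def
    using step.hyps mL inV[OF v]
    by (intro x1.inv_from_diff x1.inv_from_mult E_inv x1.inv_from_mono[OF E_inv[of v m0]]
        x1.inv_from_comp[where g = of_real] x1.inv_from_divide rm.psi_inv x1.inv_from_mono[OF rm.psi_inv[of m0]]) auto
  have Yodd: "x1.odd_at m Y" unfolding Y_def
    using mL by (intro x1.odd_at_add x1.odd_at_mult_inv ch.F_odd ch.q_odd ch.zcoeff_inv) auto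
  have e: "rm.nrm (Suc m) (\<lambda>x. E v 1 (Suc m) x - of_real (rm.psi (Suc m) x / rm.psi m0 x) * E v 1 m0 x)
     = rm.nrm (Suc m) (\<lambda>x. of_real (p m x) * X x + Y x)"
    by (intro wnorm_cong) (simp add: X_def Y_def rm.psi_Suc algebra_simps)
  have 1: "rm.nrm (Suc m) (\<lambda>x. of_real (p m x) * X x + Y x) \<le> rm.nrm m X + 2 * rm.nrm m Y"
    by (rule rm.nrm_step[OF mL Xinv Yodd])
  have 2: "rm.nrm m Y \<le> 2 * rm.nrm m (\<lambda>x. (FF w s v m x - of_real (p m x)) * E v 1 m x) + 2 * rm.nrm m (\<lambda>x. qq w s v m x * E v 0 m x)"
    unfolding Y_def by (intro wnorm_add_le rm.psi_pos) (use mL in auto)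
  have "rm.nrm m (\<lambda>x. (FF w s v m x - of_real (p m x)) * E v 1 m x) \<le> (12 / sqrt (real L))\<^sup>2 * rm.nrm m (E v 1 m)"
    by (intro wnorm_mult_le rm.psi_pos ch.F_le) (use mL in auto)
  also have "\<dots> \<le> (12 / sqrt (real L))\<^sup>2 * (4 * KK ^ 3 * X2)"
    using nrm_E1[OF v, of m] mL by (intro mult_left_mono) auto
  finally have 3: "rm.nrm m (\<lambda>x. (FF w s v m x - of_real (p m x)) * E v 1 m x) \<le> 144 / real L * (4 * KK ^ 3 * X2)"
    using L0 by (simp add: power_divide)
  have "rm.nrm m (\<lambda>x. qq w s v m x * E v 0 m x) \<le> (4 * rho * cmod (wt L w s m v))\<^sup>2 * rm.nrm m (E v 0 m)"
    by (intro wnorm_mult_le rm.psi_pos ch.q_le) (use mL in auto)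
  also have "\<dots> \<le> (4 * rho * cmod (wt L w s m v))\<^sup>2 * KK ^ 2"
    using nrm_E0[OF v, of m] mL by (intro mult_left_mono) auto
  finally have 4: "rm.nrm m (\<lambda>x. qq w s v m x * E v 0 m x) \<le> (4 * rho * cmod (wt L w s m v))\<^sup>2 * KK ^ 2" .
  have "rm.nrm (Suc m) (\<lambda>x. E v 1 (Suc m) x - of_real (rm.psi (Suc m) x / rm.psi m0 x) * E v 1 m0 x) \<le> rm.nrm m X + drift v m"
  proof -
    from nested_le[OF 1 2 3 4] show ?thesis unfolding e drift_def .
  qed
  then show ?case using step.IH step.hyps mL by (simp add: X_def)
qed

section \<open>The sieve estimate over blocks of first levels\<close>

text \<open>With the coefficients frozen at \<open>m0\<close>, all norms in the block can be taken with respect to the density at its end, and the sum over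
  \<open>m\<close> is a quadratic form in the coefficients for every fixed \<open>x\<close>.  The large sieve applies with off-diagonal bound \<open>b / l\<close> outside
  the exceptional set and with the trivial bound \<open>b\<close> on it.\<close>

lemma main_block:
  assumes m: "m0 \<le> m1" "m1 \<le> L" "m1 \<le> m0 + b"
  shows "(\<Sum>m=m0..<m1. rm.nrm m (\<lambda>x. \<Sum>v\<in>V. of_real (entry m v x) * (of_real (rm.psi m x / rm.psi m0 x) * E v 1 m0 x)))
    \<le> 12 * real b * real l * KK ^ 3 * X2"
proof -
  define g where "g = (\<lambda>v x. E v 1 m0 x / of_real (rm.psi m0 x))"
  define bad where "bad = (\<lambda>v v' x. real b / real l < \<bar>\<Sum>m=m0..<m1. entry m v x * entry m v' x\<bar>)"
  define Bd :: "'x \<Rightarrow> real" where "Bd = (\<lambda>x. \<Sum>v\<in>V. \<Sum>v'\<in>V-{v}. of_bool (bad v v' x))"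
  define S where "S = (\<lambda>x. \<Sum>v\<in>V. (cmod (g v x))\<^sup>2)"
  define Q where "Q = G * sqrt (real L)"
  have m0L: "m0 \<le> L" using m by simp
  have l1: "1 \<le> real l" using l0 by simp
  have ginv: "x1.inv_from m0 (g v)" if "v \<in> V" for v
    unfolding g_def using inV[OF that] m0L
    by (intro x1.inv_from_divide E_inv x1.inv_from_comp[where g = of_real] rm.psi_inv) auto
  have e1: "rm.nrm k (\<lambda>x. \<Sum>v\<in>V. of_real (entry k v x) * (of_real (rm.psi k x / rm.psi m0 x) * E v 1 m0 x))
     = avg A (\<lambda>x. rm.psi m1 x * (cmod (\<Sum>v\<in>V. of_real (entry k v x) * g v x))\<^sup>2)" if k: "k \<in> {m0..<m1}" for k
  proof -
    have kL: "k \<le> L" "k \<le> m1" using k m by auto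
    have "rm.nrm k (\<lambda>x. \<Sum>v\<in>V. of_real (entry k v x) * (of_real (rm.psi k x / rm.psi m0 x) * E v 1 m0 x))
      = avg A (\<lambda>x. rm.psi k x * (cmod (\<Sum>v\<in>V. of_real (entry k v x) * g v x))\<^sup>2)"
      unfolding wnorm_def
    proof (rule avg_cong)
      fix x assume x: "x \<in> A"
      have ps: "rm.psi k x > 0" by (rule rm.psi_pos[OF kL(1) x])
      have "(\<Sum>v\<in>V. of_real (entry k v x) * (of_real (rm.psi k x / rm.psi m0 x) * E v 1 m0 x))
        = of_real (rm.psi k x) * (\<Sum>v\<in>V. of_real (entry k v x) * g v x)"
        unfolding sum_distrib_left by (intro sum.cong) (simp_all add: g_def)
      then show "(cmod (\<Sum>v\<in>V. of_real (entry k v x) * (of_real (rm.psi k x / rm.psi m0 x) * E v 1 m0 x)))\<^sup>2 / rm.psi k x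
        = rm.psi k x * (cmod (\<Sum>v\<in>V. of_real (entry k v x) * g v x))\<^sup>2"
        using ps by (simp add: norm_mult power_mult_distrib power2_eq_square)
    qed
    also have "\<dots> = avg A (\<lambda>x. rm.psi m1 x * (cmod (\<Sum>v\<in>V. of_real (entry k v x) * g v x))\<^sup>2)"
    proof (rule rm.avg_psi_extend[symmetric, OF kL(2) m(2)])
      show "x1.inv_from k (\<lambda>x. (cmod (\<Sum>v\<in>V. of_real (entry k v x) * g v x))\<^sup>2)"
        by (rule sum_entry_inv) (use k in \<open>auto intro: x1.inv_from_mono[OF ginv]\<close>)
    qed
    finally show ?thesis .
  qed
  have "(\<Sum>m=m0..<m1. rm.nrm m (\<lambda>x. \<Sum>v\<in>V. of_real (entry m v x) * (of_real (rm.psi m x / rm.psi m0 x) * E v 1 m0 x)))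
     = avg A (\<lambda>x. \<Sum>m=m0..<m1. rm.psi m1 x * (cmod (\<Sum>v\<in>V. of_real (entry m v x) * g v x))\<^sup>2)"
    unfolding avg_sum by (intro sum.cong e1) auto
  also have "\<dots> \<le> avg A (\<lambda>x. 2 * real b * (rm.psi m1 x * S x) + 2 * real l * real b * real l * exp (26 * Q) * Bd x)"
  proof (rule avg_mono)
    fix x assume x: "x \<in> A"
    have psm: "0 < rm.psi m1 x" "0 < rm.psi m0 x" using rm.psi_pos x m m0L by auto
    have S0: "0 \<le> S x" unfolding S_def by (intro sum_nonneg) auto
    have diag: "(\<Sum>m=m0..<m1. (entry m v x)\<^sup>2) \<le> real b" for v
    proof -
      have "(\<Sum>m=m0..<m1. (entry m v x)\<^sup>2) \<le> (\<Sum>m=m0..<m1. 1)"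
        using entry_le[OF x] by (intro sum_mono) (simp add: abs_square_le_1)
      also have "\<dots> \<le> real b" using m by simp
      finally show ?thesis .
    qed
    have triv: "\<bar>\<Sum>m=m0..<m1. entry m v x * entry m v' x\<bar> \<le> real b" for v v'
    proof -
      have "\<bar>\<Sum>m=m0..<m1. entry m v x * entry m v' x\<bar> \<le> (\<Sum>m=m0..<m1. 1)"
        using entry_le[OF x] by (intro order_trans[OF sum_abs] sum_mono) (simp add: abs_mult mult_le_one)
      also have "\<dots> \<le> real b" using m by simp
      finally show ?thesis .
    qed
    have key: "(\<Sum>m=m0..<m1. (cmod (\<Sum>v\<in>V. of_real (entry m v x) * g v x))\<^sup>2) \<le> 2 * real b * S x + 2 * real l * real b * S x * Bd x"
    proof (cases "\<exists>v\<in>V. \<exists>v'\<in>V. v \<noteq> v' \<and> bad v v' x")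
      case False
      have "(\<Sum>m=m0..<m1. (cmod (\<Sum>v\<in>V. of_real (entry m v x) * g v x))\<^sup>2) \<le> (real b + real (card V) * (real b / real l)) * S x"
        unfolding S_def by (rule large_sieve) (use False diag finV in \<open>auto simp: bad_def not_less\<close>)
      also have "\<dots> = 2 * real b * S x" using l0 by (simp add: cardV)
      finally show ?thesis using S0 by (simp add: Bd_def sum_nonneg add_increasing2)
    next
      case True
      then obtain v v' where v: "v \<in> V" "v' \<in> V - {v}" "bad v v' x" by auto
      have "1 \<le> (\<Sum>v'\<in>V-{v}. of_bool (bad v v' x) :: real)"
        using v finV by (intro order_trans[OF _ member_le_sum[of v']]) auto
      also have "\<dots> \<le> Bd x" unfolding Bd_def
        using v finV by (intro member_le_sum[of v]) (auto intro: sum_nonneg)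
      finally have B1: "1 \<le> Bd x" .
      have "(\<Sum>m=m0..<m1. (cmod (\<Sum>v\<in>V. of_real (entry m v x) * g v x))\<^sup>2) \<le> (real b + real (card V) * real b) * S x"
        unfolding S_def by (rule large_sieve) (use diag triv finV in auto)
      also have "\<dots> \<le> (2 * real l * real b) * S x"
      proof (intro mult_right_mono S0)
        have "1 * real b \<le> real l * real b" using l1 by (intro mult_right_mono) auto
        then show "real b + real (card V) * real b \<le> 2 * real l * real b" by (simp add: cardV mult.commute)
      qed
      also have "\<dots> * 1 \<le> 2 * real l * real b * S x * Bd x"
        using B1 S0 by (intro mult_left_mono) auto
      finally show ?thesis using S0 by (simp add: add_increasing)
    qed
    \<comment> \<open>The exponent is \<open>26 = 2 + 2 * (8 + 4)\<close>, from the density at \<open>m1\<close> and the square of the frozen coefficient over the density at \<open>m0\<close>.\<close>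
    have Sup: "rm.psi m1 x * S x \<le> real l * exp (26 * Q)"
    proof -
      have "rm.psi m1 x * (cmod (g v x))\<^sup>2 \<le> exp (26 * Q)" if v: "v \<in> V" for v
      proof -
        have "cmod (g v x) = cmod (E v 1 m0 x) * (1 / rm.psi m0 x)" using psm by (simp add: g_def norm_divide)
        also have "\<dots> \<le> exp (8 * Q) * (1 / exp (- 4 * Q))"
          using E1_sup'[OF v x m0L] psi_lower[OF m0L x] less_imp_le[OF psm(2)]
          by (intro mult_mono divide_left_mono) (auto simp: Q_def mult.assoc intro!: mult_pos_pos psm)
        also have "\<dots> = exp (12 * Q)" by (simp add: exp_minus inverse_eq_divide exp_add[symmetric])
        finally have "(cmod (g v x))\<^sup>2 \<le> (exp (12 * Q))\<^sup>2" by (intro power_mono) auto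
        also have "\<dots> = exp (24 * Q)" by (simp add: exp_of_nat_mult[symmetric])
        finally have "rm.psi m1 x * (cmod (g v x))\<^sup>2 \<le> exp (2 * Q) * exp (24 * Q)"
          using psi_upper[OF m(2) x] by (intro mult_mono) (auto simp: Q_def mult.assoc)
        then show ?thesis by (simp add: exp_add[symmetric])
      qed
      then have "(\<Sum>v\<in>V. rm.psi m1 x * (cmod (g v x))\<^sup>2) \<le> (\<Sum>v\<in>V. exp (26 * Q))" by (intro sum_mono)
      then show ?thesis by (simp add: S_def sum_distrib_left cardV)
    qed
    have Bd0: "0 \<le> Bd x" unfolding Bd_def by (intro sum_nonneg) auto
    have "(\<Sum>m=m0..<m1. rm.psi m1 x * (cmod (\<Sum>v\<in>V. of_real (entry m v x) * g v x))\<^sup>2)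
      \<le> rm.psi m1 x * (2 * real b * S x + 2 * real l * real b * S x * Bd x)"
      unfolding sum_distrib_left[symmetric] using key psm by (intro mult_left_mono) auto
    also have "\<dots> = 2 * real b * (rm.psi m1 x * S x) + 2 * real l * real b * (rm.psi m1 x * S x) * Bd x"
      by (simp add: algebra_simps)
    also have "\<dots> \<le> 2 * real b * (rm.psi m1 x * S x) + 2 * real l * real b * (real l * exp (26 * Q)) * Bd x"
      using Sup Bd0 by (intro add_left_mono mult_right_mono mult_left_mono) auto
    finally show "(\<Sum>m=m0..<m1. rm.psi m1 x * (cmod (\<Sum>v\<in>V. of_real (entry m v x) * g v x))\<^sup>2)
       \<le> 2 * real b * (rm.psi m1 x * S x) + 2 * real l * real b * real l * exp (26 * Q) * Bd x" by (simp add: mult_ac)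
  qed
  also have "\<dots> = 2 * real b * avg A (\<lambda>x. rm.psi m1 x * S x) + 2 * real l * real b * real l * exp (26 * Q) * avg A Bd"
    by (simp only: avg_add avg_cmult)
  also have "\<dots> \<le> 2 * real b * (real l * (4 * KK ^ 3 * X2)) + 2 * real l * real b * real l * exp (26 * Q) * ((real l)\<^sup>2 * (2 * exp (- (real b / (4 * (real l)\<^sup>2)))))"
  proof (intro add_mono mult_left_mono)
    have "avg A (\<lambda>x. rm.psi m1 x * S x) = (\<Sum>v\<in>V. avg A (\<lambda>x. rm.psi m1 x * (cmod (g v x))\<^sup>2))"
      unfolding S_def sum_distrib_left avg_sum ..
    also have "\<dots> \<le> (\<Sum>v\<in>V. 4 * KK ^ 3 * X2)"
    proof (rule sum_mono)
      fix v assume v: "v \<in> V"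
      have "avg A (\<lambda>x. rm.psi m1 x * (cmod (g v x))\<^sup>2) = avg A (\<lambda>x. rm.psi m0 x * (cmod (g v x))\<^sup>2)"
        by (rule rm.avg_psi_extend[OF m(1,2)]) (rule x1.inv_from_comp[OF ginv[OF v]])
      also have "\<dots> = rm.nrm m0 (E v 1 m0)"
        unfolding wnorm_def g_def using rm.psi_pos[OF m0L]
        by (intro avg_cong) (auto simp: norm_divide power_divide power2_eq_square dest: less_imp_neq[symmetric])
      also have "\<dots> \<le> 4 * KK ^ 3 * X2" by (rule nrm_E1[OF v m0L])
      finally show "avg A (\<lambda>x. rm.psi m1 x * (cmod (g v x))\<^sup>2) \<le> 4 * KK ^ 3 * X2" .
    qed
    finally show "avg A (\<lambda>x. rm.psi m1 x * S x) \<le> real l * (4 * KK ^ 3 * X2)" by (simp add: cardV)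
    have "avg A Bd = (\<Sum>v\<in>V. \<Sum>v'\<in>V-{v}. avg A (\<lambda>x. of_bool (bad v v' x)))"
      unfolding Bd_def avg_sum ..
    also have "\<dots> \<le> (\<Sum>v\<in>V. \<Sum>v'\<in>V-{v}. 2 * exp (- (real b / (4 * (real l)\<^sup>2))))"
      unfolding bad_def using m by (intro sum_mono bad_prob) auto
    also have "\<dots> \<le> (\<Sum>v\<in>V. \<Sum>v'\<in>V. 2 * exp (- (real b / (4 * (real l)\<^sup>2))))"
      by (intro sum_mono sum_mono2 finV) auto
    finally show "avg A Bd \<le> (real l)\<^sup>2 * (2 * exp (- (real b / (4 * (real l)\<^sup>2))))"
      by (simp add: cardV power2_eq_square)
  qed auto
  also have "2 * real l * real b * real l * exp (26 * Q) * ((real l)\<^sup>2 * (2 * exp (- (real b / (4 * (real l)\<^sup>2)))))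
     = 4 * real b * real l * (real l ^ 3 * exp (26 * Q - real b / (4 * (real l)\<^sup>2)))"
    by (simp add: exp_diff exp_minus power2_eq_square power3_eq_cube field_simps)
  also have "\<dots> \<le> 4 * real b * real l * X2"
  proof (intro mult_left_mono)
    have "real l ^ 3 * exp (26 * Q - real b / (4 * (real l)\<^sup>2)) \<le> real l ^ 3 * exp (30 * Q - real b / (4 * (real l)\<^sup>2))"
      using G1 by (intro mult_left_mono) (auto simp: Q_def)
    also have "\<dots> \<le> X2" using c2 by (simp add: Q_def X2_def mult.assoc)
    finally show "real l ^ 3 * exp (26 * Q - real b / (4 * (real l)\<^sup>2)) \<le> X2" .
  qed auto
  also have "4 * real b * real l * X2 \<le> 4 * real b * real l * (KK ^ 3 * X2)"
    using KK1 X2_pos by (intro mult_left_mono) (auto simp: mult_le_cancel_right1)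
  finally show ?thesis by (simp add: algebra_simps)
qed

lemma sieve_block:
  assumes m: "m0 \<le> m1" "m1 \<le> L" "m1 \<le> m0 + b"
  shows "(\<Sum>m=m0..<m1. rm.nrm m (\<lambda>x. \<Sum>v\<in>V. of_real (entry m v x) * E v 1 m x))
    \<le> 24 * real b * real l * KK ^ 3 * X2 + 2 * real b * real l * (\<Sum>v\<in>V. \<Sum>j=m0..<m1. drift v j)"
proof -
  define T1 where "T1 = (\<lambda>m x. \<Sum>v\<in>V. of_real (entry m v x) * (of_real (rm.psi m x / rm.psi m0 x) * E v 1 m0 x))"
  define X where "X = (\<lambda>v m x. E v 1 m x - of_real (rm.psi m x / rm.psi m0 x) * E v 1 m0 x)"
  define T2 where "T2 = (\<lambda>m x. \<Sum>v\<in>V. of_real (entry m v x) * X v m x)"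
  have one: "rm.nrm m (\<lambda>x. \<Sum>v\<in>V. of_real (entry m v x) * E v 1 m x)
     \<le> 2 * rm.nrm m (T1 m) + 2 * (real l * (\<Sum>v\<in>V. \<Sum>j=m0..<m1. drift v j))" if k: "m \<in> {m0..<m1}" for m
  proof -
    have mL: "m \<le> L" using k m by simp
    have "rm.nrm m (\<lambda>x. \<Sum>v\<in>V. of_real (entry m v x) * E v 1 m x) = rm.nrm m (\<lambda>x. T1 m x + T2 m x)"
      unfolding T1_def T2_def X_def sum.distrib[symmetric]
      by (intro wnorm_cong sum.cong) (simp_all add: algebra_simps)
    also have "\<dots> \<le> 2 * rm.nrm m (T1 m) + 2 * rm.nrm m (T2 m)"
      by (intro wnorm_add_le rm.psi_pos mL)
    also have "rm.nrm m (T2 m) \<le> real (card V) * (\<Sum>v\<in>V. rm.nrm m (\<lambda>x. of_real (entry m v x) * X v m x))"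
      unfolding T2_def by (intro wnorm_sum_le rm.psi_pos mL finV)
    also have "(\<Sum>v\<in>V. rm.nrm m (\<lambda>x. of_real (entry m v x) * X v m x)) \<le> (\<Sum>v\<in>V. \<Sum>j=m0..<m1. drift v j)"
    proof (rule sum_mono)
      fix v assume v: "v \<in> V"
      have "rm.nrm m (\<lambda>x. of_real (entry m v x) * X v m x) \<le> 1\<^sup>2 * rm.nrm m (X v m)"
        by (intro wnorm_mult_le rm.psi_pos mL) (auto simp: entry_le)
      also have "1\<^sup>2 * rm.nrm m (X v m) \<le> (\<Sum>j=m0..<m. drift v j)"
        unfolding X_def using drift_bound[OF v _ mL] k by simp
      also have "\<dots> \<le> (\<Sum>j=m0..<m1. drift v j)" using k drift_nonneg by (intro sum_mono2) auto
      finally show "rm.nrm m (\<lambda>x. of_real (entry m v x) * X v m x) \<le> (\<Sum>j=m0..<m1. drift v j)" .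
    qed
    finally show ?thesis by (simp add: cardV mult_left_mono)
  qed
  have "(\<Sum>m=m0..<m1. rm.nrm m (\<lambda>x. \<Sum>v\<in>V. of_real (entry m v x) * E v 1 m x))
    \<le> (\<Sum>m=m0..<m1. 2 * rm.nrm m (T1 m) + 2 * (real l * (\<Sum>v\<in>V. \<Sum>j=m0..<m1. drift v j)))"
    by (intro sum_mono one)
  also have "\<dots> = 2 * (\<Sum>m=m0..<m1. rm.nrm m (T1 m)) + real (m1 - m0) * (2 * (real l * (\<Sum>v\<in>V. \<Sum>j=m0..<m1. drift v j)))"
    by (simp add: sum.distrib sum_distrib_left)
  also have "\<dots> \<le> 2 * (12 * real b * real l * KK ^ 3 * X2) + real b * (2 * (real l * (\<Sum>v\<in>V. \<Sum>j=m0..<m1. drift v j)))"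
    using main_block[OF m] m drift_nonneg unfolding T1_def
    by (intro add_mono mult_left_mono mult_right_mono) (auto intro!: sum_nonneg mult_nonneg_nonneg)
  finally show ?thesis by (simp add: algebra_simps)
qed

text \<open>On average over \<open>m\<close> the \<open>l\<close> columns behave as if they were orthogonal: the bound is \<open>L * l\<close> times the squared
  norm of one coefficient, instead of \<open>L * l\<^sup>2\<close>.\<close>

lemma sieve_total:
  "(\<Sum>m<L. rm.nrm m (\<lambda>x. \<Sum>v\<in>V. of_real (entry m v x) * E v 1 m x)) \<le> 5000 * KK ^ 3 * real l * real L * X2"
proof -
  define h where "h = (\<lambda>m. rm.nrm m (\<lambda>x. \<Sum>v\<in>V. of_real (entry m v x) * E v 1 m x))"
  define h' where "h' = (\<lambda>m. if m < L then h m else 0)"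
  define k' where "k' = (\<lambda>j. if j < L then (\<Sum>v\<in>V. drift v j) else 0)"
  \<comment> \<open>The last block may extend beyond \<open>L\<close>; the terms are continued by zero.\<close>
  define k where "k = Suc (L div b)"
  have kb: "L \<le> k * b" unfolding k_def using b0 by (metis div_mult_mod_eq mod_less_divisor add.commute add_le_cancel_left less_imp_le mult_Suc)
  have "k * b \<le> 2 * L"
  proof -
    have "b \<le> l * b" using l0 by simp
    then have "b \<le> L" using c1 by linarith
    moreover have "L div b * b \<le> L" by simp
    ultimately have "b + L div b * b \<le> 2 * L" by linarith
    then show ?thesis by (simp add: k_def)
  qed
  then have kb2: "real k * real b \<le> 2 * real L" by (metis of_nat_mono of_nat_mult of_nat_numeral)
  have blk: "(\<Sum>m=i*b..<i*b+b. h' m) \<le> 24 * real b * real l * KK ^ 3 * X2 + 2 * real b * real l * (\<Sum>j=i*b..<i*b+b. k' j)" for i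
  proof (cases "i * b \<le> L")
    case True
    define m1 where "m1 = min (i * b + b) L"
    have m1: "i * b \<le> m1" "m1 \<le> L" "m1 \<le> i * b + b" using True by (auto simp: m1_def)
    have "(\<Sum>m=i*b..<i*b+b. h' m) = (\<Sum>m=i*b..<m1. h m)"
      by (rule sum.mono_neutral_cong_right) (auto simp: h'_def m1_def)
    also have "\<dots> \<le> 24 * real b * real l * KK ^ 3 * X2 + 2 * real b * real l * (\<Sum>v\<in>V. \<Sum>j=i*b..<m1. drift v j)"
      unfolding h_def by (rule sieve_block[OF m1])
    also have "(\<Sum>v\<in>V. \<Sum>j=i*b..<m1. drift v j) = (\<Sum>j=i*b..<m1. \<Sum>v\<in>V. drift v j)" by (rule sum.swap)
    also have "\<dots> = (\<Sum>j=i*b..<i*b+b. k' j)"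
      by (rule sum.mono_neutral_cong_left) (auto simp: k'_def m1_def)
    finally show ?thesis .
  next
    case False
    then have "h' m = 0" if "m \<in> {i*b..<i*b+b}" for m using that by (auto simp: h'_def)
    moreover have "0 \<le> k' j" for j by (auto simp: k'_def intro!: sum_nonneg drift_nonneg)
    ultimately show ?thesis using KK1 X2_pos by (simp add: sum_nonneg)
  qed
  have ext: "(\<Sum>m<k*b. h' m) = (\<Sum>m<L. h m)" "(\<Sum>m<k*b. k' m) = (\<Sum>m<L. \<Sum>v\<in>V. drift v m)"
    using kb by (auto intro!: sum.mono_neutral_cong_right simp: h'_def k'_def split: if_splits)
  have "(\<Sum>m<L. h m) = (\<Sum>i<k. \<Sum>m=i*b..<i*b+b. h' m)"
    unfolding ext(1)[symmetric] by (rule sum.nat_group[symmetric])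
  also have "\<dots> \<le> (\<Sum>i<k. 24 * real b * real l * KK ^ 3 * X2 + 2 * real b * real l * (\<Sum>j=i*b..<i*b+b. k' j))"
    by (intro sum_mono blk)
  also have "\<dots> = (real k * real b) * (24 * real l * KK ^ 3 * X2) + 2 * real b * real l * (\<Sum>i<k. \<Sum>j=i*b..<i*b+b. k' j)"
    by (simp add: sum.distrib sum_distrib_left mult_ac)
  also have "(\<Sum>i<k. \<Sum>j=i*b..<i*b+b. k' j) = (\<Sum>m<L. \<Sum>v\<in>V. drift v m)"
    unfolding ext(2)[symmetric] by (rule sum.nat_group)
  also have "\<dots> = (\<Sum>v\<in>V. \<Sum>m<L. drift v m)" by (rule sum.swap)
  also have "2 * real b * real l * (\<Sum>v\<in>V. \<Sum>m<L. drift v m) \<le> 2 * real b * real l * (\<Sum>v\<in>V. 2400 * KK ^ 3 * X2)"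
    by (intro mult_left_mono sum_mono sum_drift) auto
  also have "\<dots> = (real l * real b) * (4800 * real l * KK ^ 3 * X2)" by (simp add: cardV)
  also have "(real l * real b) * (4800 * real l * KK ^ 3 * X2) \<le> real L * (4800 * real l * KK ^ 3 * X2)"
    using c1 KK1 X2_pos by (intro mult_right_mono) (auto simp flip: of_nat_mult)
  also have "(real k * real b) * (24 * real l * KK ^ 3 * X2) \<le> (2 * real L) * (24 * real l * KK ^ 3 * X2)"
    using kb2 KK1 X2_pos by (intro mult_right_mono) auto
  finally have "(\<Sum>m<L. h m) \<le> 4848 * (KK ^ 3 * real l * real L * X2)" by (simp add: algebra_simps)
  also have "\<dots> \<le> 5000 * (KK ^ 3 * real l * real L * X2)" using KK1 X2_pos by (intro mult_right_mono) auto
  finally show ?thesis by (simp add: h_def mult_ac)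
qed

section \<open>The second-order coefficient summed over a group\<close>

text \<open>The part of the increment that carries the marker \<open>s\<close>; a line has at most one such level.\<close>

definition marked :: "nat \<Rightarrow> nat \<Rightarrow> 'x \<Rightarrow> complex" where
  "marked m v x = (if Suc (m + v + w) = L then qq w s v m x else 0)"

lemma qq_decomp:
  "qq w s v m x = of_real rho * Cc w s v0 m x * of_real (entry m v x)
     + of_real (rho * entry m v x) * (Cc w s v m x - Cc w s v0 m x) + marked m v x"
  by (auto simp: qq_def marked_def entry_def wt_def algebra_simps)

text \<open>The function \<open>Cc\<close> at the beginning of the group is bounded and common to all \<open>v\<close>, so it comes out of the sum over \<open>v\<close> and leaves the
  sum treated by the sieve.  The change of \<open>Cc\<close> within the group and the marked terms are small enough for the triangle inequality.\<close>

lemma nrm_sum_qq_E1: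
  "(\<Sum>m<L. rm.nrm m (\<lambda>x. \<Sum>v\<in>V. qq w s v m x * E v 1 m x)) \<le> 10^9 * KK ^ 3 * (G ^ 4 * real l / (real L)\<^sup>2)"
proof -
  define y where "y = G ^ 4 * real l / (real L)\<^sup>2"
  have y0: "0 \<le> y" using G1 by (simp add: y_def)
  have Lp: "0 < real L" using L0 by simp
  have l1: "1 \<le> real l" using l0 by simp
  define N1 where "N1 = (\<lambda>m. rm.nrm m (\<lambda>x. \<Sum>v\<in>V. of_real (entry m v x) * E v 1 m x))"
  define N2 where "N2 = (\<lambda>m. rm.nrm m (\<lambda>x. \<Sum>v\<in>V. of_real (rho * entry m v x) * (Cc w s v m x - Cc w s v0 m x) * E v 1 m x))"
  define N3 where "N3 = (\<lambda>m. rm.nrm m (\<lambda>x. \<Sum>v\<in>V. marked m v x * E v 1 m x))"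
  have split: "rm.nrm m (\<lambda>x. \<Sum>v\<in>V. qq w s v m x * E v 1 m x) \<le> 32 * rho\<^sup>2 * N1 m + 4 * N2 m + 4 * N3 m"
    if m: "m < L" for m
  proof -
    have pos: "\<And>x. x \<in> A \<Longrightarrow> 0 < rm.psi m x" using rm.psi_pos[of m] m by simp
    define B where "B = (\<lambda>x. (\<Sum>v\<in>V. of_real (rho * entry m v x) * (Cc w s v m x - Cc w s v0 m x) * E v 1 m x) + (\<Sum>v\<in>V. marked m v x * E v 1 m x))"
    have "rm.nrm m (\<lambda>x. \<Sum>v\<in>V. qq w s v m x * E v 1 m x)
      = rm.nrm m (\<lambda>x. (of_real rho * Cc w s v0 m x) * (\<Sum>v\<in>V. of_real (entry m v x) * E v 1 m x) + B x)"
      unfolding B_def sum_distrib_left sum.distrib[symmetric]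
      by (intro wnorm_cong sum.cong refl) (subst qq_decomp, simp add: algebra_simps)
    also have "\<dots> \<le> 2 * rm.nrm m (\<lambda>x. (of_real rho * Cc w s v0 m x) * (\<Sum>v\<in>V. of_real (entry m v x) * E v 1 m x)) + 2 * rm.nrm m B"
      by (intro wnorm_add_le pos)
    also have "rm.nrm m (\<lambda>x. (of_real rho * Cc w s v0 m x) * (\<Sum>v\<in>V. of_real (entry m v x) * E v 1 m x)) \<le> (4 * rho)\<^sup>2 * N1 m"
      unfolding N1_def
    proof (intro wnorm_mult_le pos)
      fix x assume x: "x \<in> A"
      show "cmod (of_real rho * Cc w s v0 m x) \<le> 4 * rho"
        using Cc_le[OF x tau_s, of w v0 m] rho_pos by (simp add: norm_mult mult.commute)
    qed
    also have "rm.nrm m B \<le> 2 * N2 m + 2 * N3 m"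
      unfolding B_def N2_def N3_def by (intro wnorm_add_le pos)
    finally show ?thesis by (simp add: power_mult_distrib)
  qed
  have S1: "(\<Sum>m<L. 32 * rho\<^sup>2 * N1 m) \<le> 5120000 * KK ^ 3 * y"
  proof -
    have "(\<Sum>m<L. 32 * rho\<^sup>2 * N1 m) = 32 * rho\<^sup>2 * (\<Sum>m<L. N1 m)" by (simp add: sum_distrib_left)
    also have "\<dots> \<le> 32 * rho\<^sup>2 * (5000 * KK ^ 3 * real l * real L * X2)"
      unfolding N1_def by (intro mult_left_mono sieve_total) auto
    also have "\<dots> = 5120000 * KK ^ 3 * y"
      using Lp by (simp add: rho_def X2_def y_def power_divide power2_eq_square power4_eq_xxxx field_simps)
    finally show ?thesis .
  qed
  have S2: "(\<Sum>m<L. 4 * N2 m) \<le> 32768 * KK ^ 3 * y"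
  proof -
    have one: "N2 m \<le> real l * (real l * ((rho * (4 * tau * wt_bound m))\<^sup>2 * (4 * KK ^ 3 * X2)))" if m: "m < L" for m
    proof -
      have pos: "\<And>x. x \<in> A \<Longrightarrow> 0 < rm.psi m x" using rm.psi_pos[of m] m by simp
      have "N2 m \<le> real (card V) * (\<Sum>v\<in>V. rm.nrm m (\<lambda>x. of_real (rho * entry m v x) * (Cc w s v m x - Cc w s v0 m x) * E v 1 m x))"
        unfolding N2_def by (intro wnorm_sum_le pos finV)
      also have "\<dots> \<le> real (card V) * (\<Sum>v\<in>V. (rho * (4 * tau * wt_bound m))\<^sup>2 * (4 * KK ^ 3 * X2))"
      proof (intro mult_left_mono sum_mono)
        fix v assume v: "v \<in> V"
        have "rm.nrm m (\<lambda>x. of_real (rho * entry m v x) * (Cc w s v m x - Cc w s v0 m x) * E v 1 m x)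
          \<le> (rho * (4 * tau * wt_bound m))\<^sup>2 * rm.nrm m (E v 1 m)"
        proof (intro wnorm_mult_le pos)
          fix x assume x: "x \<in> A"
          have "cmod (of_real (rho * entry m v x) * (Cc w s v m x - Cc w s v0 m x)) = rho * (\<bar>entry m v x\<bar> * cmod (Cc w s v m x - Cc w s v0 m x))"
            using rho_pos by (simp add: norm_mult abs_mult)
          also have "\<dots> \<le> rho * (1 * (4 * tau * wt_bound m))"
            using FF_diff(2)[OF x, of v m] inV[OF v] entry_le[OF x, of m v] rho_pos
            by (intro mult_left_mono mult_mono) auto
          finally show "cmod (of_real (rho * entry m v x) * (Cc w s v m x - Cc w s v0 m x)) \<le> rho * (4 * tau * wt_bound m)" by simp
        qed
        also have "\<dots> \<le> (rho * (4 * tau * wt_bound m))\<^sup>2 * (4 * KK ^ 3 * X2)"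
          using nrm_E1[OF v, of m] m by (intro mult_left_mono) auto
        finally show "rm.nrm m (\<lambda>x. of_real (rho * entry m v x) * (Cc w s v m x - Cc w s v0 m x) * E v 1 m x)
          \<le> (rho * (4 * tau * wt_bound m))\<^sup>2 * (4 * KK ^ 3 * X2)" .
      qed auto
      finally show ?thesis by (simp add: cardV)
    qed
    have "(\<Sum>m<L. 4 * N2 m) \<le> (\<Sum>m<L. 4 * (real l * (real l * ((rho * (4 * tau * wt_bound m))\<^sup>2 * (4 * KK ^ 3 * X2)))))"
      using one by (intro sum_mono mult_left_mono) auto
    also have "\<dots> = 256 * (real l)\<^sup>2 * tau\<^sup>2 * (KK ^ 3 * X2) * (rho\<^sup>2 * (\<Sum>m<L. (wt_bound m)\<^sup>2))"
      by (simp add: sum_distrib_left power_mult_distrib power2_eq_square mult_ac)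
    also have "\<dots> \<le> 256 * (real l)\<^sup>2 * tau\<^sup>2 * (KK ^ 3 * X2) * (4 * G\<^sup>2 * (real l)\<^sup>2 / real L)"
      using KK1 X2_pos by (intro mult_left_mono wt_bound_rho_sq) auto
    also have "\<dots> = 32768 * KK ^ 3 * y * (real l ^ 3 / real L)"
      unfolding tau_sq using Lp by (simp add: X2_def y_def power2_eq_square power3_eq_cube power4_eq_xxxx field_simps)
    also have "\<dots> \<le> 32768 * KK ^ 3 * y * 1"
    proof (intro mult_left_mono)
      have "1 * real l ^ 3 \<le> G\<^sup>2 * real l ^ 3" using G1 by (intro mult_right_mono) auto
      then have "real l ^ 3 \<le> real L" using c3 by linarith
      then show "real l ^ 3 / real L \<le> 1" using Lp by (simp only: divide_le_eq_1_pos)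
    qed (use KK1 y0 in auto)
    finally show ?thesis by simp
  qed
  have S3: "(\<Sum>m<L. 4 * N3 m) \<le> 8192 * KK ^ 3 * y"
  proof -
    have one: "N3 m \<le> (\<Sum>v\<in>V. of_bool (Suc (m + v + w) = L) * (16 * (1 / real L) * (4 * KK ^ 3 * X2)))" if m: "m < L" for m
    proof -
      have pos: "\<And>x. x \<in> A \<Longrightarrow> 0 < rm.psi m x" using rm.psi_pos[of m] m by simp
      define V' where "V' = {v \<in> V. Suc (m + v + w) = L}"
      have fV': "finite V'" using finV by (simp add: V'_def)
      have cV': "card V' \<le> 1"
      proof -
        have "card V' \<le> card {L - Suc (m + w)}" unfolding V'_def by (intro card_mono) auto
        then show ?thesis by simp
      qed
      have "N3 m = rm.nrm m (\<lambda>x. \<Sum>v\<in>V'. marked m v x * E v 1 m x)"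
        unfolding N3_def V'_def by (intro wnorm_cong sum.mono_neutral_right finV) (auto simp: marked_def)
      also have "\<dots> \<le> real (card V') * (\<Sum>v\<in>V'. rm.nrm m (\<lambda>x. marked m v x * E v 1 m x))"
        by (intro wnorm_sum_le pos fV')
      also have "\<dots> \<le> 1 * (\<Sum>v\<in>V'. 16 * (1 / real L) * (4 * KK ^ 3 * X2))"
      proof (intro mult_mono sum_mono)
        show "0 \<le> (\<Sum>v\<in>V'. rm.nrm m (\<lambda>x. marked m v x * E v 1 m x))" using m by (intro sum_nonneg rm.nrm_nonneg) auto
        fix v assume v: "v \<in> V'"
        then have vV: "v \<in> V" and ve: "Suc (m + v + w) = L" by (auto simp: V'_def)
        have "rm.nrm m (\<lambda>x. marked m v x * E v 1 m x) \<le> (4 * (1 / sqrt (real L)))\<^sup>2 * rm.nrm m (E v 1 m)"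
        proof (intro wnorm_mult_le pos)
          fix x assume x: "x \<in> A"
          have "cmod (marked m v x) \<le> 4 * rho * cmod (wt L w s m v)" using qq_le[OF x tau_s] ve by (simp add: marked_def)
          also have "\<dots> = 4 * (rho * cmod s)" using ve by (auto simp: wt_def)
          also have "\<dots> \<le> 4 * (1 / sqrt (real L))" using rho_s by linarith
          finally show "cmod (marked m v x) \<le> 4 * (1 / sqrt (real L))" .
        qed
        also have "\<dots> \<le> (4 * (1 / sqrt (real L)))\<^sup>2 * (4 * KK ^ 3 * X2)"
          using nrm_E1[OF vV, of m] m by (intro mult_left_mono) auto
        finally show "rm.nrm m (\<lambda>x. marked m v x * E v 1 m x) \<le> 16 * (1 / real L) * (4 * KK ^ 3 * X2)"
          by (simp add: power_divide power_mult_distrib)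
      qed (use cV' in auto)
      also have "\<dots> = (\<Sum>v\<in>V. of_bool (Suc (m + v + w) = L) * (16 * (1 / real L) * (4 * KK ^ 3 * X2)))"
        unfolding V'_def mult_1 by (rule sum.mono_neutral_cong_left) (auto simp: finV)
      finally show ?thesis .
    qed
    have "(\<Sum>m<L. 4 * N3 m) \<le> (\<Sum>m<L. 4 * (\<Sum>v\<in>V. of_bool (Suc (m + v + w) = L) * (16 * (1 / real L) * (4 * KK ^ 3 * X2))))"
      using one by (intro sum_mono mult_left_mono) auto
    also have "\<dots> = 256 * KK ^ 3 * X2 / real L * (\<Sum>v\<in>V. \<Sum>m<L. of_bool (Suc (m + v + w) = L))"
      unfolding sum_distrib_left by (subst sum.swap) (intro sum.cong refl, simp)
    also have "\<dots> \<le> 256 * KK ^ 3 * X2 / real L * (\<Sum>v\<in>V. 1)"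
      using KK1 X2_pos by (intro mult_left_mono sum_mono sum_level_le) auto
    also have "\<dots> = 8192 * KK ^ 3 * (G\<^sup>2 * real l / (real L)\<^sup>2)"
      by (simp add: cardV X2_def power2_eq_square)
    also have "\<dots> \<le> 8192 * KK ^ 3 * y"
      unfolding y_def
    proof (intro mult_left_mono divide_right_mono mult_right_mono)
      show "G\<^sup>2 \<le> G ^ 4" using G1 by (intro power_increasing) auto
    qed (use KK1 in auto)
    finally show ?thesis .
  qed
  have "(\<Sum>m<L. rm.nrm m (\<lambda>x. \<Sum>v\<in>V. qq w s v m x * E v 1 m x)) \<le> (\<Sum>m<L. 32 * rho\<^sup>2 * N1 m + 4 * N2 m + 4 * N3 m)"
    using split by (intro sum_mono) auto
  also have "\<dots> \<le> 5120000 * KK ^ 3 * y + 32768 * KK ^ 3 * y + 8192 * KK ^ 3 * y"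
    unfolding sum.distrib by (intro add_mono S1 S2 S3)
  also have "\<dots> \<le> 10^9 * KK ^ 3 * y"
  proof -
    have "0 \<le> y * KK ^ 3" using KK1 y0 by simp
    then show ?thesis by simp
  qed
  finally show ?thesis by (simp add: y_def)
qed

lemma nrm_E2: "v \<in> V \<Longrightarrow> m \<le> L \<Longrightarrow> rm.nrm m (E v 2 m) \<le> 16 * KK ^ 4 * X2\<^sup>2"
  using nrm_E[of v m 2] inV[of v] by (simp add: power_mult_distrib power4_eq_xxxx power2_eq_square mult_ac)

text \<open>All members of the group are propagated with the common factor \<open>FF w s v0\<close>; the difference to their own factors is a further odd
  increment.  The factor \<open>l\<close> in place of \<open>l\<^sup>2\<close> is the gain from the sieve.\<close>

lemma nrm_sum_E2:
  "rm.nrm L (\<lambda>x. \<Sum>v\<in>V. E v 2 L x) \<le> 10^11 * KK ^ 5 * (G ^ 4 * real l / (real L)\<^sup>2)"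
proof -
  define y where "y = G ^ 4 * real l / (real L)\<^sup>2"
  have y0: "0 \<le> y" using G1 by (simp add: y_def)
  have Lp: "0 < real L" using L0 by simp
  define Y1 where "Y1 = (\<lambda>m x. \<Sum>v\<in>V. (FF w s v m x - FF w s v0 m x) * E v 2 m x)"
  define Y2 where "Y2 = (\<lambda>m x. \<Sum>v\<in>V. qq w s v m x * E v 1 m x)"
  have vV: "v0 \<in> V" using l0 by (simp add: V_def)
  have ch: "chain A fl1 L p (FF w s v) (qq w s v) (\<lambda>_. 12 / sqrt (real L)) (\<lambda>a. 4 * rho * cmod (wt L w s a v)) 144 X2"
    if "v \<in> V" for v using chain_v inV[OF that] by blast
  have "rm.nrm L (\<lambda>x. \<Sum>v\<in>V. E v 2 L x) \<le> exp (4 * (\<Sum>m<L. (12 / sqrt (real L))\<^sup>2)) * (rm.nrm 0 (\<lambda>x. \<Sum>v\<in>V. E v 2 0 x) + 4 * (\<Sum>m<L. rm.nrm m (\<lambda>x. Y1 m x + Y2 m x)))"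
  proof (rule rm.growth[where X = "\<lambda>m x. \<Sum>v\<in>V. E v 2 m x" and D = "\<lambda>m x. FF w s v0 m x - of_real (p m x)"])
    fix m x assume m: "m < L" "x \<in> A"
    show "(\<Sum>v\<in>V. E v 2 (Suc m) x) = (of_real (p m x) + (FF w s v0 m x - of_real (p m x))) * (\<Sum>v\<in>V. E v 2 m x) + (Y1 m x + Y2 m x)"
      unfolding Y1_def Y2_def sum_distrib_left sum.distrib[symmetric]
      by (intro sum.cong refl) (simp add: algebra_simps)
  next
    fix m assume "m \<le> L"
    then show "x1.inv_from m (\<lambda>x. \<Sum>v\<in>V. E v 2 m x)" using inV by (intro x1.inv_from_sum E_inv) auto
  next
    fix m assume m: "m < L"
    show "x1.odd_at m (\<lambda>x. FF w s v0 m x - of_real (p m x))" by (rule chain.F_odd[OF ch[OF vV] m])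
    have "x1.odd_at m (\<lambda>x. (FF w s v m x - FF w s v0 m x) * E v 2 m x)" if v: "v \<in> V" for v
    proof (rule x1.odd_at_mult_inv)
      show "x1.odd_at m (\<lambda>x. FF w s v m x - FF w s v0 m x)"
        using x1.odd_at_diff[OF chain.F_odd[OF ch[OF v] m] chain.F_odd[OF ch[OF vV] m]] by simp
    qed (use m inV[OF v] in \<open>auto intro: E_inv\<close>)
    moreover have "x1.odd_at m (\<lambda>x. qq w s v m x * E v 1 m x)" if v: "v \<in> V" for v
      using m inV[OF v] by (intro x1.odd_at_mult_inv qq_odd1 E_inv) auto
    ultimately show "x1.odd_at m (\<lambda>x. Y1 m x + Y2 m x)"
      unfolding Y1_def Y2_def by (intro x1.odd_at_add x1.odd_at_sum)
  qed (use FF_p[of _ v0] in auto)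
  also have "rm.nrm 0 (\<lambda>x. \<Sum>v\<in>V. E v 2 0 x) = 0" by (simp add: wnorm_def avg_def)
  also have "exp (4 * (\<Sum>m<L. (12 / sqrt (real L))\<^sup>2)) = exp 576" using Lp by (simp add: power_divide)
  also have "(\<Sum>m<L. rm.nrm m (\<lambda>x. Y1 m x + Y2 m x)) \<le> (\<Sum>m<L. 2 * rm.nrm m (Y1 m) + 2 * rm.nrm m (Y2 m))"
    by (intro sum_mono wnorm_add_le rm.psi_pos) auto
  also have "\<dots> = 2 * (\<Sum>m<L. rm.nrm m (Y1 m)) + 2 * (\<Sum>m<L. rm.nrm m (Y2 m))"
    by (simp add: sum.distrib sum_distrib_left)
  also have "(\<Sum>m<L. rm.nrm m (Y2 m)) \<le> 10^9 * KK ^ 3 * y" unfolding Y2_def y_def by (rule nrm_sum_qq_E1)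
  also have "10^9 * KK ^ 3 * y \<le> 10^9 * KK ^ 4 * y"
    using KK1 y0 by (intro mult_right_mono mult_left_mono power_increasing) auto
  also have "(\<Sum>m<L. rm.nrm m (Y1 m)) \<le> 10^9 * KK ^ 4 * y"
  proof -
    have one: "rm.nrm m (Y1 m) \<le> real l * (real l * ((4 * rho * wt_bound m)\<^sup>2 * (16 * KK ^ 4 * X2\<^sup>2)))" if m: "m < L" for m
    proof -
      have pos: "\<And>x. x \<in> A \<Longrightarrow> 0 < rm.psi m x" using rm.psi_pos[of m] m by simp
      have "rm.nrm m (Y1 m) \<le> real (card V) * (\<Sum>v\<in>V. rm.nrm m (\<lambda>x. (FF w s v m x - FF w s v0 m x) * E v 2 m x))"
        unfolding Y1_def by (intro wnorm_sum_le pos finV)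
      also have "\<dots> \<le> real (card V) * (\<Sum>v\<in>V. (4 * rho * wt_bound m)\<^sup>2 * (16 * KK ^ 4 * X2\<^sup>2))"
      proof (intro mult_left_mono sum_mono)
        fix v assume v: "v \<in> V"
        have "rm.nrm m (\<lambda>x. (FF w s v m x - FF w s v0 m x) * E v 2 m x) \<le> (4 * rho * wt_bound m)\<^sup>2 * rm.nrm m (E v 2 m)"
          using FF_diff(1) inV[OF v] by (intro wnorm_mult_le pos) auto
        also have "\<dots> \<le> (4 * rho * wt_bound m)\<^sup>2 * (16 * KK ^ 4 * X2\<^sup>2)"
          using nrm_E2[OF v, of m] m by (intro mult_left_mono) auto
        finally show "rm.nrm m (\<lambda>x. (FF w s v m x - FF w s v0 m x) * E v 2 m x) \<le> (4 * rho * wt_bound m)\<^sup>2 * (16 * KK ^ 4 * X2\<^sup>2)" .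
      qed auto
      finally show ?thesis by (simp add: cardV)
    qed
    have "(\<Sum>m<L. rm.nrm m (Y1 m)) \<le> (\<Sum>m<L. real l * (real l * ((4 * rho * wt_bound m)\<^sup>2 * (16 * KK ^ 4 * X2\<^sup>2))))"
      using one by (intro sum_mono) auto
    also have "\<dots> = 256 * (real l)\<^sup>2 * (KK ^ 4 * X2\<^sup>2) * (rho\<^sup>2 * (\<Sum>m<L. (wt_bound m)\<^sup>2))"
      by (simp add: sum_distrib_left power_mult_distrib power2_eq_square mult_ac)
    also have "\<dots> \<le> 256 * (real l)\<^sup>2 * (KK ^ 4 * X2\<^sup>2) * (4 * G\<^sup>2 * (real l)\<^sup>2 / real L)"
      using KK1 X2_pos by (intro mult_left_mono wt_bound_rho_sq) auto
    also have "\<dots> = 1048576 * KK ^ 4 * y * (G\<^sup>2 * real l ^ 3 / real L)"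
      using Lp by (simp add: X2_def y_def power2_eq_square power3_eq_cube power4_eq_xxxx field_simps)
    also have "\<dots> \<le> 1048576 * KK ^ 4 * y * 1"
      using c3 Lp KK1 y0 by (intro mult_left_mono) auto
    also have "\<dots> \<le> 10^9 * KK ^ 4 * y"
      using KK1 y0 by (simp add: mult_right_mono)
    finally show ?thesis .
  qed
  finally have "rm.nrm L (\<lambda>x. \<Sum>v\<in>V. E v 2 L x) \<le> exp 576 * (16 * 10^9 * KK ^ 4 * y)" by (simp add: mult_ac)
  also have "\<dots> \<le> KK * (16 * 10^9 * KK ^ 4 * y)"
    using y0 KK1 by (intro mult_right_mono) (auto simp: KK_def)
  also have "\<dots> = 16 * 10^9 * (KK ^ 5 * y)" by (simp add: eval_nat_numeral)
  also have "\<dots> \<le> 10^11 * (KK ^ 5 * y)" using y0 KK1 by (intro mult_right_mono) auto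
  finally show ?thesis by (simp add: y_def)
qed

lemma avg_group:
  "avg A (\<lambda>x. cmod (\<Sum>v\<in>V. (zprod (FF w s v) (qq w s v) 1 L x + zprod (FF w s v) (qq w s v) (-1) L x) / 2 - zprod (FF w s v) (qq w s v) 0 L x))
   \<le> 10^5 * KK ^ 3 * real l * (G ^ 4 / (real L)\<^sup>2) + 10^6 * KK ^ 3 * (G\<^sup>2 * sqrt (real l) / real L)"
proof -
  define R where "R = (\<lambda>v x. (zprod (FF w s v) (qq w s v) 1 L x + zprod (FF w s v) (qq w s v) (-1) L x) / 2 - E v 0 L x - E v 2 L x)"
  have "avg A (\<lambda>x. cmod (\<Sum>v\<in>V. (zprod (FF w s v) (qq w s v) 1 L x + zprod (FF w s v) (qq w s v) (-1) L x) / 2 - zprod (FF w s v) (qq w s v) 0 L x))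
    = avg A (\<lambda>x. cmod ((\<Sum>v\<in>V. R v x) + (\<Sum>v\<in>V. E v 2 L x)))"
    unfolding R_def sum.distrib[symmetric] by (intro avg_cong arg_cong[where f = cmod] sum.cong refl) (simp add: zcoeff_0)
  also have "\<dots> \<le> avg A (\<lambda>x. (\<Sum>v\<in>V. cmod (R v x)) + cmod (\<Sum>v\<in>V. E v 2 L x))"
    by (intro avg_mono order_trans[OF norm_triangle_ineq] add_right_mono norm_sum)
  also have "\<dots> = (\<Sum>v\<in>V. avg A (\<lambda>x. cmod (R v x))) + avg A (\<lambda>x. cmod (\<Sum>v\<in>V. E v 2 L x))"
    by (simp only: avg_add avg_sum)
  also have "\<dots> \<le> (\<Sum>v\<in>V. 16 * KK ^ 3 * X2\<^sup>2) + sqrt (10^11 * KK ^ 5 * (G ^ 4 * real l / (real L)\<^sup>2))"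
  proof (intro add_mono sum_mono)
    fix v assume "v \<in> V"
    then show "avg A (\<lambda>x. cmod (R v x)) \<le> 16 * KK ^ 3 * X2\<^sup>2" unfolding R_def using inV by (intro avg_remainder) auto
  next
    show "avg A (\<lambda>x. cmod (\<Sum>v\<in>V. E v 2 L x)) \<le> sqrt (10^11 * KK ^ 5 * (G ^ 4 * real l / (real L)\<^sup>2))"
      by (intro order_trans[OF rm.avg_le_wnorm[of L] real_sqrt_le_mono] nrm_sum_E2) auto
  qed
  also have "(\<Sum>v\<in>V. 16 * KK ^ 3 * X2\<^sup>2) = 16384 * (KK ^ 3 * real l * (G ^ 4 / (real L)\<^sup>2))"
    by (simp add: cardV X2_def power_mult_distrib power_divide)
  also have "\<dots> \<le> 10^5 * (KK ^ 3 * real l * (G ^ 4 / (real L)\<^sup>2))"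
    using KK1 by (intro mult_right_mono) auto
  also have "sqrt (10^11 * KK ^ 5 * (G ^ 4 * real l / (real L)\<^sup>2)) \<le> sqrt (10^12 * KK ^ 6 * (G ^ 4 * real l / (real L)\<^sup>2))"
    using KK1 G1 by (intro real_sqrt_le_mono mult_right_mono mult_mono power_increasing) auto
  also have "10^12 * KK ^ 6 * (G ^ 4 * real l / (real L)\<^sup>2) = (10^6 * KK ^ 3 * (G\<^sup>2 * sqrt (real l) / real L))\<^sup>2"
    by (simp add: power_mult_distrib power_divide)
  also have "sqrt \<dots> = 10^6 * KK ^ 3 * (G\<^sup>2 * sqrt (real l) / real L)" using KK1 G1 by simp
  finally show ?thesis by (simp add: mult_ac)
qed

end

section \<open>Even parts and their dependence on the marker\<close>

text \<open>The left-hand side is the sum of the coefficients of even order at least two.  Averages over the roots of unity on the circle of radius \<open>r\<close>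
  pick out the coefficient of order \<open>k\<close> with weight \<open>r ^ - k\<close>, and these weights sum to at most \<open>2 / r\<^sup>2\<close>.\<close>

lemma even_quadrature:
  fixes r :: real and N :: nat
  assumes r: "0 < r" "2 \<le> r\<^sup>2"
  shows "\<exists>\<kappa> \<zeta> :: nat \<Rightarrow> complex. (\<forall>j<Suc N. cmod (\<zeta> j) = r) \<and> (\<Sum>j<Suc N. cmod (\<kappa> j)) \<le> 2 / r\<^sup>2
    \<and> (\<forall>p :: complex poly. degree p \<le> N \<longrightarrow> (poly p 1 + poly p (-1)) / 2 - poly p 0 = (\<Sum>j<Suc N. \<kappa> j * poly p (\<zeta> j)))"
proof -
  define M where "M = Suc N"
  have M0: "M \<noteq> 0" "1 \<le> M" by (simp_all add: M_def)
  define e :: "nat \<Rightarrow> complex" where "e = (\<lambda>i. exp (2 * of_real pi * \<i> * of_nat i / of_nat M))"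
  have e_norm: "cmod (e i) = 1" for i
  proof -
    have "e i = exp (\<i> * of_real (2 * pi * real i / real M))" by (simp add: e_def mult_ac)
    then show ?thesis by simp
  qed
  have e0: "e i \<noteq> 0" for i by (simp add: e_def)
  have e_pow: "e j ^ i = e i ^ j" for i j
    by (simp add: e_def exp_of_nat_mult[symmetric] mult_ac)
  have orth: "(\<Sum>j<M. (e i / e k) ^ j) = (if i = k then of_nat M else 0)" if "i < M" "k < M" for i k
  proof (cases "i = k")
    case False
    have ne: "e i / e k \<noteq> 1" using complex_root_unity_eq[OF M0(2), of i k] that False e0 by (simp add: e_def)
    have "(e i / e k) ^ M = 1" using complex_root_unity[OF M0(1)] by (simp add: power_divide e_def)
    then show ?thesis using False geometric_sum[OF ne, of M] by simp
  qed (simp add: e0)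
  define S where "S = {k. k \<le> N \<and> even k \<and> 2 \<le> k}"
  have finS: "finite S" by (simp add: S_def)
  define \<zeta> where "\<zeta> = (\<lambda>j. of_real r * e j)"
  define \<kappa> where "\<kappa> = (\<lambda>j. (1 / of_nat M) * (\<Sum>k\<in>S. 1 / \<zeta> j ^ k))"
  have z_norm: "cmod (\<zeta> j) = r" for j using r by (simp add: \<zeta>_def norm_mult e_norm)
  have sumS: "(\<Sum>k\<in>S. 1 / r ^ k) \<le> 2 / r\<^sup>2"
  proof -
    have geo: "(\<Sum>i<n. (1/2) ^ i) \<le> (2::real)" for n :: nat
      by (subst geometric_sum) auto
    have "(\<Sum>k\<in>S. 1 / r ^ k) \<le> (\<Sum>k\<in>(\<lambda>i. 2 * i + 2) ` {..<N}. 1 / r ^ k)"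
    proof (intro sum_mono2)
      show "S \<subseteq> (\<lambda>i. 2 * i + 2) ` {..<N}"
      proof
        fix k assume "k \<in> S"
        then have "k = 2 * ((k - 2) div 2) + 2" "(k - 2) div 2 < N" by (auto simp: S_def)
        then show "k \<in> (\<lambda>i. 2 * i + 2) ` {..<N}" by blast
      qed
    qed (use r in auto)
    also have "\<dots> = (\<Sum>i<N. 1 / r ^ (2 * i + 2))" by (subst sum.reindex) (auto simp: inj_on_def)
    also have "\<dots> \<le> (\<Sum>i<N. 1 / r\<^sup>2 * (1/2) ^ i)"
    proof (rule sum_mono)
      fix i
      have "1 / r\<^sup>2 \<le> 1 / 2" using r by (intro divide_left_mono) auto
      then have "(1 / r\<^sup>2) ^ i \<le> (1/2) ^ i" by (intro power_mono) auto
      then have "1 / r\<^sup>2 * (1 / r\<^sup>2) ^ i \<le> 1 / r\<^sup>2 * (1/2) ^ i" by (intro mult_left_mono) auto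
      moreover have "1 / r ^ (2 * i + 2) = 1 / r\<^sup>2 * (1 / r\<^sup>2) ^ i"
        unfolding power_add power_mult by (simp add: power_one_over)
      ultimately show "1 / r ^ (2 * i + 2) \<le> 1 / r\<^sup>2 * (1/2) ^ i" by simp
    qed
    also have "\<dots> = 1 / r\<^sup>2 * (\<Sum>i<N. (1/2) ^ i)" by (rule sum_distrib_left[symmetric])
    also have "\<dots> \<le> 1 / r\<^sup>2 * 2" by (intro mult_left_mono geo) auto
    finally show ?thesis by simp
  qed
  have k_norm: "(\<Sum>j<M. cmod (\<kappa> j)) \<le> 2 / r\<^sup>2"
  proof -
    have "(\<Sum>j<M. cmod (\<kappa> j)) \<le> (\<Sum>j<M. 1 / real M * (\<Sum>k\<in>S. 1 / r ^ k))"
    proof (rule sum_mono)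
      fix j
      have "cmod (\<Sum>k\<in>S. 1 / \<zeta> j ^ k) \<le> (\<Sum>k\<in>S. cmod (1 / \<zeta> j ^ k))" by (rule norm_sum)
      also have "\<dots> = (\<Sum>k\<in>S. 1 / r ^ k)" by (simp add: norm_divide norm_power z_norm)
      finally show "cmod (\<kappa> j) \<le> 1 / real M * (\<Sum>k\<in>S. 1 / r ^ k)"
        by (simp add: \<kappa>_def norm_mult norm_divide divide_right_mono)
    qed
    also have "\<dots> = (\<Sum>k\<in>S. 1 / r ^ k)" using M0 by simp
    finally show ?thesis using sumS by simp
  qed
  have "(poly p 1 + poly p (-1)) / 2 - poly p 0 = (\<Sum>j<M. \<kappa> j * poly p (\<zeta> j))" if deg: "degree p \<le> N" for p :: "complex poly"
  proof -
    have pa: "poly p s = (\<Sum>i\<le>N. coeff p i * s ^ i)" for s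
      unfolding poly_altdef by (rule sum.mono_neutral_left) (use deg in \<open>auto simp: coeff_eq_0\<close>)
    have "(poly p 1 + poly p (-1)) / 2 - poly p 0 = (\<Sum>i\<le>N. coeff p i * ((1 + (-1) ^ i) / 2 - 0 ^ i))"
      unfolding pa sum.distrib[symmetric] sum_divide_distrib sum_subtractf[symmetric]
      by (intro sum.cong refl) (simp add: field_simps)
    also have "\<dots> = (\<Sum>i\<in>S. coeff p i)"
    proof (rule sum.mono_neutral_cong_right)
      show "\<forall>i\<in>{..N} - S. coeff p i * ((1 + (-1) ^ i) / 2 - 0 ^ i) = 0"
      proof
        fix i assume i: "i \<in> {..N} - S"
        then consider "i = 0" | "odd i" by (cases "i = 0"; cases "even i"; force simp: S_def elim!: evenE)
        then show "coeff p i * ((1 + (-1) ^ i) / 2 - 0 ^ i) = 0" by cases (auto elim: oddE)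
      qed
    qed (auto simp: S_def)
    also have "\<dots> = (\<Sum>i\<in>S. \<Sum>k\<le>N. (if i = k then coeff p k else 0))"
      by (intro sum.cong refl) (auto simp: S_def)
    also have "\<dots> = (\<Sum>k\<in>S. \<Sum>i\<le>N. coeff p i * of_real (r ^ i / r ^ k) * ((1 / of_nat M) * (\<Sum>j<M. (e i / e k) ^ j)))"
    proof (intro sum.cong refl)
      fix k i assume "k \<in> S" "i \<in> {..N}"
      then have "i < M" "k < M" by (auto simp: M_def S_def)
      then show "(if k = i then coeff p i else 0) = coeff p i * of_real (r ^ i / r ^ k) * ((1 / of_nat M) * (\<Sum>j<M. (e i / e k) ^ j))"
        using orth[of i k] M0 r by simp
    qed
    also have "\<dots> = (\<Sum>k\<in>S. \<Sum>i\<le>N. \<Sum>j<M. (1 / of_nat M) * (1 / \<zeta> j ^ k) * (coeff p i * \<zeta> j ^ i))"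
    proof (intro sum.cong refl)
      fix k i
      have "of_real (r ^ i / r ^ k) * (e i / e k) ^ j = \<zeta> j ^ i / \<zeta> j ^ k" for j
        by (simp add: \<zeta>_def power_mult_distrib power_divide e_pow[of j])
      then show "coeff p i * of_real (r ^ i / r ^ k) * ((1 / of_nat M) * (\<Sum>j<M. (e i / e k) ^ j))
         = (\<Sum>j<M. (1 / of_nat M) * (1 / \<zeta> j ^ k) * (coeff p i * \<zeta> j ^ i))"
        unfolding sum_distrib_left
      proof (intro sum.cong refl)
        fix j
        have "coeff p i * of_real (r ^ i / r ^ k) * (1 / of_nat M * (e i / e k) ^ j)
          = 1 / of_nat M * (coeff p i * (of_real (r ^ i / r ^ k) * (e i / e k) ^ j))"
          by (simp only: mult_ac)
        also have "\<dots> = 1 / of_nat M * (coeff p i * (\<zeta> j ^ i / \<zeta> j ^ k))"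
          by (simp only: \<open>\<And>j. of_real (r ^ i / r ^ k) * (e i / e k) ^ j = \<zeta> j ^ i / \<zeta> j ^ k\<close>)
        also have "\<dots> = 1 / of_nat M * (1 / \<zeta> j ^ k) * (coeff p i * \<zeta> j ^ i)" by simp
        finally show "coeff p i * of_real (r ^ i / r ^ k) * (1 / of_nat M * (e i / e k) ^ j)
          = 1 / of_nat M * (1 / \<zeta> j ^ k) * (coeff p i * \<zeta> j ^ i)" .
      qed
    qed
    also have "\<dots> = (\<Sum>k\<in>S. \<Sum>j<M. \<Sum>i\<le>N. (1 / of_nat M) * (1 / \<zeta> j ^ k) * (coeff p i * \<zeta> j ^ i))"
      by (intro sum.cong refl sum.swap)
    also have "\<dots> = (\<Sum>j<M. \<Sum>k\<in>S. \<Sum>i\<le>N. (1 / of_nat M) * (1 / \<zeta> j ^ k) * (coeff p i * \<zeta> j ^ i))"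
      by (rule sum.swap)
    also have "\<dots> = (\<Sum>j<M. \<kappa> j * poly p (\<zeta> j))"
    proof (intro sum.cong refl)
      fix j
      have "\<kappa> j * poly p (\<zeta> j) = 1 / of_nat M * ((\<Sum>k\<in>S. 1 / \<zeta> j ^ k) * (\<Sum>i\<le>N. coeff p i * \<zeta> j ^ i))"
        by (simp add: \<kappa>_def pa)
      also have "\<dots> = 1 / of_nat M * (\<Sum>k\<in>S. \<Sum>i\<le>N. (1 / \<zeta> j ^ k) * (coeff p i * \<zeta> j ^ i))"
        by (subst sum_product) (rule refl)
      finally show "(\<Sum>k\<in>S. \<Sum>i\<le>N. (1 / of_nat M) * (1 / \<zeta> j ^ k) * (coeff p i * \<zeta> j ^ i)) = \<kappa> j * poly p (\<zeta> j)"
        by (simp only: sum_distrib_left mult.assoc)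
    qed
    finally show ?thesis .
  qed
  then show ?thesis using z_norm k_norm unfolding M_def by blast
qed

definition polyf :: "nat \<Rightarrow> (complex \<Rightarrow> complex) \<Rightarrow> bool" where
  "polyf d g \<longleftrightarrow> (\<exists>p. degree p \<le> d \<and> (\<forall>s. g s = poly p s))"

lemma polyf_const: "polyf d (\<lambda>s. c)"
  unfolding polyf_def by (intro exI[of _ "[:c:]"]) simp

lemma polyf_id: "polyf 1 (\<lambda>s. s)"
  unfolding polyf_def by (intro exI[of _ "[:0, 1:]"]) simp

lemma polyf_mono: "polyf d g \<Longrightarrow> d \<le> d' \<Longrightarrow> polyf d' g"
  unfolding polyf_def using le_trans by blast

lemma polyf_add: "polyf d g \<Longrightarrow> polyf d h \<Longrightarrow> polyf d (\<lambda>s. g s + h s)"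
  unfolding polyf_def by (metis degree_add_le poly_add)

lemma polyf_diff: "polyf d g \<Longrightarrow> polyf d h \<Longrightarrow> polyf d (\<lambda>s. g s - h s)"
  unfolding polyf_def by (metis degree_diff_le poly_diff)

lemma polyf_mult: "polyf d g \<Longrightarrow> polyf d' h \<Longrightarrow> polyf (d + d') (\<lambda>s. g s * h s)"
  unfolding polyf_def by (metis (no_types, lifting) degree_mult_le poly_mult add_mono le_trans)

lemma polyf_cmult: "polyf d g \<Longrightarrow> polyf d (\<lambda>s. c * g s)"
  using polyf_mult[OF polyf_const[of 0 c], of d g] by simp

lemma polyf_prod: "finite I \<Longrightarrow> (\<And>i. i \<in> I \<Longrightarrow> polyf d (g i)) \<Longrightarrow> polyf (card I * d) (\<lambda>s. \<Prod>i\<in>I. g i s)"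
  by (induction I rule: finite_induct) (auto intro: polyf_const polyf_mult)

lemma polyf_sum: "(\<And>i. i \<in> I \<Longrightarrow> polyf d (g i)) \<Longrightarrow> polyf d (\<lambda>s. \<Sum>i\<in>I. g i s)"
  by (induction I rule: infinite_finite_induct) (auto intro: polyf_const polyf_add)

context lines begin

text \<open>The Riesz product restricted to second levels below \<open>v\<close> and third levels below \<open>w\<close>, with markers \<open>z\<close> on second
  level \<open>v\<close> and \<open>s\<close> on third level \<open>w\<close>.\<close>

definition Psi :: "nat \<Rightarrow> complex \<Rightarrow> complex \<Rightarrow> nat \<Rightarrow> 'x \<Rightarrow> complex" where
  "Psi w s z v x = zprod (FF w s v) (qq w s v) z L x"

text \<open>The terms of the product that contain second level \<open>v\<close> a positive even number of times.\<close>

definition even_part :: "nat \<Rightarrow> complex \<Rightarrow> nat \<Rightarrow> 'x \<Rightarrow> complex" where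
  "even_part w s v x = (Psi w s 1 v x + Psi w s (-1) v x) / 2 - Psi w s 0 v x"

definition even_sum :: "nat \<Rightarrow> complex \<Rightarrow> 'x \<Rightarrow> complex" where
  "even_sum w s x = (\<Sum>v<L. even_part w s v x)"

lemma even_part_big: "L \<le> v \<Longrightarrow> even_part w s v x = 0"
  by (simp add: even_part_def Psi_def zprod_def qq_def wt_def)

text \<open>There are about \<open>L / l\<close> groups, and each contributes at most a constant times \<open>G\<^sup>2 * sqrt l / L\<close>, up to a smaller term.  With \<open>l = G ^ 8\<close> the total is of
  order \<open>1 / G\<^sup>2\<close>.\<close>

lemma avg_even_sum_le:
  assumes s: "cmod s \<le> sqrt (real L) / G"
    and l: "real l = G ^ 8" and l0: "0 < l" and b0: "0 < b"
    and c0: "64 * G\<^sup>2 \<le> real L"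
    and c1: "l * b \<le> L"
    and c2: "real l ^ 3 * exp (30 * G * sqrt (real L) - real b / (4 * (real l)\<^sup>2)) \<le> 32 * G\<^sup>2 / real L"
    and c3: "G\<^sup>2 * real l ^ 3 \<le> real L"
  shows "avg A (\<lambda>x. cmod (even_sum w s x)) \<le> 10^7 * KK ^ 3 / G\<^sup>2"
proof -
  define B where "B = 10^5 * KK ^ 3 * real l * (G ^ 4 / (real L)\<^sup>2) + 10^6 * KK ^ 3 * (G\<^sup>2 * sqrt (real l) / real L)"
  have grp: "avg A (\<lambda>x. cmod (\<Sum>v=i*l..<i*l+l. even_part w s v x)) \<le> B" for i
  proof -
    interpret level_group A fl1 fl3 L f G w s "i * l" l b
      by unfold_locales (use assms in auto)
    show ?thesis using avg_group by (simp add: V_def B_def even_part_def Psi_def)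
  qed
  define k where "k = Suc (L div l)"
  have Lp: "0 < real L" using L0 by simp
  have kl: "L \<le> k * l" unfolding k_def using l0 by (metis div_mult_mod_eq mod_less_divisor add.commute add_le_cancel_left less_imp_le mult_Suc)
  have "l * 1 \<le> l * b" using b0 by (intro mult_left_mono) auto
  then have "l \<le> L" using c1 by linarith
  moreover have "L div l * l \<le> L" by simp
  ultimately have "l + L div l * l \<le> 2 * L" by linarith
  then have "k * l \<le> 2 * L" by (simp add: k_def)
  then have kl2: "real k * real l \<le> 2 * real L" by (metis of_nat_mono of_nat_mult of_nat_numeral)
  have "even_sum w s x = (\<Sum>i<k. \<Sum>v=i*l..<i*l+l. even_part w s v x)" for x
  proof -
    have "(\<Sum>i<k. \<Sum>v=i*l..<i*l+l. even_part w s v x) = (\<Sum>v<k*l. even_part w s v x)" by (rule sum.nat_group)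
    also have "\<dots> = (\<Sum>v<L. even_part w s v x)" using kl by (intro sum.mono_neutral_right) (auto simp: even_part_big)
    finally show ?thesis by (simp add: even_sum_def)
  qed
  then have "avg A (\<lambda>x. cmod (even_sum w s x)) \<le> avg A (\<lambda>x. \<Sum>i<k. cmod (\<Sum>v=i*l..<i*l+l. even_part w s v x))"
    by (intro avg_mono) (simp add: norm_sum)
  also have "\<dots> \<le> (\<Sum>i<k. B)" unfolding avg_sum by (intro sum_mono grp)
  also have "\<dots> = (real k * real l) * (10^5 * KK ^ 3 * (G ^ 4 / (real L)\<^sup>2) + 10^6 * KK ^ 3 * (G\<^sup>2 * sqrt (real l) / (real L * real l)))"
    using l0 by (simp add: B_def field_simps)
  also have "\<dots> \<le> (2 * real L) * (10^5 * KK ^ 3 * (G ^ 4 / (real L)\<^sup>2) + 10^6 * KK ^ 3 * (G\<^sup>2 * sqrt (real l) / (real L * real l)))"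
    using kl2 KK1 G1 by (intro mult_right_mono) auto
  also have "sqrt (real l) = G ^ 4"
    using G1 by (intro real_sqrt_unique) (simp_all add: l flip: power_mult)
  also have "(2 * real L) * (10^5 * KK ^ 3 * (G ^ 4 / (real L)\<^sup>2) + 10^6 * KK ^ 3 * (G\<^sup>2 * G ^ 4 / (real L * real l)))
     = 2 * 10^5 * KK ^ 3 * (G ^ 4 / real L) + 2 * 10^6 * KK ^ 3 * (1 / G\<^sup>2)"
    using Lp G1 by (simp add: l field_simps power2_eq_square eval_nat_numeral)
  also have "\<dots> \<le> 2 * 10^5 * KK ^ 3 * (1 / G\<^sup>2) + 2 * 10^6 * KK ^ 3 * (1 / G\<^sup>2)"
  proof (intro add_right_mono mult_left_mono)
    have "G ^ 4 * G\<^sup>2 \<le> G\<^sup>2 * real l ^ 3"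
    proof -
      have "G ^ 4 \<le> G ^ 24" using G1 by (intro power_increasing) auto
      then have "G\<^sup>2 * G ^ 4 \<le> G\<^sup>2 * G ^ 24" by (intro mult_left_mono) auto
      then show ?thesis by (simp add: l mult.commute flip: power_mult)
    qed
    then have "G ^ 4 * G\<^sup>2 \<le> real L" using c3 by linarith
    then show "G ^ 4 / real L \<le> 1 / G\<^sup>2" using Lp G1 by (simp add: divide_simps)
  qed (use KK1 in auto)
  also have "\<dots> \<le> 10^7 * KK ^ 3 / G\<^sup>2"
    using KK1 G1 by (simp add: divide_right_mono)
  finally show ?thesis .
qed

lemma polyf_even_sum: "polyf (L * (L + 1)) (\<lambda>s. even_sum w s x)"
proof -
  have wtp: "polyf 1 (\<lambda>s. wt L w s a u)" for a u
    using polyf_id polyf_const unfolding wt_def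
    by (cases "a + u < L"; cases "L \<le> a + u + w"; cases "Suc (a + u + w) = L") simp_all
  have PPp: "polyf v (\<lambda>s. PP w s \<iota> v a x)" for \<iota> v a
  proof -
    have "polyf (card {..<v} * 1) (\<lambda>s. \<Prod>u<v. 1 + \<iota> * (of_real (tau * f a u x) * wt L w s a u))"
      by (intro polyf_prod polyf_add polyf_const polyf_cmult wtp) simp
    then show ?thesis by (simp add: PP_def)
  qed
  have Thp: "polyf v (\<lambda>s. Th w s v a x)" for v a
  proof -
    have "polyf v (\<lambda>s. (1 / (2 * \<i>)) * (PP w s \<i> v a x - PP w s (-\<i>) v a x))"
      by (intro polyf_cmult polyf_diff PPp)
    then show ?thesis by (simp add: Th_def)
  qed
  have Ccp: "polyf v (\<lambda>s. Cc w s v a x)" for v a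
  proof -
    have "polyf v (\<lambda>s. (1 / 2) * (PP w s \<i> v a x + PP w s (-\<i>) v a x))"
      by (intro polyf_cmult polyf_add PPp)
    then show ?thesis by (simp add: Cc_def)
  qed
  have fac: "polyf (v + 1) (\<lambda>s. FF w s v a x + z * qq w s v a x)" for v a z
  proof -
    have "polyf (1 + v) (\<lambda>s. (of_real (rho * f a v x) * wt L w s a v) * Cc w s v a x)"
      by (intro polyf_mult polyf_cmult wtp Ccp)
    then have "polyf (v + 1) (\<lambda>s. z * ((of_real (rho * f a v x) * wt L w s a v) * Cc w s v a x))"
      by (intro polyf_cmult) (simp add: add.commute)
    note A = this
    have "polyf (v + 1) (\<lambda>s. 1 + of_real gam * Th w s v a x)"
      by (intro polyf_add polyf_const polyf_cmult polyf_mono[OF Thp]) simp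
    from polyf_add[OF this A] show ?thesis unfolding FF_def qq_def .
  qed
  have Psip: "polyf (L * (v + 1)) (\<lambda>s. Psi w s z v x)" for v z
    unfolding Psi_def zprod_def using polyf_prod[of "{..<L}" "v + 1" "\<lambda>a s. FF w s v a x + z * qq w s v a x"] fac
    by simp
  have "polyf (L * (L + 1)) (\<lambda>s. even_part w s v x)" if "v < L" for v
  proof -
    have P: "polyf (L * (L + 1)) (\<lambda>s. Psi w s z v x)" for z
      by (rule polyf_mono[OF Psip]) (use that in simp)
    have "polyf (L * (L + 1)) (\<lambda>s. (1/2) * (Psi w s 1 v x + Psi w s (-1) v x) - Psi w s 0 v x)"
      by (intro polyf_diff polyf_cmult polyf_add P)
    then show ?thesis by (simp add: even_part_def)
  qed
  then show ?thesis unfolding even_sum_def by (intro polyf_sum) auto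
qed

text \<open>The quadrature on the circle \<open>|s| = sqrt L / G\<close>, the largest one on which the bound for \<open>even_sum\<close> holds, expresses
  the part even in \<open>s\<close> by values with total weight \<open>2 * G\<^sup>2 / L\<close>.\<close>

lemma avg_mixed_le:
  assumes B: "\<And>s. cmod s \<le> sqrt (real L) / G \<Longrightarrow> avg A (\<lambda>x. cmod (even_sum w s x)) \<le> B"
    and L: "2 * G\<^sup>2 \<le> real L"
  shows "avg A (\<lambda>x. cmod ((even_sum w 1 x + even_sum w (-1) x) / 2 - even_sum w 0 x)) \<le> 2 * G\<^sup>2 / real L * B"
proof -
  define r where "r = sqrt (real L) / G"
  have r0: "0 < r" using L0 G1 by (simp add: r_def)
  have r2: "r\<^sup>2 = real L / G\<^sup>2" by (simp add: r_def power_divide)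
  have r2': "2 \<le> r\<^sup>2" using L G1 by (simp add: r2 field_simps)
  define N where "N = L * (L + 1)"
  obtain \<kappa> \<zeta> :: "nat \<Rightarrow> complex" where z: "\<And>j. j < Suc N \<Longrightarrow> cmod (\<zeta> j) = r"
    and k: "(\<Sum>j<Suc N. cmod (\<kappa> j)) \<le> 2 / r\<^sup>2"
    and q: "\<And>p :: complex poly. degree p \<le> N \<Longrightarrow> (poly p 1 + poly p (-1)) / 2 - poly p 0 = (\<Sum>j<Suc N. \<kappa> j * poly p (\<zeta> j))"
    using even_quadrature[OF r0 r2', of N] by blast
  have eq: "(even_sum w 1 x + even_sum w (-1) x) / 2 - even_sum w 0 x = (\<Sum>j<Suc N. \<kappa> j * even_sum w (\<zeta> j) x)" for x
  proof -
    obtain p where "degree p \<le> N" "\<And>s. even_sum w s x = poly p s" using polyf_even_sum[of w x] unfolding polyf_def N_def by blast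
    then show ?thesis using q by simp
  qed
  have B0: "0 \<le> B" using B[of 0] avg_nonneg[of A "\<lambda>x. cmod (even_sum w 0 x)"] L0 G1 by force
  have "avg A (\<lambda>x. cmod ((even_sum w 1 x + even_sum w (-1) x) / 2 - even_sum w 0 x)) \<le> avg A (\<lambda>x. \<Sum>j<Suc N. cmod (\<kappa> j) * cmod (even_sum w (\<zeta> j) x))"
    unfolding eq by (intro avg_mono order_trans[OF norm_sum]) (simp add: norm_mult)
  also have "\<dots> = (\<Sum>j<Suc N. cmod (\<kappa> j) * avg A (\<lambda>x. cmod (even_sum w (\<zeta> j) x)))"
    unfolding avg_sum avg_cmult ..
  also have "\<dots> \<le> (\<Sum>j<Suc N. cmod (\<kappa> j) * B)"
    using z by (intro sum_mono mult_left_mono B) (auto simp: r_def)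
  also have "\<dots> \<le> 2 / r\<^sup>2 * B" unfolding sum_distrib_right[symmetric] using k B0 by (intro mult_right_mono) auto
  finally show ?thesis by (simp add: r2)
qed

end

section \<open>The test function and its mean\<close>

text \<open>The full parity structure of r-functions in three coordinates.  Exchanging the second and third coordinate, as in \<open>f_swap\<close>, gives
  another instance of \<open>lines\<close>.\<close>

locale lines3 = lines A fl1 fl3 L f G + x2: digits A fl2 L
  for A :: "'x set" and fl1 fl2 fl3 L f G +
  assumes f_inv2: "a + u < L \<Longrightarrow> x2.inv_from (Suc u) (f a u)"
    and f_odd2: "a + u < L \<Longrightarrow> x2.odd_at u (f a u)"
begin

definition f_swap :: "nat \<Rightarrow> nat \<Rightarrow> 'x \<Rightarrow> real" where "f_swap a u = f a (L - Suc (a + u))"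

sublocale sw: lines A fl1 fl2 L f_swap G
proof unfold_locales
  fix a u assume au: "a + u < L"
  define u' where "u' = L - Suc (a + u)"
  have u': "a + u' < L" "Suc u' = L - a - u" "u' = L - 1 - a - u" using au by (auto simp: u'_def)
  show "x1.inv_from (Suc a) (f_swap a u)" "x1.odd_at a (f_swap a u)"
    using f_inv1[OF u'(1)] f_odd1[OF u'(1)] by (simp_all add: f_swap_def u'_def)
  show "x2.inv_from (L - a - u) (f_swap a u)" "x2.odd_at (L - 1 - a - u) (f_swap a u)"
    using f_inv2[OF u'(1)] f_odd2[OF u'(1)] u'(2,3) by (simp_all add: f_swap_def u'_def)
  show "\<bar>f_swap a u x\<bar> = 1" if "x \<in> A" for x
    using f_abs[OF u'(1) that] by (simp add: f_swap_def u'_def)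
qed (use G1 L0 in auto)

lemma Psi_Suc_v: "Psi w s 1 v x = Psi w s 0 (Suc v) x"
  by (simp add: Psi_def zprod_def FF_Suc)

lemma wt_Suc: "wt L w 1 = wt L (Suc w) 0"
  by (auto simp: wt_def fun_eq_iff)

lemma Psi_Suc_w: "Psi w 1 z v x = Psi (Suc w) 0 z v x"
  by (simp add: Psi_def zprod_def FF_def qq_def Th_def Cc_def PP_def wt_Suc)

lemma Psi_v0: "Psi w s 0 0 x = 1"
  by (simp add: Psi_def zprod_def FF_def Th_0)

lemma wt_00: "wt L 0 0 a u = 0" by (simp add: wt_def)

lemma Psi_w0: "Psi 0 0 z v x = 1"
  by (simp add: Psi_def zprod_def FF_def Th_def PP_def qq_def wt_00)

text \<open>Summation against \<open>z * s\<close> over signs keeps the terms that contain second level \<open>v\<close> an odd number of times and third level \<open>w\<close> an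
  odd number of times.\<close>

definition testf_level :: "nat \<Rightarrow> nat \<Rightarrow> 'x \<Rightarrow> complex" where
  "testf_level v w x = (Psi w 1 1 v x - Psi w 1 (-1) v x - Psi w (-1) 1 v x + Psi w (-1) (-1) v x) / 4"

definition testf :: "'x \<Rightarrow> complex" where "testf x = (\<Sum>v<L. \<Sum>w<L. testf_level v w x)"

text \<open>If all second levels are admitted then the bound \<open>w\<close> on the third level is a bound on the exchanged second level, and the marker \<open>s\<close> turns into
  the marker \<open>z\<close> of the exchanged family.\<close>

lemma PP_swap:
  "PP w s \<iota> L a x = sw.PP L 0 \<iota> w a x * (1 + \<iota> * (of_real (tau * f_swap a w x) * (s * wt L L 0 a w)))"
proof -
  define g where "g = (\<lambda>u. 1 + \<iota> * (of_real (tau * f a u x) * wt L w s a u))"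
  define g' where "g' = (\<lambda>i. 1 + \<iota> * (of_real (tau * f_swap a i x) * (if i < w then 1 else if i = w then s else 0)))"
  have "PP w s \<iota> L a x = prod g {..<L}" by (simp add: PP_def g_def)
  also have "\<dots> = prod g {..<L - a}"
    by (rule prod.mono_neutral_right) (auto simp: g_def wt_def)
  also have "\<dots> = (\<Prod>i<L - a. g (L - a - Suc i))" by (rule prod.nat_diff_reindex[symmetric])
  also have "\<dots> = (\<Prod>i<L - a. g' i)"
  proof (rule prod.cong[OF refl])
    fix i assume "i \<in> {..<L - a}"
    then show "g (L - a - Suc i) = g' i"
      by (auto simp: g_def g'_def f_swap_def wt_def)
  qed
  also have "\<dots> = sw.PP L 0 \<iota> w a x * (1 + \<iota> * (of_real (tau * f_swap a w x) * (s * wt L L 0 a w)))"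
  proof (cases "w < L - a")
    case True
    have "(\<Prod>i<L - a. g' i) = prod g' {..<Suc w}"
      using True by (intro prod.mono_neutral_right) (auto simp: g'_def)
    also have "\<dots> = prod g' {..<w} * g' w" by simp
    also have "prod g' {..<w} = sw.PP L 0 \<iota> w a x"
      unfolding sw.PP_def using True by (intro prod.cong) (auto simp: g'_def wt_def sw.tau_def tau_def)
    also have "g' w = 1 + \<iota> * (of_real (tau * f_swap a w x) * (s * wt L L 0 a w))"
      using True by (simp add: g'_def wt_def)
    finally show ?thesis .
  next
    case False
    have "(\<Prod>i<L - a. g' i) = (\<Prod>i<w. 1 + \<iota> * (of_real (tau * f_swap a i x) * wt L L 0 a i))"
      using False by (intro prod.mono_neutral_cong_left) (auto simp: g'_def wt_def)
    then show ?thesis using False by (simp add: sw.PP_def wt_def)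
  qed
  finally show ?thesis .
qed

lemma FF_swap: "FF w s L a x = sw.FF L 0 w a x + s * sw.qq L 0 w a x"
proof -
  define P where "P = (\<lambda>\<iota>. sw.PP L 0 \<iota> w a x)"
  define c where "c = of_real (tau * f_swap a w x) * (s * wt L L 0 a w)"
  have "Th w s L a x = (P \<i> * (1 + \<i> * c) - P (-\<i>) * (1 + (-\<i>) * c)) / (2 * \<i>)"
    by (simp add: Th_def PP_swap P_def c_def)
  also have "\<dots> = (P \<i> - P (-\<i>)) / (2 * \<i>) + c * ((P \<i> + P (-\<i>)) / 2)"
    by (simp add: field_simps)
  also have "\<dots> = sw.Th L 0 w a x + c * sw.Cc L 0 w a x"
    by (simp add: sw.Th_def sw.Cc_def P_def)
  finally show ?thesis
    unfolding FF_def sw.FF_def sw.qq_def c_def gam_tau[symmetric]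
    by (simp add: algebra_simps)
qed

lemma Psi_swap: "Psi w s 0 L x = sw.Psi L 0 s w x"
  by (simp add: Psi_def sw.Psi_def zprod_def FF_swap)

text \<open>Replace the difference over signs in \<open>z\<close> by the value at \<open>z = 1\<close> minus that at \<open>z = 0\<close>, up to an even part, and likewise for \<open>s\<close>.
  Since \<open>z = 1\<close> means \<open>v + 1\<close> with \<open>z = 0\<close>, and similarly for \<open>s\<close> and \<open>w\<close>, the sums over \<open>v\<close> and \<open>w\<close> telescope.  Only
  the part even in both markers keeps a sum over \<open>w\<close>.\<close>

lemma testf_eq:
  "testf x = Psi L 0 0 L x - 1 - even_sum L 0 x - sw.even_sum L 0 x + (\<Sum>w<L. (even_sum w 1 x + even_sum w (-1) x) / 2 - even_sum w 0 x)"
proof -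
  define e' where "e' = (\<lambda>v w z. (Psi w 1 z v x + Psi w (-1) z v x) / 2 - Psi w 0 z v x)"
  define \<Phi> where "\<Phi> = (\<lambda>v w. Psi w 0 0 v x)"
  have one: "testf_level v w x = ((\<Phi> (Suc v) (Suc w) - \<Phi> v (Suc w)) - (\<Phi> (Suc v) w - \<Phi> v w))
     - (even_part (Suc w) 0 v x - even_part w 0 v x) - (e' (Suc v) w 0 - e' v w 0)
     + ((even_part w 1 v x + even_part w (-1) v x) / 2 - even_part w 0 v x)" for v w
  proof -
    have E: "even_part (Suc w) 0 v x = even_part w 1 v x" by (simp add: even_part_def Psi_Suc_w)
    have E': "e' (Suc v) w 0 = e' v w 1" by (simp add: e'_def Psi_Suc_v)
    have P: "\<Phi> (Suc v) (Suc w) = Psi w 1 1 v x" "\<Phi> v (Suc w) = Psi w 1 0 v x" "\<Phi> (Suc v) w = Psi w 0 1 v x"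
      by (simp_all add: \<Phi>_def Psi_Suc_v Psi_Suc_w)
    show ?thesis unfolding E E' P unfolding testf_level_def even_part_def e'_def \<Phi>_def by (simp add: field_simps)
  qed
  have s1: "(\<Sum>v<L. \<Sum>w<L. (\<Phi> (Suc v) (Suc w) - \<Phi> v (Suc w)) - (\<Phi> (Suc v) w - \<Phi> v w)) = Psi L 0 0 L x - 1"
  proof -
    have "(\<Sum>w<L. (\<Phi> (Suc v) (Suc w) - \<Phi> v (Suc w)) - (\<Phi> (Suc v) w - \<Phi> v w)) = \<Phi> (Suc v) L - \<Phi> v L" for v
      using sum_lessThan_telescope[of "\<lambda>w. \<Phi> (Suc v) w - \<Phi> v w" L] by (simp add: \<Phi>_def Psi_w0)
    then have "(\<Sum>v<L. \<Sum>w<L. (\<Phi> (Suc v) (Suc w) - \<Phi> v (Suc w)) - (\<Phi> (Suc v) w - \<Phi> v w)) = (\<Sum>v<L. \<Phi> (Suc v) L - \<Phi> v L)"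
      by simp
    also have "\<dots> = \<Phi> L L - \<Phi> 0 L" by (rule sum_lessThan_telescope)
    finally show ?thesis by (simp add: \<Phi>_def Psi_v0)
  qed
  have s2: "(\<Sum>v<L. \<Sum>w<L. even_part (Suc w) 0 v x - even_part w 0 v x) = even_sum L 0 x"
  proof -
    have "(\<Sum>w<L. even_part (Suc w) 0 v x - even_part w 0 v x) = even_part L 0 v x" for v
      using sum_lessThan_telescope[of "\<lambda>w. even_part w 0 v x" L] by (simp add: even_part_def Psi_w0)
    then show ?thesis by (simp add: even_sum_def)
  qed
  have s3: "(\<Sum>v<L. \<Sum>w<L. e' (Suc v) w 0 - e' v w 0) = sw.even_sum L 0 x"
  proof -
    have "(\<Sum>v<L. \<Sum>w<L. e' (Suc v) w 0 - e' v w 0) = (\<Sum>w<L. \<Sum>v<L. e' (Suc v) w 0 - e' v w 0)" by (rule sum.swap)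
    also have "\<dots> = (\<Sum>w<L. e' L w 0 - e' 0 w 0)"
      by (intro sum.cong refl sum_lessThan_telescope[where f = "\<lambda>v. e' v _ 0"])
    also have "\<dots> = (\<Sum>w<L. sw.even_part L 0 w x)"
      by (intro sum.cong refl) (simp add: e'_def Psi_v0 Psi_swap sw.even_part_def)
    finally show ?thesis by (simp add: sw.even_sum_def)
  qed
  have s4: "(\<Sum>v<L. \<Sum>w<L. (even_part w 1 v x + even_part w (-1) v x) / 2 - even_part w 0 v x) = (\<Sum>w<L. (even_sum w 1 x + even_sum w (-1) x) / 2 - even_sum w 0 x)"
    unfolding even_sum_def by (subst sum.swap) (simp add: sum_subtractf sum.distrib sum_divide_distrib add_divide_distrib)
  show ?thesis
    unfolding testf_def one sum.distrib sum_subtractf[of "\<lambda>w. _ - _ - _"]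
    using s1 s2 s3 s4 by (simp add: sum.distrib sum_subtractf algebra_simps)
qed

lemma avg_testf_le:
  assumes l: "real l = G ^ 8" and l0: "0 < l" and b0: "0 < b"
    and c0: "64 * G\<^sup>2 \<le> real L"
    and c1: "l * b \<le> L"
    and c2: "real l ^ 3 * exp (30 * G * sqrt (real L) - real b / (4 * (real l)\<^sup>2)) \<le> 32 * G\<^sup>2 / real L"
    and c3: "G\<^sup>2 * real l ^ 3 \<le> real L"
  shows "avg A (\<lambda>x. cmod (testf x)) \<le> 10^8 * KK ^ 3"
proof -
  define B where "B = 10^7 * KK ^ 3 / G\<^sup>2"
  have Lp: "0 < real L" using L0 by simp
  have B: "avg A (\<lambda>x. cmod (even_sum w s x)) \<le> B" if "cmod s \<le> sqrt (real L) / G" for w s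
    unfolding B_def by (rule avg_even_sum_le[OF that assms])
  have z: "cmod 0 \<le> sqrt (real L) / G" using G1 by simp
  have B': "avg A (\<lambda>x. cmod (sw.even_sum L 0 x)) \<le> B"
    unfolding B_def by (rule sw.avg_even_sum_le[OF z assms])
  have mix: "avg A (\<lambda>x. cmod ((even_sum w 1 x + even_sum w (-1) x) / 2 - even_sum w 0 x)) \<le> 2 * G\<^sup>2 / real L * B" for w
    by (rule avg_mixed_le[OF B]) (use c0 in auto)
  have P1: "avg A (\<lambda>x. cmod (Psi L 0 0 L x)) = 1"
  proof -
    interpret level_group A fl1 fl3 L f G L 0 L l b
      by unfold_locales (use assms z in auto)
    have "avg A (\<lambda>x. cmod (Psi L 0 0 L x)) = avg A (rm.psi L)"
    proof (rule avg_cong)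
      fix x assume x: "x \<in> A"
      have "Psi L 0 0 L x = of_real (rm.psi L x)"
        by (simp add: Psi_def zprod_def rm.psi_def of_real_p[OF x, symmetric])
      then show "cmod (Psi L 0 0 L x) = rm.psi L x" using rm.psi_pos[of L x] x by simp
    qed
    then show ?thesis using rm.avg_psi[of L] by simp
  qed
  have "avg A (\<lambda>x. cmod (testf x)) \<le> avg A (\<lambda>x. cmod (Psi L 0 0 L x) + 1 + cmod (even_sum L 0 x) + cmod (sw.even_sum L 0 x)
     + (\<Sum>w<L. cmod ((even_sum w 1 x + even_sum w (-1) x) / 2 - even_sum w 0 x)))"
  proof (rule avg_mono)
    fix x
    have "cmod (\<Sum>w<L. (even_sum w 1 x + even_sum w (-1) x) / 2 - even_sum w 0 x) \<le> (\<Sum>w<L. cmod ((even_sum w 1 x + even_sum w (-1) x) / 2 - even_sum w 0 x))"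
      by (rule norm_sum)
    moreover have "cmod (a1 - 1 - c1 - d1 + e1) \<le> cmod a1 + 1 + cmod c1 + cmod d1 + cmod e1" for a1 c1 d1 e1
      using norm_triangle_ineq[of "a1 - 1 - c1 - d1" e1] norm_triangle_ineq4[of "a1 - 1 - c1" d1]
        norm_triangle_ineq4[of "a1 - 1" c1] norm_triangle_ineq4[of a1 1] by simp
    ultimately show "cmod (testf x) \<le> cmod (Psi L 0 0 L x) + 1 + cmod (even_sum L 0 x) + cmod (sw.even_sum L 0 x)
     + (\<Sum>w<L. cmod ((even_sum w 1 x + even_sum w (-1) x) / 2 - even_sum w 0 x))"
      unfolding testf_eq by (smt (verit))
  qed
  also have "\<dots> = avg A (\<lambda>x. cmod (Psi L 0 0 L x)) + avg A (\<lambda>x. 1) + avg A (\<lambda>x. cmod (even_sum L 0 x)) + avg A (\<lambda>x. cmod (sw.even_sum L 0 x))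
     + (\<Sum>w<L. avg A (\<lambda>x. cmod ((even_sum w 1 x + even_sum w (-1) x) / 2 - even_sum w 0 x)))"
    by (simp only: avg_add avg_sum)
  also have "\<dots> \<le> 1 + 1 + B + B + (\<Sum>w<L. 2 * G\<^sup>2 / real L * B)"
    using avg_const[OF x1.finA x1.neA, of 1] by (intro add_mono sum_mono mix B[OF z] B') (simp_all add: P1)
  also have "(\<Sum>w<L. 2 * G\<^sup>2 / real L * B) = 2 * 10^7 * KK ^ 3"
    using Lp G1 by (simp add: B_def)
  also have "B \<le> 10^7 * KK ^ 3"
  proof -
    have "1 \<le> G\<^sup>2" using G1 by simp
    then show ?thesis using KK1 G1 by (simp add: B_def divide_le_eq mult_le_cancel_left1)
  qed
  finally have "avg A (\<lambda>x. cmod (testf x)) \<le> 2 + 4 * 10^7 * KK ^ 3" by simp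
  moreover have "1 \<le> KK ^ 3" using KK1 by simp
  ultimately show ?thesis by simp
qed

end

section \<open>Pointwise structure of the test function\<close>

text \<open>Functions of two signs are combinations of \<open>1\<close>, \<open>z\<close>, \<open>s\<close> and \<open>z * s\<close>.  The norm weights the coefficients by \<open>1\<close>, \<open>K\<close>, \<open>K\<close>
  and \<open>K\<^sup>2\<close>, so that a bound on the norm of a product yields a saving of \<open>K\<^sup>2\<close> for its coefficient of \<open>z * s\<close>.\<close>

definition srep :: "real \<Rightarrow> (complex \<Rightarrow> complex \<Rightarrow> complex) \<Rightarrow> real \<Rightarrow> bool" where
  "srep K F N \<longleftrightarrow> (\<exists>c00 c10 c01 c11. (\<forall>z\<in>{1,-1}. \<forall>s\<in>{1,-1}. F z s = c00 + z * c10 + s * c01 + z * s * c11)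
     \<and> cmod c00 + K * cmod c10 + K * cmod c01 + K\<^sup>2 * cmod c11 \<le> N)"

lemma srepI:
  assumes "\<And>z s. z \<in> {1,-1} \<Longrightarrow> s \<in> {1,-1} \<Longrightarrow> F z s = c00 + z * c10 + s * c01 + z * s * c11"
    and "cmod c00 + K * cmod c10 + K * cmod c01 + K\<^sup>2 * cmod c11 \<le> N"
  shows "srep K F N"
  unfolding srep_def using assms by blast

lemma srep_mono: "srep K F N \<Longrightarrow> N \<le> M \<Longrightarrow> srep K F M"
  unfolding srep_def by (meson order_trans)

lemma srep_1: "srep K (\<lambda>z s. 1) 1"
  by (rule srepI[of _ 1 0 0 0]) auto

text \<open>Submultiplicativity holds because \<open>z\<^sup>2 = s\<^sup>2 = 1\<close> moves products to coefficients of smaller or equal weight when \<open>1 \<le> K\<close>.\<close>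

lemma srep_mult:
  assumes K: "1 \<le> K" and F: "srep K F N" and G: "srep K G M"
  shows "srep K (\<lambda>z s. F z s * G z s) (N * M)"
proof -
  obtain a00 a10 a01 a11 where a: "\<And>z s. z \<in> {1,-1} \<Longrightarrow> s \<in> {1,-1} \<Longrightarrow> F z s = a00 + z * a10 + s * a01 + z * s * a11"
    and aN: "cmod a00 + K * cmod a10 + K * cmod a01 + K\<^sup>2 * cmod a11 \<le> N"
    using F unfolding srep_def by blast
  obtain b00 b10 b01 b11 where b: "\<And>z s. z \<in> {1,-1} \<Longrightarrow> s \<in> {1,-1} \<Longrightarrow> G z s = b00 + z * b10 + s * b01 + z * s * b11"
    and bM: "cmod b00 + K * cmod b10 + K * cmod b01 + K\<^sup>2 * cmod b11 \<le> M"
    using G unfolding srep_def by blast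
  define c00 where "c00 = a00 * b00 + a10 * b10 + a01 * b01 + a11 * b11"
  define c10 where "c10 = a00 * b10 + a10 * b00 + a01 * b11 + a11 * b01"
  define c01 where "c01 = a00 * b01 + a01 * b00 + a10 * b11 + a11 * b10"
  define c11 where "c11 = a00 * b11 + a11 * b00 + a10 * b01 + a01 * b10"
  have n4: "cmod (p * p' + q * q' + r * r' + t * t') \<le> cmod p * cmod p' + cmod q * cmod q' + cmod r * cmod r' + cmod t * cmod t'"
    for p p' q q' r r' t t'
    unfolding norm_mult[symmetric] by (intro norm_triangle_le add_mono order_refl norm_triangle_ineq order_trans[OF norm_triangle_ineq] )
  define A0 where "A0 = cmod a00" define A1 where "A1 = cmod a10" define A2 where "A2 = cmod a01" define A3 where "A3 = cmod a11"
  define B0 where "B0 = cmod b00" define B1 where "B1 = cmod b10" define B2 where "B2 = cmod b01" define B3 where "B3 = cmod b11"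
  note ds = A0_def A1_def A2_def A3_def B0_def B1_def B2_def B3_def
  have nn: "0 \<le> A0" "0 \<le> A1" "0 \<le> A2" "0 \<le> A3" "0 \<le> B0" "0 \<le> B1" "0 \<le> B2" "0 \<le> B3" by (simp_all add: ds)
  have K2: "1 \<le> K\<^sup>2" using K by simp
  have K4: "1 \<le> K\<^sup>2 * K\<^sup>2" using mult_mono[OF K2 K2] by simp
  have KK2: "K \<le> K * K\<^sup>2" using K K2 by (simp add: mult_le_cancel_left1)
  have e1: "A1 * B1 \<le> K\<^sup>2 * (A1 * B1)" "A2 * B2 \<le> K\<^sup>2 * (A2 * B2)" "A3 * B3 \<le> (K\<^sup>2 * K\<^sup>2) * (A3 * B3)"
    using mult_right_mono[OF K2, of "A1 * B1"] mult_right_mono[OF K2, of "A2 * B2"] mult_right_mono[OF K4, of "A3 * B3"] nn by simp_all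
  have e2: "K * (A2 * B3) \<le> (K * K\<^sup>2) * (A2 * B3)" "K * (A3 * B2) \<le> (K * K\<^sup>2) * (A3 * B2)"
    "K * (A1 * B3) \<le> (K * K\<^sup>2) * (A1 * B3)" "K * (A3 * B1) \<le> (K * K\<^sup>2) * (A3 * B1)"
    using KK2 nn by (intro mult_right_mono; simp)+
  have "cmod c00 + K * cmod c10 + K * cmod c01 + K\<^sup>2 * cmod c11
    \<le> (A0 * B0 + A1 * B1 + A2 * B2 + A3 * B3) + K * (A0 * B1 + A1 * B0 + A2 * B3 + A3 * B2)
      + K * (A0 * B2 + A2 * B0 + A1 * B3 + A3 * B1) + K\<^sup>2 * (A0 * B3 + A3 * B0 + A1 * B2 + A2 * B1)"
    unfolding c00_def c10_def c01_def c11_def ds using K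
    by (intro add_mono mult_left_mono n4) auto
  also have "\<dots> \<le> (A0 + K * A1 + K * A2 + K\<^sup>2 * A3) * (B0 + K * B1 + K * B2 + K\<^sup>2 * B3)"
  proof -
    have "(A0 + K * A1 + K * A2 + K\<^sup>2 * A3) * (B0 + K * B1 + K * B2 + K\<^sup>2 * B3)
      = A0 * B0 + K\<^sup>2 * (A1 * B1) + K\<^sup>2 * (A2 * B2) + (K\<^sup>2 * K\<^sup>2) * (A3 * B3)
      + K * (A0 * B1 + A1 * B0) + (K * K\<^sup>2) * (A2 * B3) + (K * K\<^sup>2) * (A3 * B2)
      + K * (A0 * B2 + A2 * B0) + (K * K\<^sup>2) * (A1 * B3) + (K * K\<^sup>2) * (A3 * B1)
      + K\<^sup>2 * (A0 * B3 + A3 * B0 + A1 * B2 + A2 * B1)"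
      by (simp add: algebra_simps power2_eq_square)
    moreover have "K * (A0 * B1 + A1 * B0 + A2 * B3 + A3 * B2) = K * (A0 * B1 + A1 * B0) + K * (A2 * B3) + K * (A3 * B2)"
      "K * (A0 * B2 + A2 * B0 + A1 * B3 + A3 * B1) = K * (A0 * B2 + A2 * B0) + K * (A1 * B3) + K * (A3 * B1)"
      by (simp_all add: algebra_simps)
    ultimately show ?thesis using e1 e2 by linarith
  qed
  also have "\<dots> \<le> N * M"
    unfolding ds using aN bM K by (intro mult_mono) (auto intro!: add_nonneg_nonneg order_trans[OF _ aN])
  finally have le: "cmod c00 + K * cmod c10 + K * cmod c01 + K\<^sup>2 * cmod c11 \<le> N * M" .
  show ?thesis
  proof (rule srepI[OF _ le])
    fix z s :: complex assume zs: "z \<in> {1,-1}" "s \<in> {1,-1}"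
    show "F z s * G z s = c00 + z * c10 + s * c01 + z * s * c11"
      unfolding a[OF zs] b[OF zs] c00_def c10_def c01_def c11_def using zs by (auto simp: algebra_simps)
  qed
qed

lemma srep_prod:
  assumes "1 \<le> K" "finite I" "\<And>i. i \<in> I \<Longrightarrow> srep K (F i) (N i)"
  shows "srep K (\<lambda>z s. \<Prod>i\<in>I. F i z s) (\<Prod>i\<in>I. N i)"
  using assms(2,3) by (induction I rule: finite_induct) (auto intro: srep_1 srep_mult assms(1))

lemma srep_extract:
  assumes "srep K F N" "0 < K"
  shows "cmod ((F 1 1 - F 1 (-1) - F (-1) 1 + F (-1) (-1)) / 4) \<le> N / K\<^sup>2"
proof -
  obtain c00 c10 c01 c11 where a: "\<And>z s. z \<in> {1,-1} \<Longrightarrow> s \<in> {1,-1} \<Longrightarrow> F z s = c00 + z * c10 + s * c01 + z * s * c11"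
    and aN: "cmod c00 + K * cmod c10 + K * cmod c01 + K\<^sup>2 * cmod c11 \<le> N"
    using assms(1) unfolding srep_def by blast
  have "(F 1 1 - F 1 (-1) - F (-1) 1 + F (-1) (-1)) / 4 = c11"
    by (subst (1 2 3 4) a) (auto simp: field_simps)
  moreover have "K\<^sup>2 * cmod c11 \<le> N"
    using aN assms(2) by (smt (verit) mult_nonneg_nonneg norm_ge_zero)
  ultimately show ?thesis using assms(2) by (simp add: le_divide_eq mult.commute)
qed

lemma prod_telescope:
  fixes F :: "nat \<Rightarrow> 'c::comm_ring_1"
  shows "(\<Prod>a<n. F a) = 1 + (\<Sum>b<n. (F b - 1) * (\<Prod>a<b. F a))"
  by (induction n) (auto simp: algebra_simps)

context lines begin

definition fac :: "nat \<Rightarrow> nat \<Rightarrow> nat \<Rightarrow> 'x \<Rightarrow> complex \<Rightarrow> complex \<Rightarrow> complex" where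
  "fac w v a x z s = FF w s v a x + z * qq w s v a x"

lemma Ksq: "(sqrt (real L))\<^sup>2 = real L" "sqrt (real L) * tau = 1" "sqrt (real L) * rho = gam" "1 \<le> sqrt (real L)"
  using L0 by (simp_all add: tau_def rho_def gam_def divide_simps)

lemma wt_const: "Suc (a + v + w) \<noteq> L \<Longrightarrow> wt L w s a v = wt L w 0 a v"
  by (auto simp: wt_def)

lemma wt0_le: "cmod (wt L w 0 a v) \<le> 1" by (simp add: wt_def)

text \<open>Each occurrence of a marker comes with \<open>tau = 1 / sqrt L\<close>, which the weights \<open>K = sqrt L\<close> compensate exactly.  So the norm of the deviation from one stays of
  order \<open>gam\<close>.\<close>

lemma fac_rep_aux:
  assumes x: "x \<in> A" and ne: "Suc (a + v + w) \<noteq> L"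
  shows "srep (sqrt (real L)) (\<lambda>z s. fac w v a x z s - 1) (8 * gam)"
proof -
  define W where "W = of_real (f a v x) * wt L w 0 a v"
  define T where "T = Th w 0 v a x"
  define C where "C = Cc w 0 v a x"
  define g where "g = marked_f w v a x"
  have W: "cmod W \<le> 1" unfolding W_def f_wt_le[OF x] by (rule wt0_le)
  have T: "cmod T \<le> 2" and C: "cmod C \<le> 2" unfolding T_def C_def by (rule Th_le0[OF x] Cc_le0[OF x])+
  have g: "\<bar>g\<bar> \<le> 1" unfolding g_def by (rule marked_f_le[OF x])
  show ?thesis
  proof (rule srepI)
    fix z s :: complex
    have "fac w v a x z s = 1 + of_real gam * (T + of_real (tau * g) * s * C) + z * (of_real rho * W * (C - of_real (tau * g) * s * T))"
      unfolding fac_def FF_def qq_def Th_s[of w s] Cc_s[of w s] wt_const[OF ne, of s] T_def C_def g_def W_def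
      by (simp add: mult_ac)
    then show "fac w v a x z s - 1 = of_real gam * T + z * (of_real rho * W * C) + s * (of_real gam * of_real (tau * g) * C)
       + z * s * (- (of_real rho * W * of_real (tau * g) * T))"
      by (simp add: algebra_simps)
  next
    have 1: "cmod (of_real gam * T) \<le> gam * 2" using T gam_pos by (simp add: norm_mult)
    have "cmod (of_real rho * W * C) = rho * (cmod W * cmod C)" using rho_pos by (simp add: norm_mult)
    also have "\<dots> \<le> rho * (1 * 2)" using W C rho_pos by (intro mult_left_mono mult_mono) auto
    finally have "sqrt (real L) * cmod (of_real rho * W * C) \<le> sqrt (real L) * (rho * 2)" by (intro mult_left_mono) auto
    then have 2: "sqrt (real L) * cmod (of_real rho * W * C) \<le> gam * 2" using Ksq(3) by (simp only: mult.assoc[symmetric])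
    have "cmod (of_real gam * of_real (tau * g) * C) = gam * tau * (\<bar>g\<bar> * cmod C)"
      using gam_pos tau_pos by (simp add: norm_mult abs_mult)
    also have "\<dots> \<le> gam * tau * (1 * 2)" using g C gam_pos tau_pos by (intro mult_left_mono mult_mono) auto
    finally have "sqrt (real L) * cmod (of_real gam * of_real (tau * g) * C) \<le> sqrt (real L) * (gam * tau * (1 * 2))"
      by (intro mult_left_mono) auto
    also have "\<dots> = (sqrt (real L) * tau) * gam * 2" by (simp add: mult_ac)
    finally have 3: "sqrt (real L) * cmod (of_real gam * of_real (tau * g) * C) \<le> gam * 2" using Ksq(2) by simp
    have "cmod (- (of_real rho * W * of_real (tau * g) * T)) = rho * tau * (cmod W * \<bar>g\<bar> * cmod T)"
      using rho_pos tau_pos by (simp add: norm_mult abs_mult)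
    also have "\<dots> \<le> rho * tau * (1 * 1 * 2)" using W g T rho_pos tau_pos by (intro mult_left_mono mult_mono) auto
    finally have "(sqrt (real L))\<^sup>2 * cmod (- (of_real rho * W * of_real (tau * g) * T)) \<le> (sqrt (real L))\<^sup>2 * (rho * tau * (1 * 1 * 2))"
      by (intro mult_left_mono) auto
    also have "\<dots> = (sqrt (real L) * tau) * (sqrt (real L) * rho) * 2" by (simp add: power2_eq_square mult_ac)
    finally have 4: "(sqrt (real L))\<^sup>2 * cmod (- (of_real rho * W * of_real (tau * g) * T)) \<le> gam * 2" using Ksq(2,3) by simp
    show "cmod (of_real gam * T) + sqrt (real L) * cmod (of_real rho * W * C) + sqrt (real L) * cmod (of_real gam * of_real (tau * g) * C)
       + (sqrt (real L))\<^sup>2 * cmod (- (of_real rho * W * of_real (tau * g) * T)) \<le> 8 * gam"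
      using 1 2 3 4 by linarith
  qed
qed

lemma srep_add1: "srep K (\<lambda>z s. F z s - 1) N \<Longrightarrow> srep K F (1 + N)"
proof -
  assume "srep K (\<lambda>z s. F z s - 1) N"
  then obtain c00 c10 c01 c11 where a: "\<And>z s. z \<in> {1,-1} \<Longrightarrow> s \<in> {1,-1} \<Longrightarrow> F z s - 1 = c00 + z * c10 + s * c01 + z * s * c11"
    and aN: "cmod c00 + K * cmod c10 + K * cmod c01 + K\<^sup>2 * cmod c11 \<le> N"
    unfolding srep_def by blast
  show ?thesis
  proof (rule srepI)
    show "F z s = (1 + c00) + z * c10 + s * c01 + z * s * c11" if "z \<in> {1,-1}" "s \<in> {1,-1}" for z s
      using a[OF that] by (simp add: algebra_simps)
    show "cmod (1 + c00) + K * cmod c10 + K * cmod c01 + K\<^sup>2 * cmod c11 \<le> 1 + N"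
      using aN norm_triangle_ineq[of 1 c00] by simp
  qed
qed

text \<open>The exceptional line is the one on which a single r-function has second level \<open>v\<close> and third level \<open>w\<close>.  It carries \<open>z * s\<close> with coefficient
  of order \<open>rho = G / L\<close>, of norm \<open>G\<close>.\<close>

lemma fac_rep:
  assumes x: "x \<in> A"
  shows "srep (sqrt (real L)) (fac w v a x) ((if Suc (a + v + w) < L then 1 else 1 + 8 * gam) * (if Suc (a + v + w) = L then 1 + 2 * G else 1))"
proof (cases "Suc (a + v + w) = L")
  case False
  show ?thesis
  proof (cases "Suc (a + v + w) < L")
    case True
    have "wt L w s a u = 0" if "u \<le> v" for u s using True that by (simp add: wt_def)
    then have "fac w v a x = (\<lambda>z s. 1)"
      by (simp add: fac_def FF_def qq_def Th_def PP_def fun_eq_iff)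
    then show ?thesis using True by (simp add: srep_1)
  next
    case nl: False
    show ?thesis using srep_add1[OF fac_rep_aux[OF x False]] False nl by simp
  qed
next
  case True
  have g0: "marked_f w v a x = 0" using True by (auto simp: marked_f_def)
  have w: "wt L w s a v = s" for s using True by (auto simp: wt_def)
  have "srep (sqrt (real L)) (fac w v a x) (1 + 2 * gam + 2 * G)"
  proof (rule srepI)
    fix z s :: complex
    show "fac w v a x z s = (1 + of_real gam * Th w 0 v a x) + z * 0 + s * 0 + z * s * (of_real (rho * f a v x) * Cc w 0 v a x)"
      unfolding fac_def FF_def qq_def Th_s[of w s] Cc_s[of w s] g0 w by (simp add: mult_ac)
  next
    have "cmod (1 + of_real gam * Th w 0 v a x) \<le> 1 + cmod (of_real gam * Th w 0 v a x)"
      using norm_triangle_ineq[of 1 "of_real gam * Th w 0 v a x"] by simp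
    also have "cmod (of_real gam * Th w 0 v a x) \<le> gam * 2" using Th_le0[OF x, of w v a] gam_pos by (simp add: norm_mult)
    finally have 1: "cmod (1 + of_real gam * Th w 0 v a x) \<le> 1 + 2 * gam" by simp
    have "cmod (of_real (rho * f a v x) * Cc w 0 v a x) \<le> rho * 2"
      using f_abs[of a v x] True x Cc_le0[OF x, of w v a] rho_pos by (simp add: norm_mult abs_mult)
    then have "(sqrt (real L))\<^sup>2 * cmod (of_real (rho * f a v x) * Cc w 0 v a x) \<le> (sqrt (real L))\<^sup>2 * (rho * 2)"
      by (intro mult_left_mono) auto
    also have "\<dots> = 2 * G" using L0 by (simp add: rho_def)
    finally show "cmod (1 + of_real gam * Th w 0 v a x) + sqrt (real L) * cmod 0 + sqrt (real L) * cmod 0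
       + (sqrt (real L))\<^sup>2 * cmod (of_real (rho * f a v x) * Cc w 0 v a x) \<le> 1 + 2 * gam + 2 * G"
      using 1 by simp
  qed
  moreover have "1 + 2 * gam + 2 * G \<le> (1 + 8 * gam) * (1 + 2 * G)"
  proof -
    have "0 \<le> gam * G" using gam_pos G1 by simp
    then show ?thesis using gam_pos by (simp add: algebra_simps)
  qed
  ultimately show ?thesis using True srep_mono by simp
qed

text \<open>The contribution of those terms whose top first level is \<open>b\<close>, in the telescoped form of the product.\<close>

definition testf_part :: "nat \<Rightarrow> nat \<Rightarrow> nat \<Rightarrow> 'x \<Rightarrow> complex" where
  "testf_part b v w x = (let F = (\<lambda>z s. (fac w v b x z s - 1) * (\<Prod>a<b. fac w v a x z s)) in
     (F 1 1 - F 1 (-1) - F (-1) 1 + F (-1) (-1)) / 4)"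

text \<open>Below the diagonal no r-function with first level at most \<open>b\<close> and second level at most \<open>v\<close> has third level at most \<open>w\<close>; on the
  diagonal there is exactly one.\<close>

lemma testf_part_small:
  assumes "Suc (b + v + w) \<le> L"
  shows "testf_part b v w x = (if Suc (b + v + w) = L then of_real (rho * f b v x) else 0)"
proof -
  have w: "wt L w s a u = (if a = b \<and> u = v \<and> Suc (b + v + w) = L then s else 0)" if "a \<le> b" "u \<le> v" for a u s
    using assms that by (auto simp: wt_def)
  have T: "Th w s v a x = 0" "Cc w s v a x = 1" if "a \<le> b" for a s
    unfolding Th_def Cc_def PP_def using that by (simp_all add: w)
  have fa: "fac w v a x z s = 1" if "a < b" for a z s
    using that by (simp add: fac_def FF_def qq_def T w)
  have fb: "fac w v b x z s - 1 = z * s * (if Suc (b + v + w) = L then of_real (rho * f b v x) else 0)" for z s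
    by (simp add: fac_def FF_def qq_def T w)
  show ?thesis by (simp add: testf_part_def fa fb)
qed

text \<open>Lines with \<open>a + v + w + 1 < L\<close> contribute the factor one, which leaves at most \<open>j\<close> lines below \<open>b\<close>, and at most one of them is exceptional.\<close>

lemma testf_part_le:
  assumes "L < Suc (b + v + w)" "x \<in> A"
  shows "cmod (testf_part b v w x) \<le> 24 * gam * G / real L * (1 + 8 * gam) ^ (Suc (b + v + w) - L)"
proof -
  define j where "j = Suc (b + v + w) - L"
  have K0: "0 < sqrt (real L)" using L0 by simp
  have "srep (sqrt (real L)) (\<lambda>z s. (fac w v b x z s - 1) * (\<Prod>a<b. fac w v a x z s))
     (8 * gam * (\<Prod>a<b. (if Suc (a + v + w) < L then 1 else 1 + 8 * gam) * (if Suc (a + v + w) = L then 1 + 2 * G else 1)))"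
    by (intro srep_mult srep_prod fac_rep_aux fac_rep Ksq(4)) (use assms in auto)
  from srep_extract[OF this K0]
  have "cmod (testf_part b v w x) \<le> 8 * gam * (\<Prod>a<b. (if Suc (a + v + w) < L then 1 else 1 + 8 * gam) * (if Suc (a + v + w) = L then 1 + 2 * G else 1)) / real L"
    by (simp add: testf_part_def Let_def)
  also have "(\<Prod>a<b. (if Suc (a + v + w) < L then 1 else 1 + 8 * gam) * (if Suc (a + v + w) = L then 1 + 2 * G else 1))
     = (\<Prod>a<b. if Suc (a + v + w) < L then 1 else 1 + 8 * gam) * (\<Prod>a<b. if Suc (a + v + w) = L then 1 + 2 * G else 1)"
    by (rule prod.distrib)
  also have "\<dots> \<le> (1 + 8 * gam) ^ j * (1 + 2 * G)"
  proof (intro mult_mono)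
    have "(\<Prod>a<b. if Suc (a + v + w) < L then 1 else 1 + 8 * gam) = (\<Prod>a\<in>{a. a < b \<and> L \<le> Suc (a + v + w)}. 1 + 8 * gam)"
      by (rule prod.mono_neutral_cong_right) auto
    also have "\<dots> = (1 + 8 * gam) ^ card {a. a < b \<and> L \<le> Suc (a + v + w)}" by simp
    also have "\<dots> \<le> (1 + 8 * gam) ^ j"
    proof (intro power_increasing)
      have "card {a. a < b \<and> L \<le> Suc (a + v + w)} \<le> card {b - j..<b}"
        using assms(1) by (intro card_mono) (auto simp: j_def)
      then show "card {a. a < b \<and> L \<le> Suc (a + v + w)} \<le> j" by simp
    qed (use gam_pos in auto)
    finally show "(\<Prod>a<b. if Suc (a + v + w) < L then 1 else 1 + 8 * gam) \<le> (1 + 8 * gam) ^ j" .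
    have "(\<Prod>a<b. if Suc (a + v + w) = L then 1 + 2 * G else 1) \<le> (\<Prod>a\<in>insert (L - Suc (v + w)) {..<b}. if a = L - Suc (v + w) then 1 + 2 * G else 1)"
    proof -
      have "(\<Prod>a<b. if Suc (a + v + w) = L then 1 + 2 * G else 1) \<le> (\<Prod>a<b. if a = L - Suc (v + w) then 1 + 2 * G else 1)"
        using G1 by (intro prod_mono) auto
      also have "\<dots> \<le> (\<Prod>a\<in>insert (L - Suc (v + w)) {..<b}. if a = L - Suc (v + w) then 1 + 2 * G else 1)"
        using G1 by (intro prod_mono2) auto
      finally show ?thesis .
    qed
    also have "\<dots> = 1 + 2 * G" by (subst prod.delta) auto
    finally show "(\<Prod>a<b. if Suc (a + v + w) = L then 1 + 2 * G else 1) \<le> 1 + 2 * G" .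
  qed (use gam_pos G1 in \<open>auto intro!: prod_nonneg\<close>)
  finally have "cmod (testf_part b v w x) \<le> 8 * gam * ((1 + 8 * gam) ^ j * (1 + 2 * G)) / real L"
    using gam_pos by (simp add: divide_right_mono mult_left_mono)
  also have "\<dots> \<le> 8 * gam * ((1 + 8 * gam) ^ j * (3 * G)) / real L"
    using gam_pos G1 by (intro divide_right_mono mult_left_mono) auto
  finally show ?thesis by (simp add: j_def mult_ac)
qed

end

context lines3 begin

lemma testf_level_eq_sum: "testf_level v w x = (\<Sum>b<L. testf_part b v w x)"
proof -
  define F where "F = (\<lambda>b z s. (fac w v b x z s - 1) * (\<Prod>a<b. fac w v a x z s))"
  have "Psi w s z v x = 1 + (\<Sum>b<L. F b z s)" for s z
    unfolding F_def Psi_def zprod_def fac_def by (rule prod_telescope)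
  then have "testf_level v w x = ((\<Sum>b<L. F b 1 1) - (\<Sum>b<L. F b (-1) 1) - (\<Sum>b<L. F b 1 (-1)) + (\<Sum>b<L. F b (-1) (-1))) / 4"
    by (simp add: testf_level_def)
  also have "\<dots> = (\<Sum>b<L. (F b 1 1 - F b 1 (-1) - F b (-1) 1 + F b (-1) (-1)) / 4)"
    by (simp add: sum_subtractf sum.distrib sum_divide_distrib[symmetric])
  finally show ?thesis by (simp add: testf_part_def F_def)
qed

lemma testf_part_odd1: "b < L \<Longrightarrow> x \<in> A \<Longrightarrow> testf_part b v w (fl1 b x) = - testf_part b v w x"
proof -
  assume b: "b < L" and x: "x \<in> A"
  have 1: "fac w v b (fl1 b x) z s - 1 = - (fac w v b x z s - 1)" for z s
    using x1.odd_atD[OF Th_odd1[OF b, of w s v] x] x1.odd_atD[OF qq_odd1[OF b, of w s v] x]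
    by (simp add: fac_def FF_def)
  have 2: "fac w v a (fl1 b x) z s = fac w v a x z s" if "a < b" for a z s
    using x1.inv_fromD[OF FF_inv1[of a w s v] _ b x] x1.inv_fromD[OF qq_inv1[of a w s v] _ b x] that
    by (simp add: fac_def)
  show ?thesis unfolding testf_part_def Let_def 1 by (simp add: 2 field_simps)
qed

text \<open>The flip of second digit \<open>v\<close> affects only level \<open>v\<close>, hence changes the sign of \<open>z\<close>.\<close>

lemma testf_part_odd2: "v < L \<Longrightarrow> x \<in> A \<Longrightarrow> testf_part b v w (fl2 v x) = - testf_part b v w x"
proof -
  assume v: "v < L" and x: "x \<in> A"
  have P: "PP w s \<iota> v a (fl2 v x) = PP w s \<iota> v a x" for s \<iota> a
    unfolding PP_def
  proof (intro prod.cong refl)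
    fix u assume "u \<in> {..<v}"
    then have "a + u < L \<Longrightarrow> f a u (fl2 v x) = f a u x"
      by (intro x2.inv_fromD[OF f_inv2]) (use v x in auto)
    then show "1 + \<iota> * (of_real (tau * f a u (fl2 v x)) * wt L w s a u) = 1 + \<iota> * (of_real (tau * f a u x) * wt L w s a u)"
      by (auto simp: wt_def)
  qed
  have q: "qq w s v a (fl2 v x) = - qq w s v a x" for s a
  proof (cases "a + v < L")
    case True
    then show ?thesis using x2.odd_atD[OF f_odd2[OF True] x] by (simp add: qq_def Cc_def P)
  qed (simp add: qq_def wt_def)
  have "fac w v a (fl2 v x) z s = fac w v a x (-z) s" for a z s
    by (simp add: fac_def FF_def Th_def P q)
  then show ?thesis by (simp add: testf_part_def field_simps)
qed

text \<open>The flip of third digit \<open>w\<close> changes the sign of the marked terms, hence of \<open>s\<close>.\<close>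

lemma testf_part_odd3: "w < L \<Longrightarrow> x \<in> A \<Longrightarrow> testf_part b v w (fl3 w x) = - testf_part b v w x"
proof -
  assume w: "w < L" and x: "x \<in> A"
  have fw: "of_real (tau * f a u (fl3 w x)) * wt L w s a u = of_real (tau * f a u x) * wt L w (-s) a u" for a u s
  proof -
    consider "Suc (a + u + w) < L \<or> L \<le> a + u" | "a + u < L" "L \<le> a + u + w" | "a + u < L" "Suc (a + u + w) = L" by linarith
    then show ?thesis
    proof cases
      case 2
      then have "f a u (fl3 w x) = f a u x" by (intro x3.inv_fromD[OF f_inv3]) (use w x in auto)
      then show ?thesis using 2 by (simp add: wt_def)
    next
      case 3
      then have "L - 1 - a - u = w" by auto
      then have "f a u (fl3 w x) = - f a u x" using x3.odd_atD[OF f_odd3[OF 3(1)] x] by simp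
      then show ?thesis using 3 by (auto simp: wt_def)
    qed (auto simp: wt_def)
  qed
  have P: "PP w s \<iota> v a (fl3 w x) = PP w (-s) \<iota> v a x" for s \<iota> a
    by (simp only: PP_def fw)
  have q: "qq w s v a (fl3 w x) = qq w (-s) v a x" for s a
  proof -
    have "of_real (rho * f a v (fl3 w x)) * wt L w s a v = of_real gam * (of_real (tau * f a v (fl3 w x)) * wt L w s a v)"
      by (simp add: gam_tau[symmetric])
    also have "\<dots> = of_real (rho * f a v x) * wt L w (-s) a v"
      unfolding fw by (simp add: gam_tau[symmetric])
    finally show ?thesis by (simp add: qq_def Cc_def P)
  qed
  have "fac w v a (fl3 w x) z s = fac w v a x z (-s)" for a z s
    by (simp add: fac_def FF_def Th_def P q)
  then show ?thesis by (simp add: testf_part_def field_simps)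
qed

end

section \<open>The dyadic grid, r-functions and the pairing\<close>

text \<open>Digits of \<open>y < 2\<^sup>L\<close> are counted from the most significant one, so that digit \<open>k\<close> has weight \<open>2 ^ (L - 1 - k)\<close> and \<open>box_index L k y\<close>
  numbers the dyadic interval of length \<open>2 ^ - k\<close> that contains \<open>y / 2\<^sup>L\<close>.\<close>

definition flip_digit :: "nat \<Rightarrow> nat \<Rightarrow> nat \<Rightarrow> nat" where "flip_digit L k y = flip_bit (L - 1 - k) y"
definition rademacher :: "nat \<Rightarrow> nat \<Rightarrow> nat \<Rightarrow> real" where "rademacher L k y = (if bit y (L - 1 - k) then 1 else -1)"
definition box_index :: "nat \<Rightarrow> nat \<Rightarrow> nat \<Rightarrow> nat" where "box_index L k y = y div 2 ^ (L - k)"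

lemma flip_digit_lt: "y < 2 ^ L \<Longrightarrow> k < L \<Longrightarrow> flip_digit L k y < 2 ^ L"
  unfolding flip_digit_def take_bit_nat_eq_self_iff[symmetric] by (auto simp: take_bit_flip_bit_eq)

lemma flip_digit_involution: "flip_digit L k (flip_digit L k y) = y"
  unfolding flip_digit_def by (rule bit_eqI) (auto simp: bit_flip_bit_iff)

lemma rademacher_flip_digit_same: "rademacher L k (flip_digit L k y) = - rademacher L k y"
  by (simp add: rademacher_def flip_digit_def bit_flip_bit_iff)

lemma rademacher_flip_digit_other: "k < L \<Longrightarrow> k' < L \<Longrightarrow> k \<noteq> k' \<Longrightarrow> rademacher L k (flip_digit L k' y) = rademacher L k y"
  by (auto simp: rademacher_def flip_digit_def bit_flip_bit_iff)

lemma rademacher_sq: "rademacher L k y * rademacher L k y = 1" by (simp add: rademacher_def)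
lemma rademacher_abs: "\<bar>rademacher L k y\<bar> = 1" by (simp add: rademacher_def)

lemma box_index_flip_digit: "k \<le> k' \<Longrightarrow> k' < L \<Longrightarrow> box_index L k (flip_digit L k' y) = box_index L k y"
  unfolding box_index_def drop_bit_eq_div[symmetric] flip_digit_def
  by (rule bit_eqI) (auto simp: bit_drop_bit_eq bit_flip_bit_iff)

lemma flip_digit_diff: "real y - real (flip_digit L k y) = rademacher L k y * 2 ^ (L - 1 - k)"
proof -
  define m where "m = L - 1 - k"
  have 1: "flip_bit m z = z + 2 ^ m" if "\<not> bit z m" for z :: nat
    using that by (simp add: flip_bit_eq_if set_bit_eq)
  show ?thesis
  proof (cases "bit y m")
    case True
    have "\<not> bit (flip_bit m y) m" using True by (simp add: bit_flip_bit_iff)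
    from 1[OF this] have "y = flip_bit m y + 2 ^ m" using flip_digit_involution[of L k y] by (simp add: flip_digit_def m_def)
    then have "real y = real (flip_bit m y) + 2 ^ m" by (metis of_nat_add of_nat_numeral of_nat_power)
    then show ?thesis using True by (simp add: rademacher_def flip_digit_def m_def)
  next
    case False
    then show ?thesis using 1[OF False] by (simp add: rademacher_def flip_digit_def m_def)
  qed
qed

text \<open>A flip of digit \<open>k\<close> stays within the interval of level \<open>k\<close>; it can cross the threshold \<open>g\<close> only if \<open>g\<close> lies in that interval.\<close>

lemma below_flip_digit:
  assumes "k < L" "(g < y) \<noteq> (g < flip_digit L k y)"
  shows "box_index L k g = box_index L k y"
proof -
  have e: "box_index L k (flip_digit L k y) = box_index L k y" by (rule box_index_flip_digit) (use assms in auto)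
  consider "y \<le> g" "g \<le> flip_digit L k y" | "flip_digit L k y \<le> g" "g \<le> y" using assms(2) by linarith
  then show ?thesis
  proof cases
    case 1
    then have "box_index L k y \<le> box_index L k g" "box_index L k g \<le> box_index L k (flip_digit L k y)" unfolding box_index_def by (simp_all add: div_le_mono)
    then show ?thesis using e by simp
  next
    case 2
    then have "box_index L k (flip_digit L k y) \<le> box_index L k g" "box_index L k g \<le> box_index L k y" unfolding box_index_def by (simp_all add: div_le_mono)
    then show ?thesis using e by simp
  qed
qed

lemma box_index_lt: "y < 2 ^ L \<Longrightarrow> k \<le> L \<Longrightarrow> box_index L k y < 2 ^ k"
  unfolding box_index_def by (rule less_mult_imp_div_less) (simp flip: power_add)

lemma card_box_index:
  assumes "k \<le> L" "i < 2 ^ k"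
  shows "card {y \<in> {..<2 ^ L}. box_index L k y = i} = 2 ^ (L - k)"
proof -
  \<comment> \<open>The intervals of level \<open>k\<close> consist of \<open>d\<close> consecutive integers.\<close>
  define d :: nat where "d = 2 ^ (L - k)"
  have d0: "0 < d" by (simp add: d_def)
  have dk: "2 ^ k * d = 2 ^ L" using assms by (simp add: d_def flip: power_add)
  have "{y \<in> {..<2 ^ L}. box_index L k y = i} = {i * d..<i * d + d}"
  proof -
    have "(i + 1) * d \<le> 2 ^ k * d" using assms(2) by (intro mult_right_mono) auto
    then have le: "i * d + d \<le> 2 ^ L" using dk by simp
    show ?thesis
    proof (rule set_eqI)
      fix y
      have b: "box_index L k y = y div d" by (simp add: box_index_def d_def)
      have "i * d \<le> y \<and> y < i * d + d" if "y div d = i"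
      proof -
        have "y = i * d + y mod d" using div_mult_mod_eq[of y d] that by simp
        moreover have "y mod d < d" using d0 by simp
        ultimately show ?thesis by linarith
      qed
      moreover have "y div d = i" if "i * d \<le> y" "y < i * d + d"
        by (rule div_nat_eqI) (use that in \<open>simp_all add: mult.commute\<close>)
      ultimately show "y \<in> {y \<in> {..<2 ^ L}. box_index L k y = i} \<longleftrightarrow> y \<in> {i * d..<i * d + d}"
        unfolding mem_Collect_eq lessThan_iff atLeastLessThan_iff b using le by linarith
    qed
  qed
  then show ?thesis by (simp add: d_def)
qed

definition grid1 :: "nat \<Rightarrow> nat set" where "grid1 L = {..<2 ^ L}"
definition grid3 :: "nat \<Rightarrow> (nat \<times> nat \<times> nat) set" where "grid3 L = grid1 L \<times> grid1 L \<times> grid1 L"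

lemma grid1_fin: "finite (grid1 L)" "grid1 L \<noteq> {}" and card_grid1: "card (grid1 L) = 2 ^ L"
  by (auto simp: grid1_def lessThan_empty_iff)

lemma grid3_fin: "finite (grid3 L)" "grid3 L \<noteq> {}" using grid1_fin by (auto simp: grid3_def)

lemma avg_grid3_prod:
  "avg (grid3 L) (\<lambda>(x, y, z). d1 x * d2 y * d3 z) = avg (grid1 L) d1 * avg (grid1 L) d2 * avg (grid1 L) d3"
proof -
  have "(\<Sum>(x, y, z)\<in>grid3 L. d1 x * d2 y * d3 z) = (\<Sum>x\<in>grid1 L. \<Sum>y\<in>grid1 L. \<Sum>z\<in>grid1 L. d1 x * (d2 y * d3 z))"
    unfolding grid3_def by (simp add: sum.cartesian_product mult.assoc)
  also have "\<dots> = (\<Sum>x\<in>grid1 L. d1 x) * ((\<Sum>y\<in>grid1 L. d2 y) * (\<Sum>z\<in>grid1 L. d3 z))"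
    unfolding sum_product by (simp add: sum_distrib_left)
  finally show ?thesis by (simp add: avg_def grid3_def card_cartesian_product)
qed

definition fl1 :: "nat \<Rightarrow> nat \<Rightarrow> nat \<times> nat \<times> nat \<Rightarrow> nat \<times> nat \<times> nat" where "fl1 L k = (\<lambda>(x, y, z). (flip_digit L k x, y, z))"
definition fl2 :: "nat \<Rightarrow> nat \<Rightarrow> nat \<times> nat \<times> nat \<Rightarrow> nat \<times> nat \<times> nat" where "fl2 L k = (\<lambda>(x, y, z). (x, flip_digit L k y, z))"
definition fl3 :: "nat \<Rightarrow> nat \<Rightarrow> nat \<times> nat \<times> nat \<Rightarrow> nat \<times> nat \<times> nat" where "fl3 L k = (\<lambda>(x, y, z). (x, y, flip_digit L k z))"

lemma fl_bij:
  assumes "k < L"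
  shows "bij_betw (fl1 L k) (grid3 L) (grid3 L)" "bij_betw (fl2 L k) (grid3 L) (grid3 L)" "bij_betw (fl3 L k) (grid3 L) (grid3 L)"
proof -
  show "bij_betw (fl1 L k) (grid3 L) (grid3 L)"
    by (rule bij_betw_byWitness[where f' = "fl1 L k"]) (auto simp: fl1_def flip_digit_involution grid3_def grid1_def flip_digit_lt assms)
  show "bij_betw (fl2 L k) (grid3 L) (grid3 L)"
    by (rule bij_betw_byWitness[where f' = "fl2 L k"]) (auto simp: fl2_def flip_digit_involution grid3_def grid1_def flip_digit_lt assms)
  show "bij_betw (fl3 L k) (grid3 L) (grid3 L)"
    by (rule bij_betw_byWitness[where f' = "fl3 L k"]) (auto simp: fl3_def flip_digit_involution grid3_def grid1_def flip_digit_lt assms)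
qed

lemma avg_odd_half:
  assumes "bij_betw \<phi> A A" "\<And>x. x \<in> A \<Longrightarrow> h (\<phi> x) = - h x"
  shows "avg A (\<lambda>x. u x * h x) = avg A (\<lambda>x. (u x - u (\<phi> x)) / 2 * h x)"
proof -
  have "avg A (\<lambda>x. u x * h x) = (avg A (\<lambda>x. u x * h x) + avg A (\<lambda>x. u (\<phi> x) * h (\<phi> x))) * (1/2)"
    using avg_flip[OF assms(1), of "\<lambda>x. u x * h x"] by simp
  also have "\<dots> = avg A (\<lambda>x. (u x * h x + u (\<phi> x) * h (\<phi> x)) * (1/2))"
    by (simp only: avg_add avg_cmult_right)
  also have "\<dots> = avg A (\<lambda>x. (u x - u (\<phi> x)) / 2 * h x)"
    by (intro avg_cong) (simp add: assms(2) field_simps)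
  finally show ?thesis .
qed

definition hdiff :: "nat \<Rightarrow> nat \<Rightarrow> (nat \<Rightarrow> real) \<Rightarrow> nat \<Rightarrow> real" where
  "hdiff L k d y = (d y - d (flip_digit L k y)) / 2"

text \<open>Against a function odd in one digit of each coordinate, a tensor product may be replaced by its half differences.\<close>

lemma avg_prod_odd:
  assumes k: "k1 < L" "k2 < L" "k3 < L"
    and h: "\<And>x. x \<in> grid3 L \<Longrightarrow> h (fl1 L k1 x) = - h x"
    "\<And>x. x \<in> grid3 L \<Longrightarrow> h (fl2 L k2 x) = - h x" "\<And>x. x \<in> grid3 L \<Longrightarrow> h (fl3 L k3 x) = - h x"
  shows "avg (grid3 L) (\<lambda>(x, y, z). d1 x * d2 y * d3 z * h (x, y, z))
    = avg (grid3 L) (\<lambda>(x, y, z). hdiff L k1 d1 x * hdiff L k2 d2 y * hdiff L k3 d3 z * h (x, y, z))"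
proof -
  have "avg (grid3 L) (\<lambda>(x, y, z). d1 x * d2 y * d3 z * h (x, y, z))
     = avg (grid3 L) (\<lambda>q. (case q of (x, y, z) \<Rightarrow> d1 x * d2 y * d3 z) * h q)"
    by (intro avg_cong) auto
  also have "\<dots> = avg (grid3 L) (\<lambda>q. (case q of (x, y, z) \<Rightarrow> hdiff L k1 d1 x * d2 y * d3 z) * h q)"
    by (rule trans[OF avg_odd_half[where h = h and u = "\<lambda>q. case q of (x, y, z) \<Rightarrow> d1 x * d2 y * d3 z", OF fl_bij(1)[OF k(1)] h(1)]])
       (assumption | (intro avg_cong, clarsimp simp: fl1_def hdiff_def[of L k1] field_simps))+
  also have "\<dots> = avg (grid3 L) (\<lambda>q. (case q of (x, y, z) \<Rightarrow> hdiff L k1 d1 x * hdiff L k2 d2 y * d3 z) * h q)"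
    by (rule trans[OF avg_odd_half[where h = h and u = "\<lambda>q. case q of (x, y, z) \<Rightarrow> hdiff L k1 d1 x * d2 y * d3 z", OF fl_bij(2)[OF k(2)] h(2)]])
       (assumption | (intro avg_cong, clarsimp simp: fl2_def hdiff_def[of L k2] field_simps))+
  also have "\<dots> = avg (grid3 L) (\<lambda>q. (case q of (x, y, z) \<Rightarrow> hdiff L k1 d1 x * hdiff L k2 d2 y * hdiff L k3 d3 z) * h q)"
    by (rule trans[OF avg_odd_half[where h = h and u = "\<lambda>q. case q of (x, y, z) \<Rightarrow> hdiff L k1 d1 x * hdiff L k2 d2 y * d3 z", OF fl_bij(3)[OF k(3)] h(3)]])
       (assumption | (intro avg_cong, clarsimp simp: fl3_def hdiff_def[of L k3] field_simps))+
  finally show ?thesis by (simp add: case_prod_beta')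
qed

definition coord :: "nat \<Rightarrow> nat \<Rightarrow> real" where "coord L y = real y / 2 ^ L"
definition below :: "nat \<Rightarrow> nat \<Rightarrow> real" where "below g y = of_bool (g < y)"

lemma hdiff_coord: "k < L \<Longrightarrow> hdiff L k (coord L) y = rademacher L k y / 2 ^ (k + 2)"
proof -
  assume k: "k < L"
  have e: "(L - 1 - k) + (k + 1) = L" using k by simp
  have "(2::real) ^ L = 2 ^ (L - 1 - k) * 2 ^ (k + 1)"
    using power_add[of "2::real" "L - 1 - k" "k + 1"] unfolding e .
  then show ?thesis
    unfolding hdiff_def coord_def diff_divide_distrib[symmetric] flip_digit_diff by (simp add: field_simps)
qed

lemma hdiff_below: "k < L \<Longrightarrow> \<bar>hdiff L k (below g) y\<bar> \<le> of_bool (box_index L k y = box_index L k g) / 2"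
  using below_flip_digit[of k L g y] by (auto simp: hdiff_def below_def of_bool_def)

lemma avg_box_index:
  assumes "k \<le> L" "i < 2 ^ k"
  shows "avg (grid1 L) (\<lambda>y. of_bool (box_index L k y = i)) = 1 / 2 ^ k"
proof -
  have "(\<Sum>y\<in>grid1 L. of_bool (box_index L k y = i)) = real (card {y \<in> {..<2 ^ L}. box_index L k y = i})"
    by (simp add: grid1_def of_bool_def sum.If_cases Int_def)
  also have "\<dots> = 2 ^ (L - k)" unfolding card_box_index[OF assms] by simp
  finally show ?thesis using assms(1) by (simp add: avg_def card_grid1 power_diff)
qed

lemma avg_box_index_le: "k \<le> L \<Longrightarrow> avg (grid1 L) (\<lambda>y. of_bool (box_index L k y = i)) \<le> 1 / 2 ^ k"
proof (cases "i < 2 ^ k")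
  case False
  assume k: "k \<le> L"
  have "avg (grid1 L) (\<lambda>y. of_bool (box_index L k y = i)) = avg (grid1 L) (\<lambda>y. 0)"
    using box_index_lt[OF _ k] False by (intro avg_cong) (auto simp: grid1_def)
  also have "\<dots> = 0" by (simp add: avg_def)
  finally show ?thesis by simp
qed (simp add: avg_box_index)

text \<open>The discrepancy at the grid point \<open>(x, y, z) / 2\<^sup>L\<close>, for points given by the indices of the grid cells that contain them: a coordinate in cell \<open>g\<close> is
  smaller than \<open>y / 2\<^sup>L\<close> exactly if \<open>g < y\<close>.\<close>

definition grid_disc :: "nat \<Rightarrow> 'p set \<Rightarrow> ('p \<Rightarrow> nat) \<Rightarrow> ('p \<Rightarrow> nat) \<Rightarrow> ('p \<Rightarrow> nat) \<Rightarrow> nat \<times> nat \<times> nat \<Rightarrow> real" where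
  "grid_disc L P g1 g2 g3 = (\<lambda>(x, y, z). real (card P) * (coord L x * coord L y * coord L z)
     - (\<Sum>p\<in>P. below (g1 p) x * below (g2 p) y * below (g3 p) z))"

lemma avg_grid_disc:
  assumes k: "k1 < L" "k2 < L" "k3 < L"
    and h: "\<And>x. x \<in> grid3 L \<Longrightarrow> h (fl1 L k1 x) = - h x"
    "\<And>x. x \<in> grid3 L \<Longrightarrow> h (fl2 L k2 x) = - h x" "\<And>x. x \<in> grid3 L \<Longrightarrow> h (fl3 L k3 x) = - h x"
  shows "avg (grid3 L) (\<lambda>q. grid_disc L P g1 g2 g3 q * h q)
    = real (card P) * avg (grid3 L) (\<lambda>(x, y, z). hdiff L k1 (coord L) x * hdiff L k2 (coord L) y * hdiff L k3 (coord L) z * h (x, y, z))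
     - (\<Sum>p\<in>P. avg (grid3 L) (\<lambda>(x, y, z). hdiff L k1 (below (g1 p)) x * hdiff L k2 (below (g2 p)) y * hdiff L k3 (below (g3 p)) z * h (x, y, z)))"
proof -
  define u where "u = (\<lambda>(x, y, z). coord L x * coord L y * coord L z * h (x, y, z))"
  define v where "v = (\<lambda>p (x, y, z). below (g1 p) x * below (g2 p) y * below (g3 p) z * h (x, y, z))"
  have "avg (grid3 L) (\<lambda>q. grid_disc L P g1 g2 g3 q * h q) = avg (grid3 L) (\<lambda>q. real (card P) * u q - (\<Sum>p\<in>P. v p q))"
    by (intro avg_cong) (auto simp: grid_disc_def u_def v_def left_diff_distrib sum_distrib_right mult.assoc)
  also have "\<dots> = real (card P) * avg (grid3 L) u - (\<Sum>p\<in>P. avg (grid3 L) (v p))"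
    by (simp only: avg_diff avg_cmult avg_sum)
  also have "avg (grid3 L) u = avg (grid3 L) (\<lambda>(x, y, z). hdiff L k1 (coord L) x * hdiff L k2 (coord L) y * hdiff L k3 (coord L) z * h (x, y, z))"
    unfolding u_def by (rule avg_prod_odd[where h = h, OF k h])
  also have "(\<Sum>p\<in>P. avg (grid3 L) (v p)) = (\<Sum>p\<in>P. avg (grid3 L) (\<lambda>(x, y, z). hdiff L k1 (below (g1 p)) x * hdiff L k2 (below (g2 p)) y * hdiff L k3 (below (g3 p)) z * h (x, y, z)))"
    unfolding v_def by (intro sum.cong refl avg_prod_odd[where h = h, OF k h])
  finally show ?thesis .
qed

text \<open>Half differences of the linear part have size \<open>2 ^ - k\<close>, and those of an indicator are supported on a single interval of length \<open>2 ^ - k\<close>.  In each of the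
  three coordinates either fact gives a factor \<open>2 ^ - k\<close>.\<close>

lemma avg_grid_disc_le:
  assumes k: "k1 < L" "k2 < L" "k3 < L"
    and h: "\<And>x. x \<in> grid3 L \<Longrightarrow> h (fl1 L k1 x) = - h x"
    "\<And>x. x \<in> grid3 L \<Longrightarrow> h (fl2 L k2 x) = - h x" "\<And>x. x \<in> grid3 L \<Longrightarrow> h (fl3 L k3 x) = - h x"
    and H: "\<And>x. x \<in> grid3 L \<Longrightarrow> \<bar>h x\<bar> \<le> H"
  shows "\<bar>avg (grid3 L) (\<lambda>q. grid_disc L P g1 g2 g3 q * h q)\<bar> \<le> real (card P) * H / 2 ^ (k1 + k2 + k3)"
proof -
  have H0: "0 \<le> H" using H grid3_fin(2) by force
  have abs_avg: "\<bar>avg A u\<bar> \<le> avg A (\<lambda>x. \<bar>u x\<bar>)" for A :: "(nat \<times> nat \<times> nat) set" and u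
    unfolding avg_def by (simp add: divide_right_mono sum_abs)
  have gen: "\<bar>avg (grid3 L) (\<lambda>(x, y, z). e1 x * e2 y * e3 z * h (x, y, z))\<bar>
      \<le> H * (avg (grid1 L) (\<lambda>x. b1 x) * avg (grid1 L) (\<lambda>x. b2 x) * avg (grid1 L) (\<lambda>x. b3 x))"
    if e: "\<And>x. \<bar>e1 x\<bar> \<le> b1 x" "\<And>x. \<bar>e2 x\<bar> \<le> b2 x" "\<And>x. \<bar>e3 x\<bar> \<le> b3 x" for e1 e2 e3 b1 b2 b3 :: "nat \<Rightarrow> real"
  proof -
    have "\<bar>avg (grid3 L) (\<lambda>(x, y, z). e1 x * e2 y * e3 z * h (x, y, z))\<bar> \<le> avg (grid3 L) (\<lambda>q. \<bar>case q of (x, y, z) \<Rightarrow> e1 x * e2 y * e3 z * h (x, y, z)\<bar>)"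
      by (rule abs_avg)
    also have "\<dots> \<le> avg (grid3 L) (\<lambda>q. H * (case q of (x, y, z) \<Rightarrow> b1 x * b2 y * b3 z))"
    proof (rule avg_mono)
      fix q assume q: "q \<in> grid3 L"
      obtain x y z where xyz: "q = (x, y, z)" by (cases q)
      have "\<bar>e1 x\<bar> * \<bar>e2 y\<bar> * \<bar>e3 z\<bar> * \<bar>h q\<bar> \<le> b1 x * b2 y * b3 z * H"
        using e H[OF q] by (intro mult_mono mult_nonneg_nonneg) (auto intro: order_trans[OF abs_ge_zero])
      then show "\<bar>case q of (x, y, z) \<Rightarrow> e1 x * e2 y * e3 z * h (x, y, z)\<bar> \<le> H * (case q of (x, y, z) \<Rightarrow> b1 x * b2 y * b3 z)"
        by (simp add: xyz abs_mult mult_ac)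
    qed
    finally show ?thesis by (simp only: avg_cmult avg_grid3_prod)
  qed
  define s where "s = k1 + k2 + k3"
  have c: "avg (grid1 L) (\<lambda>x. 1 / 2 ^ (k + 2)) = 1 / 2 ^ (k + 2)" for k by (rule avg_const[OF grid1_fin])
  have l1: "\<bar>avg (grid3 L) (\<lambda>(x, y, z). hdiff L k1 (coord L) x * hdiff L k2 (coord L) y * hdiff L k3 (coord L) z * h (x, y, z))\<bar> \<le> H / (64 * 2 ^ s)"
    using gen[of "hdiff L k1 (coord L)" "\<lambda>_. 1 / 2 ^ (k1 + 2)" "hdiff L k2 (coord L)" "\<lambda>_. 1 / 2 ^ (k2 + 2)" "hdiff L k3 (coord L)" "\<lambda>_. 1 / 2 ^ (k3 + 2)"]
    unfolding c by (simp add: hdiff_coord k rademacher_abs s_def power_add)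
  have i0: "avg (grid1 L) (\<lambda>y. of_bool (box_index L k y = box_index L k g) / 2) \<le> 1 / 2 ^ (k + 1)" if "k < L" for k g
    using avg_box_index_le[of k L "box_index L k g"] avg_cmult_right[of "grid1 L" "\<lambda>y. of_bool (box_index L k y = box_index L k g)" "1/2"] that by simp
  have i1: "\<bar>avg (grid3 L) (\<lambda>(x, y, z). hdiff L k1 (below g) x * hdiff L k2 (below g') y * hdiff L k3 (below g'') z * h (x, y, z))\<bar> \<le> H / (8 * 2 ^ s)" for g g' g''
  proof -
    have "\<bar>avg (grid3 L) (\<lambda>(x, y, z). hdiff L k1 (below g) x * hdiff L k2 (below g') y * hdiff L k3 (below g'') z * h (x, y, z))\<bar>
      \<le> H * (avg (grid1 L) (\<lambda>y. of_bool (box_index L k1 y = box_index L k1 g) / 2) * avg (grid1 L) (\<lambda>y. of_bool (box_index L k2 y = box_index L k2 g') / 2) * avg (grid1 L) (\<lambda>y. of_bool (box_index L k3 y = box_index L k3 g'') / 2))"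
      by (intro gen hdiff_below k)
    also have "\<dots> \<le> H * (1 / 2 ^ (k1 + 1) * (1 / 2 ^ (k2 + 1)) * (1 / 2 ^ (k3 + 1)))"
      using H0 by (intro mult_left_mono mult_mono i0 k mult_nonneg_nonneg avg_nonneg) auto
    finally show ?thesis by (simp add: s_def power_add)
  qed
  define X where "X = avg (grid3 L) (\<lambda>(x, y, z). hdiff L k1 (coord L) x * hdiff L k2 (coord L) y * hdiff L k3 (coord L) z * h (x, y, z))"
  define Y where "Y = (\<lambda>p. avg (grid3 L) (\<lambda>(x, y, z). hdiff L k1 (below (g1 p)) x * hdiff L k2 (below (g2 p)) y * hdiff L k3 (below (g3 p)) z * h (x, y, z)))"
  have "avg (grid3 L) (\<lambda>q. grid_disc L P g1 g2 g3 q * h q) = real (card P) * X - (\<Sum>p\<in>P. Y p)"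
    unfolding X_def Y_def by (rule avg_grid_disc[where h = h, OF k h])
  also have "\<bar>real (card P) * X - (\<Sum>p\<in>P. Y p)\<bar> \<le> real (card P) * \<bar>X\<bar> + (\<Sum>p\<in>P. \<bar>Y p\<bar>)"
  proof -
    have "\<bar>real (card P) * X - (\<Sum>p\<in>P. Y p)\<bar> \<le> \<bar>real (card P) * X\<bar> + \<bar>\<Sum>p\<in>P. Y p\<bar>" by (rule abs_triangle_ineq4)
    moreover have "\<bar>real (card P) * X\<bar> = real (card P) * \<bar>X\<bar>" by (simp add: abs_mult)
    ultimately show ?thesis using sum_abs[of Y P] by linarith
  qed
  also have "\<dots> \<le> real (card P) * (H / (64 * 2 ^ s)) + (\<Sum>p\<in>P. H / (8 * 2 ^ s))"
    using l1 i1 unfolding X_def Y_def by (intro add_mono mult_left_mono sum_mono) auto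
  also have "\<dots> = (real (card P) * H / 2 ^ s) * (1/64 + 1/8)" by (simp add: field_simps)
  also have "\<dots> \<le> (real (card P) * H / 2 ^ s) * 1" using H0 by (intro mult_left_mono) auto
  finally show ?thesis by (simp add: s_def)
qed

definition box_haar :: "nat \<Rightarrow> nat \<Rightarrow> nat \<Rightarrow> nat \<Rightarrow> nat \<times> nat \<times> nat \<Rightarrow> nat \<times> nat \<times> nat \<Rightarrow> real" where
  "box_haar L a u c R = (\<lambda>(x, y, z). of_bool ((box_index L a x, box_index L u y, box_index L c z) = R) * (rademacher L a x * rademacher L u y * rademacher L c z))"

definition haar_coeff :: "nat \<Rightarrow> (nat \<times> nat \<times> nat \<Rightarrow> real) \<Rightarrow> nat \<Rightarrow> nat \<Rightarrow> nat \<Rightarrow> nat \<times> nat \<times> nat \<Rightarrow> real" where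
  "haar_coeff L D a u c R = avg (grid3 L) (\<lambda>q. D q * box_haar L a u c R q)"

definition haar_sign :: "nat \<Rightarrow> (nat \<times> nat \<times> nat \<Rightarrow> real) \<Rightarrow> nat \<Rightarrow> nat \<Rightarrow> nat \<Rightarrow> nat \<times> nat \<times> nat \<Rightarrow> real" where
  "haar_sign L D a u c R = (if 0 \<le> haar_coeff L D a u c R then 1 else -1)"

definition rfun :: "nat \<Rightarrow> (nat \<times> nat \<times> nat \<Rightarrow> real) \<Rightarrow> nat \<Rightarrow> nat \<Rightarrow> nat \<times> nat \<times> nat \<Rightarrow> real" where
  "rfun L D a u = (\<lambda>(x, y, z). haar_sign L D a u (L - 1 - a - u) (box_index L a x, box_index L u y, box_index L (L - 1 - a - u) z)
     * (rademacher L a x * rademacher L u y * rademacher L (L - 1 - a - u) z))"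

lemma avg_rfun:
  assumes au: "a + u < L"
  shows "avg (grid3 L) (\<lambda>q. D q * rfun L D a u q) = (\<Sum>R\<in>{..<2^a} \<times> {..<2^u} \<times> {..<2^(L - 1 - a - u)}. \<bar>haar_coeff L D a u (L - 1 - a - u) R\<bar>)"
proof -
  define c where "c = L - 1 - a - u"
  define Bx :: "(nat \<times> nat \<times> nat) set" where "Bx = {..<2^a} \<times> {..<2^u} \<times> {..<2^c}"
  have finB: "finite Bx" by (simp add: Bx_def)
  have "rfun L D a u q = (\<Sum>R\<in>Bx. haar_sign L D a u c R * box_haar L a u c R q)" if q: "q \<in> grid3 L" for q
  proof -
    obtain x y z where xyz: "q = (x, y, z)" by (cases q)
    define R0 where "R0 = (box_index L a x, box_index L u y, box_index L c z)"
    have R0: "R0 \<in> Bx" using q au by (auto simp: R0_def Bx_def grid3_def grid1_def xyz c_def intro!: box_index_lt)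
    have "(\<Sum>R\<in>Bx. haar_sign L D a u c R * box_haar L a u c R q) = (\<Sum>R\<in>Bx. if R = R0 then haar_sign L D a u c R0 * (rademacher L a x * rademacher L u y * rademacher L c z) else 0)"
      by (intro sum.cong refl) (auto simp: box_haar_def xyz R0_def)
    also have "\<dots> = haar_sign L D a u c R0 * (rademacher L a x * rademacher L u y * rademacher L c z)" using R0 finB by simp
    finally show ?thesis by (simp add: rfun_def xyz R0_def c_def)
  qed
  then have "avg (grid3 L) (\<lambda>q. D q * rfun L D a u q) = avg (grid3 L) (\<lambda>q. \<Sum>R\<in>Bx. haar_sign L D a u c R * (D q * box_haar L a u c R q))"
    by (intro avg_cong) (simp add: sum_distrib_left mult_ac)
  also have "\<dots> = (\<Sum>R\<in>Bx. haar_sign L D a u c R * haar_coeff L D a u c R)"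
    by (simp only: avg_sum avg_cmult haar_coeff_def)
  also have "\<dots> = (\<Sum>R\<in>Bx. \<bar>haar_coeff L D a u c R\<bar>)"
    by (intro sum.cong refl) (simp add: haar_sign_def)
  finally show ?thesis by (simp add: Bx_def c_def)
qed

text \<open>In a box without points the half differences of all indicators vanish, and only the volume is left.\<close>

lemma haar_coeff_empty:
  assumes k: "a < L" "u < L" "c < L"
    and R: "R \<in> {..<2^a} \<times> {..<2^u} \<times> {..<2^c}"
    and empty: "\<And>p. p \<in> P \<Longrightarrow> (box_index L a (g1 p), box_index L u (g2 p), box_index L c (g3 p)) \<noteq> R"
  shows "haar_coeff L (grid_disc L P g1 g2 g3) a u c R = real (card P) / (64 * (2 ^ (a + u + c))\<^sup>2)"
proof -
  obtain i j l where R': "R = (i, j, l)" by (cases R)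
  have ijl: "i < 2 ^ a" "j < 2 ^ u" "l < 2 ^ c" using R by (auto simp: R')
  have h: "box_haar L a u c R (fl1 L a q) = - box_haar L a u c R q" "box_haar L a u c R (fl2 L u q) = - box_haar L a u c R q"
    "box_haar L a u c R (fl3 L c q) = - box_haar L a u c R q" for q
    using k by (cases q; simp add: box_haar_def fl1_def fl2_def fl3_def box_index_flip_digit rademacher_flip_digit_same)+
  have "avg (grid3 L) (\<lambda>(x, y, z). hdiff L a (coord L) x * hdiff L u (coord L) y * hdiff L c (coord L) z * box_haar L a u c R (x, y, z))
    = avg (grid3 L) (\<lambda>q. 1 / (64 * 2 ^ (a + u + c)) * (case q of (x, y, z) \<Rightarrow> of_bool (box_index L a x = i) * of_bool (box_index L u y = j) * of_bool (box_index L c z = l)))"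
  proof (rule avg_cong)
    fix q assume "q \<in> grid3 L"
    obtain x y z where xyz: "q = (x, y, z)" by (cases q)
    have "rademacher L a x * rademacher L u y * rademacher L c z * (rademacher L a x * rademacher L u y * rademacher L c z) = 1"
      using rademacher_sq[of L a x] rademacher_sq[of L u y] rademacher_sq[of L c z] by (simp add: mult_ac)
    then show "(case q of (x, y, z) \<Rightarrow> hdiff L a (coord L) x * hdiff L u (coord L) y * hdiff L c (coord L) z * box_haar L a u c R (x, y, z))
      = 1 / (64 * 2 ^ (a + u + c)) * (case q of (x, y, z) \<Rightarrow> of_bool (box_index L a x = i) * of_bool (box_index L u y = j) * of_bool (box_index L c z = l))"
      by (auto simp: xyz hdiff_coord k box_haar_def R' power_add)
  qed
  also have "\<dots> = 1 / (64 * 2 ^ (a + u + c)) * (1 / 2 ^ a * (1 / 2 ^ u) * (1 / 2 ^ c))"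
    using k ijl by (simp only: avg_cmult avg_grid3_prod avg_box_index less_imp_le)
  finally have 1: "avg (grid3 L) (\<lambda>(x, y, z). hdiff L a (coord L) x * hdiff L u (coord L) y * hdiff L c (coord L) z * box_haar L a u c R (x, y, z))
    = 1 / (64 * (2 ^ (a + u + c))\<^sup>2)" by (simp add: power_add power2_eq_square)
  have 2: "avg (grid3 L) (\<lambda>(x, y, z). hdiff L a (below (g1 p)) x * hdiff L u (below (g2 p)) y * hdiff L c (below (g3 p)) z * box_haar L a u c R (x, y, z)) = 0"
    if p: "p \<in> P" for p
  proof -
    have "hdiff L a (below (g1 p)) x * hdiff L u (below (g2 p)) y * hdiff L c (below (g3 p)) z * box_haar L a u c R (x, y, z) = 0" for x y z
    proof (rule ccontr)
      assume "\<not> ?thesis"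
      then have n: "hdiff L a (below (g1 p)) x \<noteq> 0" "hdiff L u (below (g2 p)) y \<noteq> 0" "hdiff L c (below (g3 p)) z \<noteq> 0" "box_haar L a u c R (x, y, z) \<noteq> 0" by auto
      have "box_index L a x = box_index L a (g1 p)" "box_index L u y = box_index L u (g2 p)" "box_index L c z = box_index L c (g3 p)"
        using hdiff_below[OF k(1), of "g1 p" x] hdiff_below[OF k(2), of "g2 p" y] hdiff_below[OF k(3), of "g3 p" z] n by (auto split: if_splits simp: of_bool_def)
      then show False using empty[OF p] n(4) by (auto simp: box_haar_def)
    qed
    then have "avg (grid3 L) (\<lambda>(x, y, z). hdiff L a (below (g1 p)) x * hdiff L u (below (g2 p)) y * hdiff L c (below (g3 p)) z * box_haar L a u c R (x, y, z)) = avg (grid3 L) (\<lambda>q. 0)"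
      by (intro avg_cong) auto
    then show ?thesis by (simp add: avg_def)
  qed
  show ?thesis
    unfolding haar_coeff_def using h by (subst avg_grid_disc[OF k]) (simp_all add: 1 2)
qed

text \<open>There are \<open>2 ^ (L - 1) \<ge> 2 N\<close> boxes, so at least half of them contain no point.  Each of those has Haar coefficient \<open>N / (64 * 4 ^ (L - 1))\<close>, and the
  signs of the r-function make all other coefficients count nonnegatively.\<close>

lemma avg_rfun_ge:
  assumes P: "finite P" and N: "2 * card P \<le> 2 ^ (L - 1)" "2 ^ (L - 1) \<le> 4 * card P" and au: "a + u < L"
  shows "1 / 512 \<le> avg (grid3 L) (\<lambda>q. grid_disc L P g1 g2 g3 q * rfun L (grid_disc L P g1 g2 g3) a u q)"
proof -
  define c where "c = L - 1 - a - u"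
  have s: "a + u + c = L - 1" using au by (simp add: c_def)
  define Bx :: "(nat \<times> nat \<times> nat) set" where "Bx = {..<2^a} \<times> {..<2^u} \<times> {..<2^c}"
  define Oc where "Oc = (\<lambda>p. (box_index L a (g1 p), box_index L u (g2 p), box_index L c (g3 p))) ` P"
  define M :: real where "M = 2 ^ (L - 1)"
  have M0: "0 < M" by (simp add: M_def)
  have finB: "finite Bx" by (simp add: Bx_def)
  have cB: "card Bx = 2 ^ (L - 1)"
    unfolding s[symmetric] by (simp add: Bx_def card_cartesian_product power_add)
  have "card Oc \<le> card P" unfolding Oc_def by (rule card_image_le[OF P])
  moreover have "card Bx - card Oc \<le> card (Bx - Oc)" using P by (intro diff_card_le_card_Diff) (auto simp: Oc_def)
  ultimately have "2 ^ (L - 1) \<le> 2 * card (Bx - Oc)" using N(1) cB by linarith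
  then have "real (2 ^ (L - 1)) \<le> real (2 * card (Bx - Oc))" by (rule of_nat_mono)
  then have "M \<le> 2 * real (card (Bx - Oc))" by (simp add: M_def)
  moreover have "real (2 ^ (L - 1)) \<le> real (4 * card P)" using N(2) by (rule of_nat_mono)
  then have "M \<le> 4 * real (card P)" by (simp add: M_def)
  ultimately have cN: "M / 2 \<le> real (card (Bx - Oc))" "M / 4 \<le> real (card P)" by linarith+
  have "1 / 512 = (M / 2) * ((M / 4) / (64 * M\<^sup>2))" using M0 by (simp add: power2_eq_square)
  also have "\<dots> \<le> real (card (Bx - Oc)) * (real (card P) / (64 * M\<^sup>2))"
    using cN M0 by (intro mult_mono divide_right_mono) auto
  also have "\<dots> = (\<Sum>R\<in>Bx - Oc. \<bar>haar_coeff L (grid_disc L P g1 g2 g3) a u c R\<bar>)"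
  proof -
    have "\<bar>haar_coeff L (grid_disc L P g1 g2 g3) a u c R\<bar> = real (card P) / (64 * M\<^sup>2)" if R: "R \<in> Bx - Oc" for R
    proof -
      have "haar_coeff L (grid_disc L P g1 g2 g3) a u c R = real (card P) / (64 * (2 ^ (a + u + c))\<^sup>2)"
      proof (rule haar_coeff_empty)
        show "a < L" "u < L" "c < L" using s au by linarith+
        show "R \<in> {..<2^a} \<times> {..<2^u} \<times> {..<2^c}" using R unfolding Bx_def by blast
        show "(box_index L a (g1 p), box_index L u (g2 p), box_index L c (g3 p)) \<noteq> R" if "p \<in> P" for p
          using R that unfolding Oc_def by blast
      qed
      moreover have "0 \<le> real (card P) / (64 * (2 ^ (a + u + c))\<^sup>2)" by simp
      ultimately show ?thesis unfolding M_def s[symmetric] by (simp only: abs_of_nonneg)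
    qed
    then show ?thesis by simp
  qed
  also have "\<dots> \<le> (\<Sum>R\<in>Bx. \<bar>haar_coeff L (grid_disc L P g1 g2 g3) a u c R\<bar>)"
    using finB by (intro sum_mono2) auto
  also have "\<dots> = avg (grid3 L) (\<lambda>q. grid_disc L P g1 g2 g3 q * rfun L (grid_disc L P g1 g2 g3) a u q)"
    unfolding avg_rfun[OF au] Bx_def c_def ..
  finally show ?thesis .
qed

lemma lines3_rfun:
  assumes "1 \<le> G" "0 < L"
  shows "lines3 (grid3 L) (fl1 L) (fl2 L) (fl3 L) L (rfun L D) G"
proof -
  interpret x1: digits "grid3 L" "fl1 L" L by unfold_locales (auto simp: grid3_fin fl_bij)
  interpret x2: digits "grid3 L" "fl2 L" L by unfold_locales (auto simp: grid3_fin fl_bij)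
  interpret x3: digits "grid3 L" "fl3 L" L by unfold_locales (auto simp: grid3_fin fl_bij)
  show ?thesis
  proof
    fix a u assume au: "a + u < L"
    define c where "c = L - 1 - a - u"
    have c: "a < L" "u < L" "c < L" "L - a - u = Suc c" using au by (auto simp: c_def)
    have r: "rfun L D a u (x, y, z) = haar_sign L D a u c (box_index L a x, box_index L u y, box_index L c z) * (rademacher L a x * rademacher L u y * rademacher L c z)" for x y z
      by (simp add: rfun_def c_def)
    show "\<bar>rfun L D a u x\<bar> = 1" if "x \<in> grid3 L" for x
      by (cases x) (simp add: r abs_mult rademacher_abs haar_sign_def)
    show "x1.inv_from (Suc a) (rfun L D a u)"
      using c by (auto simp: x1.inv_from_def fl1_def r box_index_flip_digit rademacher_flip_digit_other)
    show "x1.odd_at a (rfun L D a u)"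
      using c by (auto simp: x1.odd_at_def fl1_def r box_index_flip_digit rademacher_flip_digit_same)
    show "x2.inv_from (Suc u) (rfun L D a u)"
      using c by (auto simp: x2.inv_from_def fl2_def r box_index_flip_digit rademacher_flip_digit_other)
    show "x2.odd_at u (rfun L D a u)"
      using c by (auto simp: x2.odd_at_def fl2_def r box_index_flip_digit rademacher_flip_digit_same)
    show "x3.inv_from (L - a - u) (rfun L D a u)"
      unfolding c(4) using c by (auto simp: x3.inv_from_def fl3_def r box_index_flip_digit rademacher_flip_digit_other)
    show "x3.odd_at (L - 1 - a - u) (rfun L D a u)"
      unfolding c_def[symmetric] using c by (auto simp: x3.odd_at_def fl3_def r box_index_flip_digit rademacher_flip_digit_same)
  qed (use assms in auto)
qed

text \<open>The diagonal \<open>b + v + w = L - 1\<close> contributes \<open>rho / 512\<close> for each of about \<open>L\<^sup>2 / 2\<close> pairs.  Beyond it the bound of \<open>testf_part_le\<close> decays like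
  \<open>((1 + 8 * gam) / 2) ^ j\<close>, so that the total is of order \<open>gam * G * L\<close>, which is smaller by the factor \<open>gam\<close>.\<close>

lemma pairing_lower:
  fixes P :: "'p set" and g1 g2 g3 :: "'p \<Rightarrow> nat" and L :: nat and G :: real
  defines "D \<equiv> grid_disc L P g1 g2 g3"
  assumes P: "finite P" and N: "2 * card P \<le> 2 ^ (L - 1)" "2 ^ (L - 1) \<le> 4 * card P"
    and G: "1 \<le> G" and L: "0 < L" and big: "73728 * G \<le> sqrt (real L)"
  shows "G * real L / 2048 \<le> avg (grid3 L) (\<lambda>q. D q * Re (lines3.testf L (rfun L D) G q))"
proof -
  interpret lines3 "grid3 L" "fl1 L" "fl2 L" "fl3 L" L "rfun L D" G by (rule lines3_rfun[OF G L])
  define T where "T = (\<lambda>b v w. avg (grid3 L) (\<lambda>q. D q * Re (testf_part b v w q)))"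
  have Lp: "0 < real L" using L by simp
  have gam: "73728 * gam \<le> 1" using big Lp by (simp add: gam_def)
  define M :: real where "M = 2 ^ (L - 1)"
  have M0: "0 < M" by (simp add: M_def)
  have "real (2 * card P) \<le> real (2 ^ (L - 1))" using N(1) by (rule of_nat_mono)
  then have NM: "2 * real (card P) \<le> M" by (simp add: M_def)
  have diag: "T b v w = rho * avg (grid3 L) (\<lambda>q. D q * rfun L D b v q)" if "Suc (b + v + w) = L" for b v w
  proof -
    have "T b v w = avg (grid3 L) (\<lambda>q. rho * (D q * rfun L D b v q))"
      unfolding T_def using that by (intro avg_cong) (simp add: testf_part_small)
    then show ?thesis by (simp only: avg_cmult)
  qed
  have zero: "T b v w = 0" if "Suc (b + v + w) < L" for b v w
    unfolding T_def using that by (simp add: testf_part_small avg_def)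
  have off: "\<bar>T b v w\<bar> \<le> 12 * gam * G / real L * (3/4) ^ (Suc (b + v + w) - L)"
    if j: "L < Suc (b + v + w)" and blt: "b < L" "v < L" "w < L" for b v w
  proof -
    define j where "j = Suc (b + v + w) - L"
    have jj: "b + v + w = (L - 1) + j" using j L by (simp add: j_def)
    have "\<bar>T b v w\<bar> \<le> real (card P) * (24 * gam * G / real L * (1 + 8 * gam) ^ j) / 2 ^ (b + v + w)"
      unfolding T_def D_def
    proof (rule avg_grid_disc_le[OF blt])
      fix x assume x: "x \<in> grid3 L"
      show "Re (lines.testf_part L (rfun L (grid_disc L P g1 g2 g3)) G b v w (fl1 L b x)) = - Re (lines.testf_part L (rfun L (grid_disc L P g1 g2 g3)) G b v w x)"
        using testf_part_odd1[OF blt(1) x, of v w] by (simp add: D_def)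
      show "Re (lines.testf_part L (rfun L (grid_disc L P g1 g2 g3)) G b v w (fl2 L v x)) = - Re (lines.testf_part L (rfun L (grid_disc L P g1 g2 g3)) G b v w x)"
        using testf_part_odd2[OF blt(2) x, of b w] by (simp add: D_def)
      show "Re (lines.testf_part L (rfun L (grid_disc L P g1 g2 g3)) G b v w (fl3 L w x)) = - Re (lines.testf_part L (rfun L (grid_disc L P g1 g2 g3)) G b v w x)"
        using testf_part_odd3[OF blt(3) x, of b v] by (simp add: D_def)
      show "\<bar>Re (lines.testf_part L (rfun L (grid_disc L P g1 g2 g3)) G b v w x)\<bar> \<le> 24 * gam * G / real L * (1 + 8 * gam) ^ j"
        using order_trans[OF abs_Re_le_cmod testf_part_le[OF j x]] by (simp add: D_def j_def)
    qed
    also have "\<dots> = (real (card P) / M) * (24 * gam * G / real L) * ((1 + 8 * gam) / 2) ^ j"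
      by (simp add: jj power_add M_def power_divide mult_ac)
    also have "\<dots> \<le> (1/2) * (24 * gam * G / real L) * (3/4) ^ j"
      using NM M0 gam gam_pos G by (intro mult_mono power_mono) (auto simp: divide_le_eq)
    finally show ?thesis by (simp add: j_def mult_ac)
  qed
  have "avg (grid3 L) (\<lambda>q. D q * Re (testf q)) = (\<Sum>v<L. \<Sum>w<L. \<Sum>b<L. T b v w)"
    unfolding testf_def testf_level_eq_sum Re_sum sum_distrib_left avg_sum T_def ..
  also have "\<dots> = (\<Sum>v<L. \<Sum>b<L. \<Sum>w<L. T b v w)" by (intro sum.cong refl sum.swap)
  finally have total: "avg (grid3 L) (\<lambda>q. D q * Re (testf q)) = (\<Sum>v<L. \<Sum>b<L. \<Sum>w<L. T b v w)" .
  have each: "(\<Sum>v<L. \<Sum>b<L. of_bool (b + v < L) * (rho / 512) - 36 * gam * G / real L) \<le> (\<Sum>v<L. \<Sum>b<L. \<Sum>w<L. T b v w)"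
  proof (intro sum_mono)
    fix v b assume "v \<in> {..<L}" "b \<in> {..<L}"
    then have vb: "v < L" "b < L" by auto
    have low: "of_bool (Suc (b + v + w) = L) * (rho / 512) - of_bool (L < Suc (b + v + w)) * (12 * gam * G / real L * (3/4) ^ (Suc (b + v + w) - L)) \<le> T b v w"
      if w: "w < L" for w
    proof (cases "Suc (b + v + w) = L")
      case True
      have "1 / 512 \<le> avg (grid3 L) (\<lambda>q. D q * rfun L D b v q)"
        unfolding D_def by (rule avg_rfun_ge[OF P N]) (use True in simp)
      then have "rho * (1 / 512) \<le> T b v w" unfolding diag[OF True] using rho_pos by (intro mult_left_mono) auto
      then show ?thesis using True by simp
    next
      case False
      then show ?thesis using zero[of b v w] off[of b v w] vb w by (cases "Suc (b + v + w) < L") auto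
    qed
    have geo: "(\<Sum>w<L. of_bool (L < Suc (b + v + w)) * (3/4) ^ (Suc (b + v + w) - L)) \<le> (3::real)"
    proof -
      have "(\<Sum>w<L. of_bool (L < Suc (b + v + w)) * (3/4) ^ (Suc (b + v + w) - L))
         = (\<Sum>w\<in>{w. w < L \<and> L < Suc (b + v + w)}. (3/4::real) ^ (Suc (b + v + w) - L))"
        by (rule sum.mono_neutral_cong_right) auto
      also have "\<dots> = (\<Sum>j\<in>(\<lambda>w. Suc (b + v + w) - L) ` {w. w < L \<and> L < Suc (b + v + w)}. (3/4::real) ^ j)"
        by (subst sum.reindex) (auto simp: inj_on_def)
      also have "\<dots> \<le> (\<Sum>j=1..<3*L. (3/4::real) ^ j)"
        using vb by (intro sum_mono2) auto
      also have "\<dots> = (\<Sum>j<3*L. (3/4::real) ^ j) - 1"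
        using L by (simp add: lessThan_atLeast0 sum.atLeast_Suc_lessThan[of 0 "3*L"])
      also have "\<dots> \<le> 3" by (subst geometric_sum) auto
      finally show ?thesis .
    qed
    have one: "of_bool (b + v < L) \<le> (\<Sum>w<L. of_bool (Suc (b + v + w) = L) :: real)"
    proof (cases "b + v < L")
      case True
      then have "(1::real) \<le> (\<Sum>w<L. of_bool (Suc (b + v + w) = L))"
        using member_le_sum[of "L - Suc (b + v)" "{..<L}" "\<lambda>w. of_bool (Suc (b + v + w) = L) :: real"] by auto
      then show ?thesis using True by simp
    qed (simp add: sum_nonneg)
    have "of_bool (b + v < L) * (rho / 512) - 36 * gam * G / real L
      \<le> (\<Sum>w<L. of_bool (Suc (b + v + w) = L)) * (rho / 512) - 12 * gam * G / real L * (\<Sum>w<L. of_bool (L < Suc (b + v + w)) * (3/4) ^ (Suc (b + v + w) - L))"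
    proof (rule diff_mono)
      show "of_bool (b + v < L) * (rho / 512) \<le> (\<Sum>w<L. of_bool (Suc (b + v + w) = L)) * (rho / 512)"
        using rho_pos by (intro mult_right_mono one) simp
      have "12 * gam * G / real L * (\<Sum>w<L. of_bool (L < Suc (b + v + w)) * (3/4) ^ (Suc (b + v + w) - L)) \<le> 12 * gam * G / real L * 3"
        using gam_pos G by (intro mult_left_mono geo) auto
      then show "12 * gam * G / real L * (\<Sum>w<L. of_bool (L < Suc (b + v + w)) * (3/4) ^ (Suc (b + v + w) - L)) \<le> 36 * gam * G / real L" by simp
    qed
    also have "\<dots> = (\<Sum>w<L. of_bool (Suc (b + v + w) = L) * (rho / 512) - of_bool (L < Suc (b + v + w)) * (12 * gam * G / real L * (3/4) ^ (Suc (b + v + w) - L)))"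
      unfolding sum_subtractf sum_distrib_right sum_distrib_left by (simp only: mult_ac)
    also have "\<dots> \<le> (\<Sum>w<L. T b v w)" using low by (intro sum_mono) auto
    finally show "of_bool (b + v < L) * (rho / 512) - 36 * gam * G / real L \<le> (\<Sum>w<L. T b v w)" .
  qed
  have gen: "(\<Sum>v<L. \<Sum>b<L. h b v * c - d) = c * (\<Sum>v<L. \<Sum>b<L. h b v) - real L * (real L * d)"
    for h :: "nat \<Rightarrow> nat \<Rightarrow> real" and c d
    by (simp add: sum_subtractf sum_distrib_left mult_ac)
  have "real L * (real L * (36 * gam * G / real L)) = 36 * gam * G * real L" using Lp by simp
  then have split: "(\<Sum>v<L. \<Sum>b<L. of_bool (b + v < L) * (rho / 512) - 36 * gam * G / real L)
     = (rho / 512) * (\<Sum>v<L. \<Sum>b<L. of_bool (b + v < L)) - 36 * gam * G * real L"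
    unfolding gen by (simp only:)
  have "(rho / 512) * ((real L)\<^sup>2 / 2) - 36 * gam * G * real L \<le> (rho / 512) * (\<Sum>v<L. \<Sum>b<L. of_bool (b + v < L)) - 36 * gam * G * real L"
  proof (intro diff_right_mono mult_left_mono)
    have "(\<Sum>b<L. of_bool (b + v < L)) = real (L - v)" for v
    proof -
      have "(\<Sum>b<L. of_bool (b + v < L) :: real) = (\<Sum>b\<in>{..<L - v}. 1)"
        by (rule sum.mono_neutral_cong_right) auto
      then show ?thesis by simp
    qed
    then have e: "(\<Sum>v<L. \<Sum>b<L. of_bool (b + v < L)) = (\<Sum>v<L. real (L - v))" by simp
    have "(real L)\<^sup>2 / 2 \<le> (\<Sum>v<L. real (L - v))"
    proof -
      have "(\<Sum>v<L. real (L - v)) = (\<Sum>v<L. real L - real v)" by (intro sum.cong) (auto simp: of_nat_diff)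
      also have "\<dots> = (real L)\<^sup>2 - (\<Sum>v<L. real v)" by (simp add: sum_subtractf power2_eq_square)
      finally have e2: "(\<Sum>v<L. real (L - v)) = (real L)\<^sup>2 - (\<Sum>v<L. real v)" .
      have "(\<Sum>v<L. real v) \<le> (real L)\<^sup>2 / 2"
      proof -
        have "(\<Sum>v<n. real v) \<le> (real n)\<^sup>2 / 2" for n
          by (induction n) (auto simp: power2_eq_square algebra_simps)
        then show ?thesis .
      qed
      then show ?thesis unfolding e2 by simp
    qed
    then show "(real L)\<^sup>2 / 2 \<le> (\<Sum>v<L. \<Sum>b<L. of_bool (b + v < L))" unfolding e .
  qed (use rho_pos in auto)
  moreover have "(rho / 512) * ((real L)\<^sup>2 / 2) = G * real L / 1024"
    using Lp by (simp add: rho_def power2_eq_square)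
  ultimately have "G * real L / 1024 - 36 * gam * G * real L \<le> avg (grid3 L) (\<lambda>q. D q * Re (testf q))"
    using total each split by linarith
  moreover have "36 * gam * (G * real L) \<le> (1 / 2048) * (G * real L)"
    using gam G by (intro mult_right_mono) auto
  ultimately show ?thesis by simp
qed

section \<open>From the grid to the star discrepancy\<close>

text \<open>The box lies between the open and the closed box, which have the same measure.\<close>

lemma measure_half_open_box:
  fixes X :: "real^'d"
  assumes X: "\<And>i. 0 \<le> X $ i"
  shows "measure lebesgue (half_open_box 0 X) = (\<Prod>i\<in>UNIV. X $ i)"
proof -
  have eq: "half_open_box 0 X = (\<Inter>i. {y. 0 \<le> y $ i} \<inter> {y. y $ i < X $ i})"
    by (auto simp: half_open_box_def)
  have "half_open_box 0 X \<in> sets borel"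
    unfolding eq
    by (intro sets.countable_INT' sets.Int borel_closed borel_open closed_Collect_le
        open_Collect_less continuous_intros) auto
  then have meas: "half_open_box 0 X \<in> sets lborel" by simp
  have c: "measure lborel (cbox 0 X) = (\<Prod>i\<in>UNIV. X $ i)"
    using X by (subst content_cbox_cart) (auto simp: interval_eq_empty_cart not_less)
  have b: "measure lborel (box 0 X) = measure lborel (cbox 0 X)"
    by (simp add: measure_lborel_box_eq measure_lborel_cbox_eq)
  have "measure lborel (half_open_box 0 X) \<le> measure lborel (cbox 0 X)"
    using meas by (intro measure_mono_fmeasurable) (auto simp: half_open_box_def mem_box_cart less_imp_le)
  moreover have "measure lborel (box 0 X) \<le> measure lborel (half_open_box 0 X)"
  proof (rule measure_mono_fmeasurable)
    show "half_open_box 0 X \<in> fmeasurable lborel"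
      by (rule fmeasurableI2[of "cbox 0 X"]) (use meas in \<open>auto simp: half_open_box_def mem_box_cart less_imp_le\<close>)
  qed (auto simp: half_open_box_def mem_box_cart less_imp_le)
  ultimately show ?thesis using b c meas by simp
qed

lemma vec3_eq: "(\<chi> i. if i = 1 then a else if i = 2 then b else c) $ (1::3) = a"
  "(\<chi> i. if i = 1 then a else if i = 2 then b else c) $ (2::3) = b"
  "(\<chi> i. if i = 1 then a else if i = 2 then b else c) $ (3::3) = c"
  by auto

lemma prod_UNIV_3: "(\<Prod>i\<in>(UNIV :: 3 set). F i) = F 1 * F 2 * (F 3 :: real)"
  unfolding UNIV_3 by (simp add: mult.assoc)

lemma grid_disc_le_star:
  fixes P :: "(real^3) set"
  assumes P: "finite P" "P \<subseteq> unit_cube" and q: "q \<in> grid3 L"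
  defines "g \<equiv> \<lambda>i p. nat \<lfloor>(p :: real^3) $ i * 2 ^ L\<rfloor>"
  shows "\<bar>grid_disc L P (g 1) (g 2) (g 3) q\<bar> \<le> star_discrepancy P"
proof -
  obtain x y z where xyz: "q = (x, y, z)" by (cases q)
  have lt: "x < 2 ^ L" "y < 2 ^ L" "z < 2 ^ L" using q by (auto simp: xyz grid3_def grid1_def)
  define X :: "real^3" where "X = (\<chi> i. if i = 1 then coord L x else if i = 2 then coord L y else coord L z)"
  have X: "X $ 1 = coord L x" "X $ 2 = coord L y" "X $ 3 = coord L z" unfolding X_def by (rule vec3_eq)+
  have l1: "coord L t < 1" if "t < 2 ^ L" for t
  proof -
    have "real t < real (2 ^ L)" using that by (rule iffD2[OF of_nat_less_iff])
    then show ?thesis by (simp add: coord_def)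
  qed
  have Xnn: "0 \<le> X $ i" "X $ i < 1" for i
    using exhaust_3[of i] l1 lt by (auto simp: X coord_def)
  have Xu: "X \<in> unit_cube" by (simp add: unit_cube_def half_open_box_def Xnn)
  have key: "p $ i < coord L t \<longleftrightarrow> g i p < t" if "p \<in> P" for p i t
  proof -
    have p0: "0 \<le> p $ i" using P(2) that by (auto simp: unit_cube_def half_open_box_def)
    have "p $ i < coord L t \<longleftrightarrow> p $ i * 2 ^ L < real t" by (simp add: coord_def less_divide_eq)
    also have "\<dots> \<longleftrightarrow> \<lfloor>p $ i * 2 ^ L\<rfloor> < int t" by (simp add: floor_less_iff)
    also have "\<dots> \<longleftrightarrow> g i p < t" using p0 by (simp add: g_def nat_less_iff)
    finally show ?thesis .
  qed
  have mem: "p \<in> half_open_box 0 X \<longleftrightarrow> g 1 p < x \<and> g 2 p < y \<and> g 3 p < z" if "p \<in> P" for p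
  proof -
    have "0 \<le> p $ i" for i using P(2) that by (auto simp: unit_cube_def half_open_box_def)
    then show ?thesis using key[OF that] by (simp add: half_open_box_def forall_3 X)
  qed
  have "real (card (P \<inter> half_open_box 0 X)) = (\<Sum>p\<in>P. of_bool (p \<in> half_open_box 0 X))"
    using P(1) by (simp add: of_bool_def sum.If_cases Int_def)
  also have "\<dots> = (\<Sum>p\<in>P. below (g 1 p) x * below (g 2 p) y * below (g 3 p) z)"
  proof (rule sum.cong[OF refl])
    fix p assume "p \<in> P"
    show "of_bool (p \<in> half_open_box 0 X) = below (g 1 p) x * below (g 2 p) y * below (g 3 p) z"
      unfolding mem[OF \<open>p \<in> P\<close>] below_def of_bool_conj by (simp only: mult.assoc)
  qed
  finally have cnt: "real (card (P \<inter> half_open_box 0 X)) = (\<Sum>p\<in>P. below (g 1 p) x * below (g 2 p) y * below (g 3 p) z)" .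
  have "(\<Prod>i\<in>UNIV. X $ i) = coord L x * coord L y * coord L z" unfolding prod_UNIV_3 X ..
  then have "discrepancy P X = grid_disc L P (g 1) (g 2) (g 3) q"
    unfolding discrepancy_def measure_half_open_box[OF Xnn(1)] cnt by (simp only: grid_disc_def xyz prod.case)
  moreover have "\<bar>discrepancy P X\<bar> \<le> star_discrepancy P"
    unfolding star_discrepancy_def by (rule cSUP_upper[OF Xu bdd_above_discrepancy[OF P(1)]])
  ultimately show ?thesis by simp
qed

lemma exp_ge_fourth: "y ^ 4 / 256 \<le> exp y" if "0 \<le> y" for y :: real
proof -
  have "y / 4 \<le> exp (y / 4)" using exp_ge_add_one_self[of "y / 4"] by linarith
  then have "(y / 4) ^ 4 \<le> exp (y / 4) ^ 4" using that by (intro power_mono) auto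
  also have "exp (y / 4) ^ 4 = exp y" by (simp add: exp_of_nat_mult[symmetric])
  finally show ?thesis by (simp add: power_divide)
qed

text \<open>The group length \<open>l = G ^ 8\<close> is dictated by \<open>avg_even_sum_le\<close>.  The block length must satisfy \<open>b / (4 * l\<^sup>2) > 30 * G * sqrt L\<close>, so \<open>b\<close> is of order
  \<open>G ^ 18 * sqrt L\<close>; the requirement \<open>l * b \<le> L\<close> then amounts to \<open>2 * G ^ 26 \<le> sqrt L\<close>, which the exponent 57 grants.\<close>

lemma star_ge:
  fixes P :: "(real^3) set" and G L :: nat
  assumes P: "finite P" "P \<subseteq> unit_cube" and N: "2 * card P \<le> 2 ^ (L - 1)" "2 ^ (L - 1) \<le> 4 * card P"
    and G: "73728 \<le> G" and GL: "G ^ 57 \<le> L"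
  shows "real G * real L / (2048 * 10^8 * KK ^ 3) \<le> star_discrepancy P"
proof -
  define g where "g = (\<lambda>i p. nat \<lfloor>(p :: real^3) $ i * 2 ^ L\<rfloor>)"
  define D where "D = grid_disc L P (g 1) (g 2) (g 3)"
  define Gr where "Gr = real G"
  have Gr: "73728 \<le> Gr" using G by (simp add: Gr_def)
  then have Gr1: "1 \<le> Gr" by simp
  have GLr: "Gr ^ 57 \<le> real L" using GL by (simp add: Gr_def flip: of_nat_power)
  have gp: "c * Gr ^ k \<le> real L" if "c \<le> Gr" "Suc k \<le> 57" "0 \<le> c" for c k
  proof -
    have "c * Gr ^ k \<le> Gr * Gr ^ k" using that Gr1 by (intro mult_right_mono) auto
    also have "\<dots> = Gr ^ Suc k" by simp
    also have "\<dots> \<le> Gr ^ 57" using that Gr1 by (intro power_increasing) auto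
    finally show ?thesis using GLr by linarith
  qed
  have Lp: "0 < real L" using gp[of 1 0] Gr1 by simp
  then have L0: "0 < L" by simp
  define Q where "Q = sqrt (real L)"
  have Q2: "Q * Q = real L" by (simp add: Q_def)
  have Q0: "0 < Q" using Lp by (simp add: Q_def)
  have gq: "c * Gr ^ k \<le> Q" if "c \<le> Gr" "Suc k \<le> 28" "0 \<le> c" for c k
  proof -
    have "c * Gr ^ k \<le> Gr * Gr ^ k" using that Gr1 by (intro mult_right_mono) auto
    also have "\<dots> = Gr ^ Suc k" by simp
    also have "\<dots> \<le> Gr ^ 28" using that Gr1 by (intro power_increasing) auto
    also have "\<dots> \<le> Q" unfolding Q_def
    proof (rule real_le_rsqrt)
      have "Gr ^ 56 \<le> Gr ^ 57" using Gr1 by (intro power_increasing) auto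
      then show "(Gr ^ 28)\<^sup>2 \<le> real L" using GLr by (simp flip: power_mult)
    qed
    finally show ?thesis .
  qed
  define l where "l = G ^ 8"
  have lr: "real l = Gr ^ 8" by (simp add: l_def Gr_def)
  have l0: "0 < l" using G by (simp add: l_def)
  define b where "b = nat \<lceil>Gr ^ 18 * Q\<rceil>"
  have GQ: "1 \<le> Gr ^ 18 * Q"
  proof -
    have "1 \<le> Q" using gq[of 1 0] Gr1 by simp
    then have "1 * 1 \<le> Gr ^ 18 * Q" using Gr1 by (intro mult_mono) auto
    then show ?thesis by simp
  qed
  have b_ge: "Gr ^ 18 * Q \<le> real b" unfolding b_def by (rule real_nat_ceiling_ge)
  have b_le: "real b \<le> 2 * (Gr ^ 18 * Q)"
  proof -
    have "real b \<le> Gr ^ 18 * Q + 1" unfolding b_def using GQ by linarith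
    then show ?thesis using GQ by linarith
  qed
  have b0: "0 < b" using b_ge GQ by (cases b) auto
  interpret lines3 "grid3 L" "fl1 L" "fl2 L" "fl3 L" L "rfun L D" Gr by (rule lines3_rfun[OF Gr1 L0])
  have T: "avg (grid3 L) (\<lambda>x. cmod (testf x)) \<le> 10^8 * KK ^ 3"
  proof (rule avg_testf_le[OF lr l0 b0])
    show "64 * Gr\<^sup>2 \<le> real L" using gp[of 64 2] Gr by simp
    have "real (l * b) \<le> Gr ^ 8 * (2 * (Gr ^ 18 * Q))"
      using b_le Gr1 by (simp add: lr mult_left_mono)
    also have "\<dots> = (2 * Gr ^ 26) * Q" by (simp flip: power_add)
    also have "\<dots> \<le> Q * Q" using gq[of 2 26] Gr Q0 by (intro mult_right_mono) auto
    finally have "real (l * b) \<le> real L" using Q2 by simp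
    then show "l * b \<le> L" by (rule of_nat_le_iff[THEN iffD1])
    show "Gr\<^sup>2 * real l ^ 3 \<le> real L" using gp[of 1 26] Gr1 by (simp add: lr flip: power_mult power_add)
    have e1: "30 * Gr * Q - real b / (4 * (real l)\<^sup>2) \<le> - Q"
    proof -
      have l2: "(real l)\<^sup>2 = Gr ^ 16" by (simp add: lr flip: power_mult)
      have "Gr\<^sup>2 * Q / 4 = Gr ^ 18 * Q / (4 * Gr ^ 16)"
      proof -
        have "Gr ^ 18 = Gr ^ 16 * Gr\<^sup>2" by (simp flip: power_add)
        then have "Gr ^ 18 * Q = Gr\<^sup>2 * Q * Gr ^ 16" by (simp only: mult_ac)
        then show ?thesis using Gr1 by (simp add: field_simps)
      qed
      also have "\<dots> \<le> real b / (4 * Gr ^ 16)" using b_ge Gr1 by (intro divide_right_mono) auto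
      finally have 1: "Gr\<^sup>2 * Q / 4 \<le> real b / (4 * (real l)\<^sup>2)" unfolding l2 .
      have "(124 * Gr) * Q \<le> (Gr * Gr) * Q" using Gr Q0 by (intro mult_right_mono) auto
      then have "31 * Gr * Q \<le> Gr\<^sup>2 * Q / 4" by (simp add: power2_eq_square)
      moreover have "1 * Q \<le> Gr * Q" using Gr1 Q0 by (intro mult_right_mono) auto
      ultimately show ?thesis using 1 by linarith
    qed
    have "exp (30 * Gr * Q - real b / (4 * (real l)\<^sup>2)) \<le> exp (- Q)" using e1 by simp
    also have "\<dots> \<le> 256 / Q ^ 4"
    proof -
      have "0 < Q ^ 4" using Q0 by simp
      then have "1 / exp Q \<le> 1 / (Q ^ 4 / 256)" using exp_ge_fourth[of Q] Q0 by (intro divide_left_mono) auto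
      then show ?thesis by (simp add: exp_minus inverse_eq_divide)
    qed
    also have "Q ^ 4 = real L * real L" by (simp add: Q2[symmetric] power4_eq_xxxx)
    finally have "real l ^ 3 * exp (30 * Gr * Q - real b / (4 * (real l)\<^sup>2)) \<le> Gr ^ 24 * (256 / (real L * real L))"
      using Gr1 by (intro mult_mono) (auto simp: lr simp flip: power_mult)
    also have "\<dots> = (256 * Gr ^ 24) / (real L * real L)" by simp
    also have "\<dots> \<le> real L / (real L * real L)" using gp[of 256 24] Gr Lp by (intro divide_right_mono) auto
    also have "\<dots> = 1 / real L" using Lp by simp
    also have "\<dots> \<le> 32 * Gr\<^sup>2 / real L"
    proof (intro divide_right_mono)
      have "1 \<le> Gr\<^sup>2" using Gr1 by simp
      then show "1 \<le> 32 * Gr\<^sup>2" by linarith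
    qed simp
    finally show "real l ^ 3 * exp (30 * Gr * sqrt (real L) - real b / (4 * (real l)\<^sup>2)) \<le> 32 * Gr\<^sup>2 / real L"
      by (simp add: Q_def)
  qed
  have "Gr * real L / 2048 \<le> avg (grid3 L) (\<lambda>q. D q * Re (lines3.testf L (rfun L D) Gr q))"
    unfolding D_def
  proof (rule pairing_lower[OF P(1) N Gr1 L0])
    have "73728 * Gr \<le> Gr * Gr" using Gr Gr1 by (intro mult_right_mono) auto
    also have "\<dots> \<le> Q" using gq[of 1 2] Gr1 by (simp add: power2_eq_square)
    finally show "73728 * Gr \<le> sqrt (real L)" by (simp add: Q_def)
  qed
  also have "\<dots> \<le> avg (grid3 L) (\<lambda>q. star_discrepancy P * cmod (testf q))"
  proof (rule avg_mono)
    fix q assume q: "q \<in> grid3 L"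
    have "D q * Re (testf q) \<le> \<bar>D q\<bar> * \<bar>Re (testf q)\<bar>" by (simp flip: abs_mult)
    also have "\<dots> \<le> star_discrepancy P * cmod (testf q)"
      using grid_disc_le_star[OF P q] abs_Re_le_cmod[of "testf q"] unfolding D_def g_def
      by (intro mult_mono) (auto intro: order_trans[OF abs_ge_zero])
    finally show "D q * Re (testf q) \<le> star_discrepancy P * cmod (testf q)" .
  qed
  also have "\<dots> = star_discrepancy P * avg (grid3 L) (\<lambda>q. cmod (testf q))" by (rule avg_cmult)
  also have "\<dots> \<le> star_discrepancy P * (10^8 * KK ^ 3)"
  proof (rule mult_left_mono[OF T])
    obtain q where "q \<in> grid3 L" using grid3_fin(2) by blast
    from grid_disc_le_star[OF P this] show "0 \<le> star_discrepancy P" by linarith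
  qed
  finally have le: "Gr * real L / 2048 \<le> star_discrepancy P * (10^8 * KK ^ 3)" .
  have "0 < 10^8 * KK ^ 3" using KK1 by simp
  with le have "Gr * real L / 2048 / (10^8 * KK ^ 3) \<le> star_discrepancy P" by (simp only: pos_divide_le_eq)
  then show ?thesis by (simp only: Gr_def divide_divide_eq_left mult.assoc)
qed

lemma greatest_root:
  fixes L a k :: nat
  assumes "0 < k" "a ^ k \<le> L"
  obtains g where "g ^ k \<le> L" "a \<le> g" "L < (g + 1) ^ k"
proof -
  define g where "g = (GREATEST g. g ^ k \<le> L)"
  have bnd: "x \<le> L" if "x ^ k \<le> L" for x
    using self_le_power[of x k] that assms(1) by (cases "x = 0") auto
  show thesis
  proof
    show "g ^ k \<le> L" unfolding g_def by (rule GreatestI_nat[of _ a L]) (use assms bnd in auto)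
    show "a \<le> g" unfolding g_def by (rule Greatest_le_nat[of _ _ L]) (use assms bnd in auto)
    show "L < (g + 1) ^ k"
    proof (rule ccontr)
      assume "\<not> ?thesis"
      then have "(g + 1) ^ k \<le> L" by simp
      then have "g + 1 \<le> g" unfolding g_def by (rule Greatest_le_nat[of _ _ L]) (use bnd in auto)
      then show False by simp
    qed
  qed
qed

lemma powr_inverse_le:
  fixes x y :: real
  assumes "0 < e" "0 \<le> x" "0 < y" "x \<le> y ^ e"
  shows "x powr (1 / real e) \<le> y"
proof -
  have "x powr (1 / real e) \<le> (y ^ e) powr (1 / real e)" using assms by (intro powr_mono2) auto
  also have "\<dots> = y powr (real e * (1 / real e))" using assms by (simp add: powr_realpow[symmetric] powr_powr)
  also have "\<dots> = y" using assms by simp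
  finally show ?thesis .
qed

lemma dyadic_scale:
  fixes N a e :: nat
  assumes N: "2 ^ (a ^ e) \<le> N" and e: "0 < e" and N1: "1 \<le> N"
  obtains k g where "2 ^ k \<le> N" "N < 2 ^ (k + 1)" "a \<le> g" "g ^ e \<le> k + 3" "k + 3 < (g + 1) ^ e"
proof -
  obtain k where k: "2 ^ k \<le> N" "N < 2 ^ (k + 1)" using ex_power_ivl1[of 2 N] N1 by auto
  have "(2::nat) ^ (a ^ e) < 2 ^ (k + 1)" using N k(2) by (rule le_less_trans)
  then have "a ^ e < k + 1" by (rule power_less_imp_less_exp[rotated]) simp
  then have "a ^ e \<le> k + 3" by simp
  then obtain g where "g ^ e \<le> k + 3" "a \<le> g" "k + 3 < (g + 1) ^ e"
    using greatest_root[OF e] by blast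
  then show thesis using that k by blast
qed

theorem theorem1p1:
  fixes \<eta> :: real
  assumes "\<eta> < 1 / (32 + 4 * sqrt 41)"
  shows "\<exists>C::real. C > 0 \<and> (\<exists>N\<^sub>0::nat. \<forall>N\<ge>N\<^sub>0. \<forall>P::(real^3) set.
           finite P \<and> card P = N \<and> P \<subseteq> unit_cube \<longrightarrow>
           star_discrepancy P \<ge> C * (ln (real N)) powr (1 + \<eta>))"
proof -
  define C where "C = 1 / (4096 * 10^8 * KK ^ 3)"
  have K: "0 < KK ^ 3" using KK1 by simp
  have eta: "\<eta> \<le> 1 / 57"
  proof -
    have "6.25 \<le> sqrt (41::real)" by (rule real_le_rsqrt) (simp add: power2_eq_square)
    then have "1 / (32 + 4 * sqrt 41) \<le> 1 / (57::real)" by (intro divide_left_mono) auto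
    then show ?thesis using assms by linarith
  qed
  define N0 :: nat where "N0 = max 4 (2 ^ (73728 ^ 57))"
  have N0: "4 \<le> N0" "2 ^ (73728 ^ 57) \<le> N0" unfolding N0_def by (rule max.cobounded1 max.cobounded2)+
  have "C * (ln (real N)) powr (1 + \<eta>) \<le> star_discrepancy P"
    if N: "N0 \<le> N" and P: "finite P" "card P = N" "P \<subseteq> unit_cube" for N and P :: "(real^3) set"
  proof -
    have N4: "4 \<le> N" by (rule order_trans[OF N0(1) N])
    have "1 \<le> N" using N4 by simp
    then obtain k G where k: "2 ^ k \<le> N" "N < 2 ^ (k + 1)"
      and G: "73728 \<le> G" "G ^ 57 \<le> k + 3" "k + 3 < (G + 1) ^ 57"
      by (rule dyadic_scale[OF order_trans[OF N0(2) N] zero_less_numeral])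
    \<comment> \<open>Then \<open>2 ^ (L - 1) = 4 * 2 ^ k\<close> lies between \<open>2 * N\<close> and \<open>4 * N\<close>.\<close>
    define L where "L = k + 3"
    have lnN: "ln (real N) \<le> real L"
    proof -
      have "real N < 2 ^ (k + 1)" using k(2) by (metis of_nat_less_iff of_nat_numeral of_nat_power)
      then have "ln (real N) \<le> ln (2 ^ (k + 1))" using N4 by (intro ln_mono) auto
      also have "\<dots> = real (k + 1) * ln 2" by (rule ln_realpow)
      also have "\<dots> \<le> real (k + 1) * 1" using ln_2_less_1 by (intro mult_left_mono) auto
      finally show ?thesis by (simp add: L_def)
    qed
    have ln1: "1 \<le> ln (real N)"
    proof -
      have "exp 1 \<le> real N" using exp_le N4 by linarith
      then show ?thesis using N4 by (simp add: ln_ge_iff)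
    qed
    have Lp: "0 < real L" by (simp add: L_def)
    have "(ln (real N)) powr (1 + \<eta>) \<le> (ln (real N)) powr (1 + 1 / 57)"
      using ln1 eta by (intro powr_mono) auto
    also have "\<dots> \<le> real L powr (1 + 1 / 57)" using lnN ln1 by (intro powr_mono2) auto
    also have "\<dots> = real L * real L powr (1 / 57)" unfolding powr_add using Lp by simp
    also have "\<dots> \<le> real L * (2 * real G)"
    proof (intro mult_left_mono)
      have "real L \<le> real ((G + 1) ^ 57)" unfolding L_def using less_imp_le[OF G(3)] by (rule of_nat_mono)
      also have "\<dots> = (real G + 1) ^ 57" by (simp only: of_nat_power of_nat_add of_nat_1)
      finally have "real L powr (1 / real 57) \<le> real G + 1" by (intro powr_inverse_le) auto
      also have "\<dots> \<le> 2 * real G" using G(1) by simp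
      finally show "real L powr (1 / 57) \<le> 2 * real G" by simp
    qed simp
    finally have "C * (ln (real N)) powr (1 + \<eta>) \<le> C * (real L * (2 * real G))"
      using K by (intro mult_left_mono) (auto simp: C_def)
    also have "\<dots> = real G * real L / (2048 * 10^8 * KK ^ 3)" by (simp add: C_def)
    also have "\<dots> \<le> star_discrepancy P"
    proof (rule star_ge[OF P(1,3) _ _ G(1) G(2)[folded L_def]])
      have e: "(2::nat) ^ (L - 1) = 4 * 2 ^ k" by (simp add: L_def)
      show "2 * card P \<le> 2 ^ (L - 1)" unfolding e using k P(2) by simp
      show "2 ^ (L - 1) \<le> 4 * card P" unfolding e using k P(2) by simp
    qed
    finally show ?thesis .
  qed
  moreover have "0 < C" using K by (simp add: C_def)
  ultimately show ?thesis by blast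
qed

end
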